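(* Let $(M,\boldsymbol{c})$ be a conformal manifold of dimension $n\ge3$, $1\le d\le n-1$, and $\mathbb{W}(d):=\Lambda^d\mathbb{R}^{n+2}$, where $\mathbb{R}^{n+2}$ is the defining representation of $G=\mathrm{SO}(h)$. Let $\mathbb{V}_1,\dots,\mathbb{V}_k$ be irreducible representation spaces of $G$, $\mathcal{V}_i=\mathcal{G}\times_P\mathbb{V}_i$ the corresponding tractor bundles, and $\mathcal{D}^{\mathcal{V}_i}$, $i\in\{1,\dots,k\}$, the corresponding respective first BGG operators. For each $i$ suppose that $\sigma_i$ is a normal solution to the first BGG equation $\mathcal{D}^{\mathcal{V}_i}\sigma_i=0$, and let $m_0,m_1,\dots,m_k\in\mathbb{Z}_{\ge0}$. Then for each copy of the trivial $G$-representation $\mathbb{R}$ in $$(\odot^{m_0}\mathbb{W}(d))\otimes(\odot^{m_1}\mathbb{V}_1)\otimes\cdots\otimes(\odot^{m_k}\mathbb{V}_k)$$ there is a corresponding first integral for distinguished submanifolds of codimension $d$: if $\varphi$ is the corresponding $G$-invariant linear functional on this tensor product (inducing a parallel bundle functional on the associated bundle), $S_i\in\Gamma(\mathcal{V}_i)$ is the parallel tractor corresponding to $\sigma_i$, and $N$ is the tractor normal form of a distinguished submanifold $\Sigma$ of codimension $d$, then the function $$\varphi\big((\odot^{m_0}N)\otimes(\odot^{m_1}S_1)\otimes\cdots\otimes(\odot^{m_k}S_k)\big)$$ is constant along (each connected component of) $\Sigma$.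
   Context: Conformal tractors. $(M,\boldsymbol{c})$ is a smooth connected oriented $n$-manifold with a class of conformally related Riemannian metrics. Sections of $\mathcal{E}[w]$ are classes of pairs $(g,f)\sim(\Omega^2g,\Omega^wf)$; $\mathcal{B}[w]:=\mathcal{B}\otimes\mathcal{E}[w]$; the conformal metric $\boldsymbol{g}$ is the class of $(g,g)$ and raises and lowers indices. For $g\in\boldsymbol{c}$, $\nabla$ is the Levi-Civita connection, $R_{ab}$ the Ricci tensor (positive on spheres), $P_{ab}$ is defined by $R_{ab}=(n-2)P_{ab}+J\boldsymbol{g}_{ab}$, $J=\boldsymbol{g}^{ab}P_{ab}$. The standard tractor bundle $\mathcal{T}$ is identified by $g\in\boldsymbol{c}$ with $\mathcal{E}[1]\oplus T^*M[1]\oplus\mathcal{E}[-1]$, $V=(\sigma,\mu_a,\rho)$; for $\hat g=\Omega^2g$, $\Upsilon_a=\Omega^{-1}\nabla_a\Omega$, the triple becomes $(\sigma,\mu_a+\Upsilon_a\sigma,\rho-\Upsilon^b\mu_b-\tfrac12\Upsilon^b\Upsilon_b\sigma)$. The canonical tractor $X\in\Gamma(\mathcal{T}[1])$ is the inclusion $\rho\mapsto(0,0,\rho)$. The invariant tractor metric is $h(V,V)=2\sigma\rho+\boldsymbol{g}^{ab}\mu_a\mu_b$ and the invariant tractor connection is $\nabla_a(\sigma,\mu_b,\rho)=(\nabla_a\sigma-\mu_a,\nabla_a\mu_b+P_{ab}\sigma+\boldsymbol{g}_{ab}\rho,\nabla_a\rho-P_{ab}\mu^b)$. Tractor bundles and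 BGG. $G=\mathrm{SO}(h)$ is the group of $\mathbb{R}^{n+2}$ with its Lorentzian form $h$ (signature $(n+1,1)$), taken to be the identity component $\mathrm{SO}_0(n+1,1)$ in forming the model $S^n=G/P$; $P\subset G$ is the stabiliser of a null ray. $\mathcal{G}\to M$ is the $P$-principal (Cartan) bundle, i.e. the bundle of oriented and time-oriented $h$-orthonormal identifications of $\mathcal{T}$ with $\mathbb{R}^{n+2}$ taking the ray of $X$ to the fixed null ray; so $\mathcal{T}=\mathcal{G}\times_P\mathbb{R}^{n+2}$. For a $G$-representation $\mathbb{V}$, $\mathcal{V}=\mathcal{G}\times_P\mathbb{V}$ carries the tractor connection induced from that of $\mathcal{T}$. For $\mathbb{V}$ irreducible, $\mathbb{V}^0$ is its largest proper $P$-invariant filtration component, $\mathcal{H}_0=\mathcal{V}/\mathcal{V}^0$, and $\pi:\mathcal{V}\to\mathcal{H}_0$ the projection. With $\partial^*:\Lambda^kT^*M\otimes\mathcal{V}\to\Lambda^{k-1}T^*M\otimes\mathcal{V}$ the Kostant codifferential induced by the action of $T^*M\subset\mathrm{End}(\mathcal{T})$ (via $\omega_a\mapsto X_{[A}Z_{B]}^a\omega_a$), and $\mathcal{H}_1=\ker\partial^*/\operatorname{im}\partial^*$ in degree one, there is a unique invariant differential operator $L:\mathcal{H}_0\to\mathcal{V}$ with $\pi\circ L=\mathrm{id}$ and $\nabla\circ L$ valued in $\ker\partial^*$; the first BGG operator $\mathcal{D}^{\mathcal{V}}:\mathcal{H}_0\to\mathcal{H}_1$ is the projection of $\nabla L$.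 The map $\pi$ is injective on parallel sections of $\mathcal{V}$ and sends them into $\ker\mathcal{D}^{\mathcal{V}}$; a normal solution is $\sigma=\pi(S)$ with $S$ parallel, and then $S=L(\sigma)$ is the corresponding parallel tractor. Distinguished submanifolds. For an embedded oriented submanifold $\Sigma$ of codimension $d$, dimension $m=n-d$: $H^c=\frac1m\boldsymbol{g}^{ij}I\!I_{ij}{}^c$ is the mean curvature for $g\in\boldsymbol{c}$; the normal tractor bundle $\mathcal{N}\subset\mathcal{T}|_\Sigma$ is the image of $N\Sigma[-1]$ under the invariant map $n^a\mapsto(0,n_a,n_cH^c)$, with orthogonal projection $\mathrm{N}^A_B$; the tractor normal form $N_{A_1\cdots A_d}$ is the section of $\Lambda^d\mathcal{N}^*\cong\Lambda^d\mathcal{N}$ compatible with orientations with $N^{A_1\cdots A_d}N_{A_1\cdots A_d}=d!$. $\Sigma$ is distinguished if the tractor second fundamental form $\mathbb{L}_i{}^C(V)=\mathrm{N}^C_A\nabla_iV^A$, $V\in\Gamma(\mathcal{N}^\perp)$, vanishes. *)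

theory Defs
  imports "HOL-Analysis.Analysis"
begin

section \<open>Calculus on open subsets of Euclidean space\<close>

fun Ck_on :: "nat \<Rightarrow> 'a::euclidean_space set \<Rightarrow> ('a \<Rightarrow> 'b::real_normed_vector) \<Rightarrow> bool" where
  "Ck_on 0 U f = continuous_on U f"
| "Ck_on (Suc k) U f =
     ((\<forall>x\<in>U. f differentiable (at x)) \<and>
      (\<forall>b\<in>Basis. Ck_on k U (\<lambda>x. frechet_derivative f (at x) b)))"

text \<open>Only used for open \<open>U\<close>.\<close>
definition smooth_on :: "'a::euclidean_space set \<Rightarrow> ('a \<Rightarrow> 'b::real_normed_vector) \<Rightarrow> bool" where
  "smooth_on U f \<longleftrightarrow> (\<forall>k. Ck_on k U f)"

definition pd :: "'n::finite \<Rightarrow> (real^'n \<Rightarrow> 'b::real_normed_vector) \<Rightarrow> real^'n \<Rightarrow> 'b" where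
  "pd a f y = vector_derivative (\<lambda>t. f (y + t *\<^sub>R axis a 1)) (at 0)"


section \<open>Oriented smooth manifolds\<close>

text \<open>The manifold is the whole space \<open>'m\<close>; its dimension is \<open>CARD('n)\<close>. A chart is a pair of a domain
  and a coordinate map, whose values outside the domain are irrelevant.\<close>

type_synonym ('m, 'n) chart = "'m set \<times> ('m \<Rightarrow> (real, 'n) vec)"

abbreviation cdom :: "('m, 'n) chart \<Rightarrow> 'm set" where
  "cdom \<equiv> fst"

abbreviation coord :: "('m, 'n) chart \<Rightarrow> 'm \<Rightarrow> (real, 'n) vec" where
  "coord \<equiv> snd"

abbreviation cinv :: "('m, 'n) chart \<Rightarrow> (real, 'n) vec \<Rightarrow> 'm" where
  "cinv \<kappa> \<equiv> inv_into (cdom \<kappa>) (coord \<kappa>)"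

definition is_chart :: "('m::topological_space, 'n::finite) chart \<Rightarrow> bool" where
  "is_chart \<kappa> \<longleftrightarrow> open (cdom \<kappa>) \<and> open (coord \<kappa> ` cdom \<kappa>) \<and>
     homeomorphism (cdom \<kappa>) (coord \<kappa> ` cdom \<kappa>) (coord \<kappa>) (cinv \<kappa>)"

text \<open>\<open>jac \<kappa> \<kappa>' x $ i $ j\<close> is the derivative of the \<open>i\<close>-th coordinate of \<open>\<kappa>'\<close> with respect to the
  \<open>j\<close>-th coordinate of \<open>\<kappa>\<close>.\<close>
definition jac :: "('m, 'n::finite) chart \<Rightarrow> ('m, 'n) chart \<Rightarrow> 'm \<Rightarrow> real^'n^'n" where
  "jac \<kappa> \<kappa>' x = matrix (frechet_derivative (coord \<kappa>' \<circ> cinv \<kappa>) (at (coord \<kappa> x)))"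

definition compatible :: "('m, 'n::finite) chart \<Rightarrow> ('m, 'n) chart \<Rightarrow> bool" where
  "compatible \<kappa> \<kappa>' \<longleftrightarrow>
     smooth_on (coord \<kappa> ` (cdom \<kappa> \<inter> cdom \<kappa>')) (coord \<kappa>' \<circ> cinv \<kappa>) \<and>
     (\<forall>x\<in>cdom \<kappa> \<inter> cdom \<kappa>'. det (jac \<kappa> \<kappa>' x) > 0)"

definition oriented_smooth_structure :: "('m::topological_space, 'n::finite) chart set \<Rightarrow> bool" where
  "oriented_smooth_structure A \<longleftrightarrow>
     (\<forall>\<kappa>\<in>A. is_chart \<kappa>) \<and> (\<Union>\<kappa>\<in>A. cdom \<kappa>) = UNIV \<and>
     (\<forall>\<kappa>\<in>A. \<forall>\<kappa>'\<in>A. compatible \<kappa> \<kappa>') \<and>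
     (\<forall>\<kappa>. is_chart \<kappa> \<and> (\<forall>\<kappa>'\<in>A. compatible \<kappa> \<kappa>' \<and> compatible \<kappa>' \<kappa>) \<longrightarrow> \<kappa> \<in> A)"

definition msmooth :: "('m, 'n::finite) chart set \<Rightarrow> 'm set \<Rightarrow> ('m \<Rightarrow> 'b::real_normed_vector) \<Rightarrow> bool" where
  "msmooth A W f \<longleftrightarrow> (\<forall>\<kappa>\<in>A. smooth_on (coord \<kappa> ` (W \<inter> cdom \<kappa>)) (f \<circ> cinv \<kappa>))"


section \<open>Conformal structures\<close>

text \<open>A metric is given by its components: \<open>g \<kappa> y $ a $ b\<close> at the point with \<open>\<kappa>\<close>-coordinates \<open>y\<close>.\<close>

type_synonym ('m, 'n) metric = "('m, 'n) chart \<Rightarrow> (real, 'n) vec \<Rightarrow> ((real, 'n) vec, 'n) vec"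

definition riemannian :: "('m, 'n::finite) chart set \<Rightarrow> ('m, 'n) metric \<Rightarrow> bool" where
  "riemannian A g \<longleftrightarrow>
     (\<forall>\<kappa>\<in>A. smooth_on (coord \<kappa> ` cdom \<kappa>) (g \<kappa>) \<and>
        (\<forall>y\<in>coord \<kappa> ` cdom \<kappa>. transpose (g \<kappa> y) = g \<kappa> y \<and> (\<forall>v. v \<noteq> 0 \<longrightarrow> v \<bullet> (g \<kappa> y *v v) > 0))) \<and>
     (\<forall>\<kappa>\<in>A. \<forall>\<kappa>'\<in>A. \<forall>x\<in>cdom \<kappa> \<inter> cdom \<kappa>'.
        g \<kappa> (coord \<kappa> x) = transpose (jac \<kappa> \<kappa>' x) ** g \<kappa>' (coord \<kappa>' x) ** jac \<kappa> \<kappa>' x)"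

text \<open>\<open>g'\<close> is the metric \<open>\<Omega>\<^sup>2 g\<close>.\<close>
definition rescaling :: "('m, 'n::finite) chart set \<Rightarrow> ('m \<Rightarrow> real) \<Rightarrow> ('m, 'n) metric \<Rightarrow> ('m, 'n) metric \<Rightarrow> bool" where
  "rescaling A \<Omega> g g' \<longleftrightarrow> msmooth A UNIV \<Omega> \<and> (\<forall>x. \<Omega> x > 0) \<and>
     (\<forall>\<kappa>\<in>A. \<forall>x\<in>cdom \<kappa>. g' \<kappa> (coord \<kappa> x) = (\<Omega> x)\<^sup>2 *\<^sub>R g \<kappa> (coord \<kappa> x))"

definition conformal_class :: "('m, 'n::finite) chart set \<Rightarrow> ('m, 'n) metric set \<Rightarrow> bool" where
  "conformal_class A c \<longleftrightarrow> c \<noteq> {} \<and> (\<forall>g\<in>c. riemannian A g) \<and>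
     (\<forall>g\<in>c. \<forall>g'\<in>c. \<exists>\<Omega>. rescaling A \<Omega> g g') \<and>
     (\<forall>g\<in>c. \<forall>g'. riemannian A g' \<and> (\<exists>\<Omega>. rescaling A \<Omega> g g') \<longrightarrow> g' \<in> c)"

text \<open>Curvature of the metric with components \<open>G\<close> in a chart. \<open>christoffel G y c a b\<close> has upper index
  \<open>c\<close>; the Ricci tensor is positive on spheres. Taking the trace of
  \<open>R\<^sub>a\<^sub>b = (n-2) P\<^sub>a\<^sub>b + J g\<^sub>a\<^sub>b\<close>, where \<open>J = g\<^sup>a\<^sup>b P\<^sub>a\<^sub>b\<close>, gives \<open>J\<close> as the scalar curvature divided by
  \<open>2(n-1)\<close>.\<close>

definition christoffel :: "(real^'n \<Rightarrow> real^'n^'n) \<Rightarrow> real^'n \<Rightarrow> 'n \<Rightarrow> 'n \<Rightarrow> 'n::finite \<Rightarrow> real" where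
  "christoffel G y c a b = (1/2) * (\<Sum>e\<in>UNIV. matrix_inv (G y) $ c $ e *
     (pd a (\<lambda>z. G z $ b $ e) y + pd b (\<lambda>z. G z $ a $ e) y - pd e (\<lambda>z. G z $ a $ b) y))"

definition ricci :: "(real^'n \<Rightarrow> real^'n^'n) \<Rightarrow> real^'n \<Rightarrow> 'n \<Rightarrow> 'n::finite \<Rightarrow> real" where
  "ricci G y a b =
     (\<Sum>c\<in>UNIV. pd c (\<lambda>z. christoffel G z c a b) y) - (\<Sum>c\<in>UNIV. pd a (\<lambda>z. christoffel G z c c b) y)
     + (\<Sum>c\<in>UNIV. \<Sum>e\<in>UNIV. christoffel G y c c e * christoffel G y e a b
                         - christoffel G y c a e * christoffel G y e c b)"

definition schouten_J :: "(real^'n \<Rightarrow> real^'n^'n) \<Rightarrow> real^'n::finite \<Rightarrow> real" where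
  "schouten_J G y = (\<Sum>a\<in>UNIV. \<Sum>b\<in>UNIV. matrix_inv (G y) $ a $ b * ricci G y a b)
     / (2 * (real CARD('n) - 1))"

definition schouten :: "(real^'n \<Rightarrow> real^'n^'n) \<Rightarrow> real^'n \<Rightarrow> 'n \<Rightarrow> 'n::finite \<Rightarrow> real" where
  "schouten G y a b = (ricci G y a b - schouten_J G y * G y $ a $ b) / (real CARD('n) - 2)"


section \<open>The model\<close>

datatype 'n tidx = Top | Mid 'n | Bot

instance tidx :: (finite) finite
proof
  have "(UNIV :: 'a tidx set) = {Top, Bot} \<union> range Mid"
    using tidx.exhaust by auto
  then show "finite (UNIV :: 'a tidx set)"
    by (metis finite.emptyI finite.insertI finite_UnI finite_imageI finite)
qed

definition tvec :: "real \<Rightarrow> real^'n \<Rightarrow> real \<Rightarrow> real^('n::finite) tidx" where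
  "tvec \<sigma> \<mu> \<rho> = (\<chi> i. case i of Top \<Rightarrow> \<sigma> | Mid a \<Rightarrow> \<mu> $ a | Bot \<Rightarrow> \<rho>)"

definition mid :: "real^('n::finite) tidx \<Rightarrow> real^'n" where
  "mid v = (\<chi> a. v $ Mid a)"

text \<open>The Lorentzian form of the model space, and the null ray of positive multiples of
  \<open>axis Bot 1\<close>.\<close>
definition hform :: "real^('n::finite) tidx \<Rightarrow> real^'n tidx \<Rightarrow> real" where
  "hform v w = v $ Top * w $ Bot + v $ Bot * w $ Top + mid v \<bullet> mid w"

definition SO_h :: "(real^('n::finite) tidx^'n tidx) set" where
  "SO_h = {B. (\<forall>v w. hform (B *v v) (B *v w) = hform v w) \<and> det B = 1}"

definition Ggrp :: "(real^('n::finite) tidx^'n tidx) set" where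
  "Ggrp = connected_component_set SO_h (mat 1)"

definition Pgrp :: "(real^('n::finite) tidx^'n tidx) set" where
  "Pgrp = {B\<in>Ggrp. \<exists>r>0. B *v axis Bot 1 = r *\<^sub>R axis Bot 1}"

text \<open>Finite-dimensional real representations, carried by a subspace \<open>V\<close> of a Euclidean space (whose
  inner product plays no role). Since the group is an embedded submanifold of the space of matrices,
  smoothness means the existence of smooth extensions of the orbit maps.\<close>

type_synonym ('n, 'v) rep = "(((real, 'n tidx) vec, 'n tidx) vec) \<Rightarrow> 'v \<Rightarrow> 'v"

definition representation :: "('n::finite, 'v::euclidean_space) rep \<Rightarrow> 'v set \<Rightarrow> bool" where
  "representation \<rho> V \<longleftrightarrow> subspace V \<and>
     (\<forall>B\<in>Ggrp. \<forall>v\<in>V. \<rho> B v \<in> V) \<and>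
     (\<forall>B\<in>Ggrp. \<forall>v\<in>V. \<forall>w\<in>V. \<rho> B (v + w) = \<rho> B v + \<rho> B w) \<and>
     (\<forall>B\<in>Ggrp. \<forall>v\<in>V. \<forall>r. \<rho> B (r *\<^sub>R v) = r *\<^sub>R \<rho> B v) \<and>
     (\<forall>v\<in>V. \<rho> (mat 1) v = v) \<and>
     (\<forall>B\<in>Ggrp. \<forall>C\<in>Ggrp. \<forall>v\<in>V. \<rho> (B ** C) v = \<rho> B (\<rho> C v)) \<and>
     (\<forall>v\<in>V. \<exists>O' F. open O' \<and> Ggrp \<subseteq> O' \<and> smooth_on O' F \<and> (\<forall>B\<in>Ggrp. F B = \<rho> B v))"

definition irreducible_rep :: "('n::finite, 'v::euclidean_space) rep \<Rightarrow> 'v set \<Rightarrow> bool" where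
  "irreducible_rep \<rho> V \<longleftrightarrow> representation \<rho> V \<and> V \<noteq> {0} \<and>
     (\<forall>U. subspace U \<and> U \<subseteq> V \<and> (\<forall>B\<in>Ggrp. \<rho> B ` U \<subseteq> U) \<longrightarrow> U = {0} \<or> U = V)"

text \<open>The differential of \<open>\<rho>\<close> at the identity, applied to an element \<open>Y\<close> of the Lie algebra
  of the group: differentiate along any curve in the group with velocity \<open>Y\<close> at the identity.\<close>
definition drep :: "('n::finite, 'v::euclidean_space) rep \<Rightarrow> real^'n tidx^'n tidx \<Rightarrow> 'v \<Rightarrow> 'v" where
  "drep \<rho> Y v = (THE w. \<forall>C. (\<forall>t. C t \<in> Ggrp) \<and> C 0 = mat 1 \<and> (C has_vector_derivative Y) (at 0) \<longrightarrow>
     ((\<lambda>t. \<rho> (C t) v) has_vector_derivative w) (at (0::real)))"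

text \<open>The grading element; its eigenspaces in a representation with eigenvalue at least \<open>r\<close> span the
  components of the \<open>P\<close>-invariant filtration. These are nested, so the union below is
  the largest proper one.\<close>
definition grading :: "real^('n::finite) tidx^'n tidx" where
  "grading = (\<chi> i j. if i = j then (case i of Top \<Rightarrow> -1 | Mid a \<Rightarrow> 0 | Bot \<Rightarrow> 1) else 0)"

definition filtr :: "('n::finite, 'v::euclidean_space) rep \<Rightarrow> 'v set \<Rightarrow> real \<Rightarrow> 'v set" where
  "filtr \<rho> V r = span {v\<in>V. \<exists>s\<ge>r. drep \<rho> grading v = s *\<^sub>R v}"

definition V0 :: "('n::finite, 'v::euclidean_space) rep \<Rightarrow> 'v set \<Rightarrow> 'v set" where
  "V0 \<rho> V = \<Union>{F. \<exists>r. F = filtr \<rho> V r \<and> F \<noteq> V}"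


section \<open>The standard tractor bundle, its connection, and the Cartan bundle\<close>

text \<open>A gauge is a chart together with a metric in the conformal class. The chart trivialises
  \<open>T\<^sup>*M\<close> and the metric trivialises the density bundles, so a tractor at a point is a triple
  \<open>(\<sigma>, \<mu>, \<rho>)\<close> for each gauge. Under \<open>g' = \<Omega>\<^sup>2 g\<close> a density of weight \<open>w\<close> acquires the factor
  \<open>\<Omega>\<^sup>w\<close>, which is combined below with the conformal transformation law of tractors and the change
  of coordinates.\<close>

type_synonym ('m, 'n) gauge = "('m, 'n) chart \<times> ('m, 'n) metric"
type_synonym ('m, 'n) tractor = "('m, 'n) gauge \<Rightarrow> (real, 'n tidx) vec"

definition gauges :: "('m, 'n::finite) chart set \<Rightarrow> ('m, 'n) metric set \<Rightarrow> 'm \<Rightarrow> ('m, 'n) gauge set" where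
  "gauges A c x = {(\<kappa>, g). \<kappa> \<in> A \<and> g \<in> c \<and> x \<in> cdom \<kappa>}"

definition Upsilon :: "('m \<Rightarrow> real) \<Rightarrow> ('m, 'n::finite) chart \<Rightarrow> 'm \<Rightarrow> real^'n" where
  "Upsilon \<Omega> \<kappa> x = (\<chi> a. pd a (\<Omega> \<circ> cinv \<kappa>) (coord \<kappa> x) / \<Omega> x)"

definition change_gauge ::
  "('m \<Rightarrow> real) \<Rightarrow> ('m, 'n::finite) chart \<Rightarrow> ('m, 'n) metric \<Rightarrow> ('m, 'n) chart \<Rightarrow> 'm
     \<Rightarrow> real^'n tidx \<Rightarrow> real^'n tidx" where
  "change_gauge \<Omega> \<kappa> g \<kappa>' x v =
     (let \<sigma> = v $ Top; \<mu> = mid v; \<rho> = v $ Bot; Y = Upsilon \<Omega> \<kappa> x;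
          gi = matrix_inv (g \<kappa> (coord \<kappa> x))
      in tvec (\<Omega> x * \<sigma>)
              (\<Omega> x *\<^sub>R (transpose (jac \<kappa>' \<kappa> x) *v (\<mu> + \<sigma> *\<^sub>R Y)))
              ((\<rho> - Y \<bullet> (gi *v \<mu>) - (1/2) * (Y \<bullet> (gi *v Y)) * \<sigma>) / \<Omega> x))"

definition tractors :: "('m, 'n::finite) chart set \<Rightarrow> ('m, 'n) metric set \<Rightarrow> 'm \<Rightarrow> ('m, 'n) tractor set" where
  "tractors A c x = {T.
     (\<forall>\<kappa> g \<kappa>' g' \<Omega>. (\<kappa>, g) \<in> gauges A c x \<and> (\<kappa>', g') \<in> gauges A c x \<and> rescaling A \<Omega> g g' \<longrightarrow>
        T (\<kappa>', g') = change_gauge \<Omega> \<kappa> g \<kappa>' x (T (\<kappa>, g))) \<and>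
     (\<forall>\<gamma>. \<gamma> \<notin> gauges A c x \<longrightarrow> T \<gamma> = 0)}"

definition tmetric :: "('m, 'n::finite) gauge \<Rightarrow> 'm \<Rightarrow> real^'n tidx \<Rightarrow> real^'n tidx \<Rightarrow> real" where
  "tmetric \<gamma> x v w = (case \<gamma> of (\<kappa>, g) \<Rightarrow>
     v $ Top * w $ Bot + v $ Bot * w $ Top + mid v \<bullet> (matrix_inv (g \<kappa> (coord \<kappa> x)) *v mid w))"

definition tractor_field ::
  "('m::topological_space, 'n::finite) chart set \<Rightarrow> ('m, 'n) metric set \<Rightarrow> 'm set
     \<Rightarrow> ('m \<Rightarrow> ('m, 'n) tractor) \<Rightarrow> bool" where
  "tractor_field A c W T \<longleftrightarrow> (\<forall>x\<in>W. T x \<in> tractors A c x) \<and>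
     (\<forall>\<kappa>\<in>A. \<forall>g\<in>c. smooth_on (coord \<kappa> ` (W \<inter> cdom \<kappa>)) (\<lambda>y. T (cinv \<kappa> y) (\<kappa>, g)))"

text \<open>The component \<open>\<nabla>\<^sub>a T\<close> of the tractor connection in a gauge, at \<open>x\<close>.\<close>
definition tnabla :: "('m, 'n::finite) gauge \<Rightarrow> ('m \<Rightarrow> ('m, 'n) tractor) \<Rightarrow> 'n \<Rightarrow> 'm \<Rightarrow> real^'n tidx" where
  "tnabla \<gamma> T a x = (case \<gamma> of (\<kappa>, g) \<Rightarrow>
     (let y = coord \<kappa> x; G = g \<kappa>; v = T x \<gamma>; D = pd a (\<lambda>z. T (cinv \<kappa> z) \<gamma>) y
      in tvec (D $ Top - v $ Mid a)
              (\<chi> b. D $ Mid b - (\<Sum>e\<in>UNIV. christoffel G y e a b * v $ Mid e)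
                    + schouten G y a b * v $ Top + G y $ a $ b * v $ Bot)
              (D $ Bot - (\<Sum>b\<in>UNIV. schouten G y a b * (matrix_inv (G y) *v mid v) $ b))))"

text \<open>The fibre of the Cartan bundle. A frame is a linear identification of the model space with the
  tractors at \<open>x\<close>. The gauges give oriented trivialisations of the tractor bundle, and the time
  orientation is the one determined by the ray of the canonical tractor, so it is respected by the
  last condition.\<close>

type_synonym ('m, 'n) frame = "(real, 'n tidx) vec \<Rightarrow> ('m, 'n) tractor"

definition frame_mat :: "('m, 'n::finite) gauge \<Rightarrow> ('m, 'n) frame \<Rightarrow> real^'n tidx^'n tidx" where
  "frame_mat \<gamma> u = matrix (\<lambda>v. u v \<gamma>)"

definition frames :: "('m, 'n::finite) chart set \<Rightarrow> ('m, 'n) metric set \<Rightarrow> 'm \<Rightarrow> ('m, 'n) frame set" where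
  "frames A c x = {u. (\<forall>v. u v \<in> tractors A c x) \<and>
     (\<forall>\<gamma>\<in>gauges A c x.
        linear (\<lambda>v. u v \<gamma>) \<and>
        (\<forall>v w. tmetric \<gamma> x (u v \<gamma>) (u w \<gamma>) = hform v w) \<and>
        det (frame_mat \<gamma> u) > 0 \<and>
        (\<exists>r>0. u (axis Bot 1) \<gamma> = tvec 0 0 r))}"

definition frame_act :: "('m, 'n::finite) frame \<Rightarrow> real^'n tidx^'n tidx \<Rightarrow> ('m, 'n) frame" where
  "frame_act u p = (\<lambda>v. u (p *v v))"

definition frame_field ::
  "('m::topological_space, 'n::finite) chart set \<Rightarrow> ('m, 'n) metric set \<Rightarrow> 'm set
     \<Rightarrow> ('m \<Rightarrow> ('m, 'n) frame) \<Rightarrow> bool" where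
  "frame_field A c W u \<longleftrightarrow> open W \<and> (\<forall>x\<in>W. u x \<in> frames A c x) \<and>
     (\<forall>v. tractor_field A c W (\<lambda>x. u x v))"

text \<open>The matrix \<open>\<omega>\<^sub>a\<close> with \<open>\<nabla>\<^sub>a (u v) = u (\<omega>\<^sub>a v)\<close> for constant \<open>v\<close>.\<close>
definition conn_form ::
  "('m, 'n::finite) gauge \<Rightarrow> ('m \<Rightarrow> ('m, 'n) frame) \<Rightarrow> 'n \<Rightarrow> 'm \<Rightarrow> real^'n tidx^'n tidx" where
  "conn_form \<gamma> u a x = matrix (\<lambda>v. matrix_inv (frame_mat \<gamma> (u x)) *v tnabla \<gamma> (\<lambda>z. u z v) a x)"


section \<open>General tractor bundles\<close>

text \<open>Sections of the bundle associated to \<open>V\<close> are \<open>P\<close>-equivariant functions on the Cartan bundle.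
  They are set to zero off the Cartan bundle to make them unique.\<close>

type_synonym ('m, 'n, 'v) assoc = "'m \<Rightarrow> ('m, 'n) frame \<Rightarrow> 'v"

definition tractor_section ::
  "('m::topological_space, 'n::finite) chart set \<Rightarrow> ('m, 'n) metric set
     \<Rightarrow> ('n, 'v::euclidean_space) rep \<Rightarrow> 'v set \<Rightarrow> ('m, 'n, 'v) assoc \<Rightarrow> bool" where
  "tractor_section A c \<rho> V S \<longleftrightarrow>
     (\<forall>x. \<forall>u\<in>frames A c x. S x u \<in> V \<and> (\<forall>p\<in>Pgrp. S x (frame_act u p) = \<rho> (matrix_inv p) (S x u))) \<and>
     (\<forall>x u. u \<notin> frames A c x \<longrightarrow> S x u = 0) \<and>
     (\<forall>W u. frame_field A c W u \<longrightarrow> msmooth A W (\<lambda>x. S x (u x)))"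

text \<open>\<open>\<nabla>\<^sub>a S\<close> at \<open>x\<close>, expressed in the frame \<open>u x\<close>, where \<open>u\<close> is a local frame field.\<close>
definition nabla ::
  "('n::finite, 'v::euclidean_space) rep \<Rightarrow> ('m, 'n) gauge \<Rightarrow> ('m \<Rightarrow> ('m, 'n) frame)
     \<Rightarrow> ('m, 'n, 'v) assoc \<Rightarrow> 'n \<Rightarrow> 'm \<Rightarrow> 'v" where
  "nabla \<rho> \<gamma> u S a x =
     pd a (\<lambda>z. S (cinv (fst \<gamma>) z) (u (cinv (fst \<gamma>) z))) (coord (fst \<gamma>) x)
     + drep \<rho> (conn_form \<gamma> u a x) (S x (u x))"

definition parallel ::
  "('m::topological_space, 'n::finite) chart set \<Rightarrow> ('m, 'n) metric set
     \<Rightarrow> ('n, 'v::euclidean_space) rep \<Rightarrow> 'v set \<Rightarrow> ('m, 'n, 'v) assoc \<Rightarrow> bool" where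
  "parallel A c \<rho> V S \<longleftrightarrow> tractor_section A c \<rho> V S \<and>
     (\<forall>W u. frame_field A c W u \<longrightarrow>
        (\<forall>x\<in>W. \<forall>\<gamma>\<in>gauges A c x. \<forall>a. nabla \<rho> \<gamma> u S a x = 0))"


section \<open>First BGG operators\<close>

text \<open>Elements of the quotient \<open>V/V0\<close> are cosets, and sections of the associated bundle are again
  equivariant functions on the Cartan bundle. Smoothness is the existence of smooth local lifts.\<close>

definition H0_section ::
  "('m::topological_space, 'n::finite) chart set \<Rightarrow> ('m, 'n) metric set
     \<Rightarrow> ('n, 'v::euclidean_space) rep \<Rightarrow> 'v set \<Rightarrow> ('m, 'n, 'v set) assoc \<Rightarrow> bool" where
  "H0_section A c \<rho> V \<sigma> \<longleftrightarrow>
     (\<forall>x. \<forall>u\<in>frames A c x. (\<exists>v\<in>V. \<sigma> x u = (+) v ` V0 \<rho> V) \<and>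
        (\<forall>p\<in>Pgrp. \<sigma> x (frame_act u p) = \<rho> (matrix_inv p) ` \<sigma> x u)) \<and>
     (\<forall>x u. u \<notin> frames A c x \<longrightarrow> \<sigma> x u = V0 \<rho> V) \<and>
     (\<forall>W u. frame_field A c W u \<longrightarrow> (\<exists>f. msmooth A W f \<and> (\<forall>x\<in>W. f x \<in> \<sigma> x (u x))))"

definition H0_proj ::
  "('n::finite, 'v::euclidean_space) rep \<Rightarrow> 'v set \<Rightarrow> ('m, 'n, 'v) assoc \<Rightarrow> ('m, 'n, 'v set) assoc" where
  "H0_proj \<rho> V S = (\<lambda>x u. (+) (S x u) ` V0 \<rho> V)"

text \<open>The matrix, in the frame \<open>u\<close>, of the endomorphism \<open>X\<^sub>[\<^sub>A Z\<^sub>B\<^sub>]\<^sup>b\<close> by which the coordinate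
  covector \<open>dx\<^sup>b\<close> acts on tractors; in a gauge, this sends \<open>(\<sigma>, \<mu>, \<rho>)\<close> to
  half of \<open>(0, - \<sigma> dx\<^sup>b, g\<^sup>b\<^sup>a \<mu>\<^sub>a)\<close>.\<close>
definition covec_act ::
  "('m, 'n::finite) gauge \<Rightarrow> ('m, 'n) frame \<Rightarrow> 'm \<Rightarrow> 'n \<Rightarrow> real^'n tidx^'n tidx" where
  "covec_act \<gamma> u x b = (case \<gamma> of (\<kappa>, g) \<Rightarrow>
     matrix_inv (frame_mat \<gamma> u) **
     matrix (\<lambda>v. (1/2) *\<^sub>R tvec 0 (- v $ Top *\<^sub>R axis b 1)
                                ((matrix_inv (g \<kappa> (coord \<kappa> x)) *v mid v) $ b)) **
     frame_mat \<gamma> u)"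

text \<open>The Kostant codifferential (up to a nonzero constant in each degree, which does not affect
  kernels and images) contracts the first form index with the action:
  \<open>\<psi>\<^sub>a \<mapsto> dx\<^sup>b \<cdot> \<psi>\<^sub>b\<close> in degree one and \<open>\<Psi>\<^sub>a\<^sub>c \<mapsto> dx\<^sup>b \<cdot> \<Psi>\<^sub>b\<^sub>c\<close> in degree two.\<close>
definition codiff1 ::
  "('n::finite, 'v::euclidean_space) rep \<Rightarrow> ('m, 'n) gauge \<Rightarrow> ('m, 'n) frame \<Rightarrow> 'm \<Rightarrow> ('n \<Rightarrow> 'v) \<Rightarrow> 'v" where
  "codiff1 \<rho> \<gamma> u x \<psi> = (\<Sum>b\<in>UNIV. drep \<rho> (covec_act \<gamma> u x b) (\<psi> b))"

definition codiff2 ::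
  "('n::finite, 'v::euclidean_space) rep \<Rightarrow> ('m, 'n) gauge \<Rightarrow> ('m, 'n) frame \<Rightarrow> 'm
     \<Rightarrow> ('n \<Rightarrow> 'n \<Rightarrow> 'v) \<Rightarrow> 'n \<Rightarrow> 'v" where
  "codiff2 \<rho> \<gamma> u x \<Psi> = (\<lambda>e. \<Sum>b\<in>UNIV. drep \<rho> (covec_act \<gamma> u x b) (\<Psi> b e))"

definition im_codiff ::
  "('n::finite, 'v::euclidean_space) rep \<Rightarrow> 'v set \<Rightarrow> ('m, 'n) gauge \<Rightarrow> ('m, 'n) frame \<Rightarrow> 'm
     \<Rightarrow> ('n \<Rightarrow> 'v) set" where
  "im_codiff \<rho> V \<gamma> u x = codiff2 \<rho> \<gamma> u x ` {\<Psi>. \<forall>a b. \<Psi> a b \<in> V \<and> \<Psi> b a = - \<Psi> a b}"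

text \<open>The splitting operator \<open>L\<close>: the value \<open>L \<sigma>\<close> is already determined, as a section, by the two
  conditions \<open>\<pi> (L \<sigma>) = \<sigma>\<close> and \<open>\<partial>\<^sup>* (\<nabla> (L \<sigma>)) = 0\<close>.\<close>
definition BGG_split ::
  "('m::topological_space, 'n::finite) chart set \<Rightarrow> ('m, 'n) metric set
     \<Rightarrow> ('n, 'v::euclidean_space) rep \<Rightarrow> 'v set \<Rightarrow> ('m, 'n, 'v set) assoc \<Rightarrow> ('m, 'n, 'v) assoc" where
  "BGG_split A c \<rho> V \<sigma> = (THE S. tractor_section A c \<rho> V S \<and> H0_proj \<rho> V S = \<sigma> \<and>
     (\<forall>W u. frame_field A c W u \<longrightarrow>
        (\<forall>x\<in>W. \<forall>\<gamma>\<in>gauges A c x. codiff1 \<rho> \<gamma> (u x) x (\<lambda>a. nabla \<rho> \<gamma> u S a x) = 0)))"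

text \<open>The value of the first BGG operator at \<open>x\<close>, in a gauge and in the frame \<open>u x\<close>, as a coset of the
  image of the codifferential.\<close>
definition first_BGG ::
  "('m::topological_space, 'n::finite) chart set \<Rightarrow> ('m, 'n) metric set
     \<Rightarrow> ('n, 'v::euclidean_space) rep \<Rightarrow> 'v set \<Rightarrow> ('m, 'n, 'v set) assoc
     \<Rightarrow> ('m, 'n) gauge \<Rightarrow> ('m \<Rightarrow> ('m, 'n) frame) \<Rightarrow> 'm \<Rightarrow> ('n \<Rightarrow> 'v) set" where
  "first_BGG A c \<rho> V \<sigma> \<gamma> u x =
     (\<lambda>\<eta> a. nabla \<rho> \<gamma> u (BGG_split A c \<rho> V \<sigma>) a x + \<eta> a) ` im_codiff \<rho> V \<gamma> (u x) x"

definition BGG_solution ::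
  "('m::topological_space, 'n::finite) chart set \<Rightarrow> ('m, 'n) metric set
     \<Rightarrow> ('n, 'v::euclidean_space) rep \<Rightarrow> 'v set \<Rightarrow> ('m, 'n, 'v set) assoc \<Rightarrow> bool" where
  "BGG_solution A c \<rho> V \<sigma> \<longleftrightarrow> H0_section A c \<rho> V \<sigma> \<and>
     (\<forall>W u. frame_field A c W u \<longrightarrow>
        (\<forall>x\<in>W. \<forall>\<gamma>\<in>gauges A c x. first_BGG A c \<rho> V \<sigma> \<gamma> u x = im_codiff \<rho> V \<gamma> (u x) x))"

definition corresponding_tractor ::
  "('m::topological_space, 'n::finite) chart set \<Rightarrow> ('m, 'n) metric set
     \<Rightarrow> ('n, 'v::euclidean_space) rep \<Rightarrow> 'v set \<Rightarrow> ('m, 'n, 'v set) assoc \<Rightarrow> ('m, 'n, 'v) assoc \<Rightarrow> bool" where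
  "corresponding_tractor A c \<rho> V \<sigma> S \<longleftrightarrow> parallel A c \<rho> V S \<and> H0_proj \<rho> V S = \<sigma>"

definition normal_solution ::
  "('m::topological_space, 'n::finite) chart set \<Rightarrow> ('m, 'n) metric set
     \<Rightarrow> ('n, 'v::euclidean_space) rep \<Rightarrow> 'v set \<Rightarrow> ('m, 'n, 'v set) assoc \<Rightarrow> bool" where
  "normal_solution A c \<rho> V \<sigma> \<longleftrightarrow> BGG_solution A c \<rho> V \<sigma> \<and>
     (\<exists>S. corresponding_tractor A c \<rho> V \<sigma> S)"


section \<open>Distinguished submanifolds\<close>

text \<open>An embedded oriented submanifold \<open>\<Sigma>\<close> of codimension \<open>length ks\<close> is given with a family \<open>Q\<close> of
  slice charts, taken from the oriented atlas of the ambient manifold, in which \<open>\<Sigma>\<close> is the zero set of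
  the coordinates listed in \<open>ks\<close>. The remaining coordinates form an oriented atlas of \<open>\<Sigma>\<close>. As both
  orientations are respected by \<open>Q\<close>, the normal bundle is oriented by the order of \<open>ks\<close>; a permutation
  of \<open>ks\<close> amounts to a choice of convention for its orientation. Flipping the sign of one tangential
  and one normal coordinate where necessary shows that every embedded oriented submanifold of positive
  dimension and codimension is of this kind.\<close>

definition tan_block :: "'n list \<Rightarrow> real^'n^'n \<Rightarrow> real^'n^('n::finite)" where
  "tan_block ks B = (\<chi> i j. if i \<in> set ks \<or> j \<in> set ks then (if i = j then 1 else 0) else B $ i $ j)"

definition oriented_submanifold ::
  "('m::topological_space, 'n::finite) chart set \<Rightarrow> 'n list \<Rightarrow> 'm set \<Rightarrow> ('m, 'n) chart set \<Rightarrow> bool" where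
  "oriented_submanifold A ks \<Sigma> Q \<longleftrightarrow> distinct ks \<and> Q \<subseteq> A \<and> \<Sigma> \<subseteq> (\<Union>\<kappa>\<in>Q. cdom \<kappa>) \<and>
     (\<forall>\<kappa>\<in>Q. \<forall>x\<in>cdom \<kappa>. x \<in> \<Sigma> \<longleftrightarrow> (\<forall>k\<in>set ks. coord \<kappa> x $ k = 0)) \<and>
     (\<forall>\<kappa>\<in>Q. \<forall>\<kappa>'\<in>Q. \<forall>x\<in>\<Sigma> \<inter> cdom \<kappa> \<inter> cdom \<kappa>'. det (tan_block ks (jac \<kappa> \<kappa>' x)) > 0)"

text \<open>In a slice chart: the inverse \<open>g\<^sup>i\<^sup>j\<close> of the induced metric (meaningful for tangential
  \<open>i\<close>, \<open>j\<close>), the normal part of a vector, the second fundamental form (the normal part of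
  \<open>\<nabla>\<^sub>i \<partial>\<^sub>j\<close>) and the mean curvature.\<close>

definition tan_inv :: "'n list \<Rightarrow> real^'n^'n \<Rightarrow> real^'n^('n::finite)" where
  "tan_inv ks B = matrix_inv (tan_block ks B)"

definition normal_part :: "'n list \<Rightarrow> real^'n^'n \<Rightarrow> real^'n \<Rightarrow> real^('n::finite)" where
  "normal_part ks B v =
     v - (\<Sum>i\<in>- set ks. \<Sum>j\<in>- set ks. (tan_inv ks B $ i $ j * (B *v v) $ i) *\<^sub>R axis j 1)"

definition second_ff :: "'n list \<Rightarrow> ('m, 'n::finite) gauge \<Rightarrow> 'm \<Rightarrow> 'n \<Rightarrow> 'n \<Rightarrow> real^'n" where
  "second_ff ks \<gamma> x i j = (case \<gamma> of (\<kappa>, g) \<Rightarrow>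
     normal_part ks (g \<kappa> (coord \<kappa> x)) (\<chi> e. christoffel (g \<kappa>) (coord \<kappa> x) e i j))"

definition mean_curv :: "'n list \<Rightarrow> ('m, 'n::finite) gauge \<Rightarrow> 'm \<Rightarrow> real^'n" where
  "mean_curv ks \<gamma> x = (case \<gamma> of (\<kappa>, g) \<Rightarrow>
     (1 / real (CARD('n) - length ks)) *\<^sub>R
       (\<Sum>i\<in>- set ks. \<Sum>j\<in>- set ks. tan_inv ks (g \<kappa> (coord \<kappa> x)) $ i $ j *\<^sub>R second_ff ks \<gamma> x i j))"

text \<open>The tractor \<open>(0, n\<^sub>a, n\<^sub>c H\<^sup>c)\<close>, and the fibre of the normal tractor bundle, both in a gauge
  whose chart is a slice chart.\<close>

definition normal_tractor :: "'n list \<Rightarrow> ('m, 'n::finite) gauge \<Rightarrow> 'm \<Rightarrow> real^'n \<Rightarrow> real^'n tidx" where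
  "normal_tractor ks \<gamma> x n = (case \<gamma> of (\<kappa>, g) \<Rightarrow>
     (let nl = g \<kappa> (coord \<kappa> x) *v n in tvec 0 nl (nl \<bullet> mean_curv ks \<gamma> x)))"

definition normal_bundle :: "'n list \<Rightarrow> ('m, 'n::finite) gauge \<Rightarrow> 'm \<Rightarrow> (real^'n tidx) set" where
  "normal_bundle ks \<gamma> x = (case \<gamma> of (\<kappa>, g) \<Rightarrow>
     normal_tractor ks \<gamma> x ` {n. \<forall>j. j \<notin> set ks \<longrightarrow> (g \<kappa> (coord \<kappa> x) *v n) $ j = 0})"

definition ortho_proj :: "('a::real_vector \<Rightarrow> 'a \<Rightarrow> real) \<Rightarrow> 'a set \<Rightarrow> 'a \<Rightarrow> 'a" where
  "ortho_proj b K v = (THE p. p \<in> K \<and> (\<forall>n\<in>K. b (v - p) n = 0))"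

text \<open>The value on \<open>V\<close> of the tractor second fundamental form, for tangential \<open>i\<close>.\<close>
definition tractor_second_ff ::
  "'n list \<Rightarrow> ('m, 'n::finite) gauge \<Rightarrow> ('m \<Rightarrow> ('m, 'n) tractor) \<Rightarrow> 'n \<Rightarrow> 'm \<Rightarrow> real^'n tidx" where
  "tractor_second_ff ks \<gamma> V i x = ortho_proj (tmetric \<gamma> x) (normal_bundle ks \<gamma> x) (tnabla \<gamma> V i x)"

text \<open>Local sections along \<open>\<Sigma>\<close> of the orthogonal complement of the normal tractor bundle are
  represented by tractor fields on open sets of the ambient manifold; only their values along \<open>\<Sigma>\<close>
  matter.\<close>
definition distinguished ::
  "('m::topological_space, 'n::finite) chart set \<Rightarrow> ('m, 'n) metric set \<Rightarrow> 'n list \<Rightarrow> 'm set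
     \<Rightarrow> ('m, 'n) chart set \<Rightarrow> bool" where
  "distinguished A c ks \<Sigma> Q \<longleftrightarrow>
     (\<forall>W V. open W \<and> tractor_field A c W V \<and>
        (\<forall>\<kappa>\<in>Q. \<forall>g\<in>c. \<forall>x\<in>\<Sigma> \<inter> W \<inter> cdom \<kappa>.
           \<forall>n\<in>normal_bundle ks (\<kappa>, g) x. tmetric (\<kappa>, g) x (V x (\<kappa>, g)) n = 0) \<longrightarrow>
        (\<forall>\<kappa>\<in>Q. \<forall>g\<in>c. \<forall>x\<in>\<Sigma> \<inter> W \<inter> cdom \<kappa>. \<forall>i. i \<notin> set ks \<longrightarrow>
           tractor_second_ff ks (\<kappa>, g) V i x = 0))"


section \<open>Exterior powers and the tractor normal form\<close>

text \<open>\<open>\<Lambda>\<^sup>d\<close> of the model space, as alternating arrays \<open>w [A\<^sub>1, \<dots>, A\<^sub>d]\<close> of components with upper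
  indices.\<close>
definition ext_power :: "nat \<Rightarrow> ('n tidx list \<Rightarrow> real) set" where
  "ext_power d = {w. (\<forall>I. length I \<noteq> d \<longrightarrow> w I = 0) \<and>
     (\<forall>I i j. length I = d \<and> i < d \<and> j < d \<and> i \<noteq> j \<longrightarrow> w (I[i := I ! j, j := I ! i]) = - w I)}"

definition ext_act :: "real^('n::finite) tidx^'n tidx \<Rightarrow> ('n tidx list \<Rightarrow> real) \<Rightarrow> 'n tidx list \<Rightarrow> real" where
  "ext_act B w I = (\<Sum>J | length J = length I. (\<Prod>i<length I. B $ (I ! i) $ (J ! i)) * w J)"

definition wedge :: "(real^('n::finite) tidx) list \<Rightarrow> 'n tidx list \<Rightarrow> real" where
  "wedge vs I = (if length I = length vs
     then \<Sum>p | p permutes {..<length vs}. of_int (sign p) * (\<Prod>i<length vs. (vs ! p i) $ (I ! i))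
     else 0)"

definition full_contraction :: "nat \<Rightarrow> (('n::finite) tidx list \<Rightarrow> real) \<Rightarrow> ('n tidx list \<Rightarrow> real) \<Rightarrow> real" where
  "full_contraction d w w' = (\<Sum>I | length I = d. \<Sum>J | length J = d.
     (\<Prod>i<d. hform (axis (I ! i) 1) (axis (J ! i) 1)) * w I * w' J)"

text \<open>The tractor normal form as a function on the Cartan bundle over \<open>\<Sigma>\<close>. Transported to a gauge whose
  chart is a slice chart, it is to be a positive multiple of the wedge product of the images of the normal
  vectors metrically dual to the covectors \<open>dx\<^sup>k\<close>, for \<open>k\<close> in \<open>ks\<close>. These images form an oriented
  basis of the normal tractor bundle.\<close>
definition tractor_normal_form ::
  "('m, 'n::finite) chart set \<Rightarrow> ('m, 'n) metric set \<Rightarrow> 'n list \<Rightarrow> 'm set \<Rightarrow> ('m, 'n) chart set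
     \<Rightarrow> ('m, 'n, 'n tidx list \<Rightarrow> real) assoc \<Rightarrow> bool" where
  "tractor_normal_form A c ks \<Sigma> Q N \<longleftrightarrow> (\<forall>x\<in>\<Sigma>. \<forall>u\<in>frames A c x.
     N x u \<in> ext_power (length ks) \<and>
     full_contraction (length ks) (N x u) (N x u) = fact (length ks) \<and>
     (\<forall>\<kappa>\<in>Q. \<forall>g\<in>c. x \<in> cdom \<kappa> \<longrightarrow>
        (\<exists>r>0. ext_act (frame_mat (\<kappa>, g) u) (N x u) =
           (\<lambda>I. r * wedge
              (map (\<lambda>k. normal_tractor ks (\<kappa>, g) x (matrix_inv (g \<kappa> (coord \<kappa> x)) *v axis k 1)) ks) I))))"


section \<open>Invariant functionals on tensor products of symmetric powers\<close>

text \<open>The tensor product of the symmetric powers is realised in the space of functions of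
  \<open>m 0\<close> multi-indices and of \<open>m i\<close> vectors \<open>b\<close>, \<open>i = 1, \<dots>, k\<close>, these being identified with the linear
  functionals \<open>v \<mapsto> v \<bullet> b\<close>. \<open>sym_prod\<close> is the tensor product of the
  symmetrised tensor products of the \<open>w j\<close> (\<open>j < m 0\<close>) and of the \<open>v i j\<close> (\<open>j < m i\<close>).\<close>

type_synonym ('n, 'v) tensor = "(nat \<Rightarrow> 'n tidx list) \<times> (nat \<Rightarrow> nat \<Rightarrow> 'v) \<Rightarrow> real"

definition sym_prod ::
  "nat \<Rightarrow> (nat \<Rightarrow> nat) \<Rightarrow> (nat \<Rightarrow> 'n tidx list \<Rightarrow> real) \<Rightarrow> (nat \<Rightarrow> nat \<Rightarrow> 'v::euclidean_space)
     \<Rightarrow> ('n, 'v) tensor" where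
  "sym_prod k m w v = (\<lambda>(I, b).
     (\<Sum>p | p permutes {..<m 0}. \<Prod>j<m 0. w (p j) (I j)) / fact (m 0) *
     (\<Prod>i\<in>{1..k}. (\<Sum>p | p permutes {..<m i}. \<Prod>j<m i. v i (p j) \<bullet> b i j) / fact (m i)))"

inductive_set sym_tensors ::
  "nat \<Rightarrow> nat \<Rightarrow> (nat \<Rightarrow> nat) \<Rightarrow> (nat \<Rightarrow> 'v::euclidean_space set) \<Rightarrow> ('n, 'v) tensor set"
  for d k m V where
  gen: "\<lbrakk>\<And>j. j < m 0 \<Longrightarrow> w j \<in> ext_power d; \<And>i j. \<lbrakk>i \<in> {1..k}; j < m i\<rbrakk> \<Longrightarrow> v i j \<in> V i\<rbrakk>
     \<Longrightarrow> sym_prod k m w v \<in> sym_tensors d k m V"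
| add: "\<lbrakk>s \<in> sym_tensors d k m V; t \<in> sym_tensors d k m V\<rbrakk> \<Longrightarrow> (\<lambda>z. s z + t z) \<in> sym_tensors d k m V"
| scale: "s \<in> sym_tensors d k m V \<Longrightarrow> (\<lambda>z. r * s z) \<in> sym_tensors d k m V"

text \<open>The group acts linearly and factorwise, so invariance is a condition on the generators.\<close>
definition invariant_functional ::
  "nat \<Rightarrow> nat \<Rightarrow> (nat \<Rightarrow> nat) \<Rightarrow> (nat \<Rightarrow> ('n::finite, 'v::euclidean_space) rep) \<Rightarrow> (nat \<Rightarrow> 'v set)
     \<Rightarrow> (('n, 'v) tensor \<Rightarrow> real) \<Rightarrow> bool" where
  "invariant_functional d k m \<rho> V \<phi> \<longleftrightarrow>
     (\<forall>s\<in>sym_tensors d k m V. \<forall>t\<in>sym_tensors d k m V. \<phi> (\<lambda>z. s z + t z) = \<phi> s + \<phi> t) \<and>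
     (\<forall>s\<in>sym_tensors d k m V. \<forall>r. \<phi> (\<lambda>z. r * s z) = r * \<phi> s) \<and>
     (\<forall>B\<in>Ggrp. \<forall>w v. (\<forall>j<m 0. w j \<in> ext_power d) \<and> (\<forall>i\<in>{1..k}. \<forall>j<m i. v i j \<in> V i) \<longrightarrow>
        \<phi> (sym_prod k m (\<lambda>j. ext_act B (w j)) (\<lambda>i j. \<rho> i B (v i j))) = \<phi> (sym_prod k m w v))"

end

theory Submission
  imports Defs
begin

text \<open>Write the sections in a local frame of the Cartan bundle. The derivative of a parallel section
  along a coordinate line in the submanifold is then the infinitesimal action of \<open>- \<omega>\<close>, where \<open>\<omega>\<close> is the
  connection matrix, which lies in the Lie algebra of \<open>h\<close>. The same holds for the tractor normal form: a
  distinguished submanifold is one whose normal tractor bundle is parallel along it, so that the covariant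
  derivative of the normal form is a multiple of the normal form, and this multiple vanishes since the norm
  is constant. Hence all arguments of the functional agree to first order with a curve in a single group
  orbit, on which the functional is constant.\<close>


section \<open>Calculus of smooth maps\<close>

text \<open>Several obstacles shape the proof. The normal form is given point by point and frame by
  frame; neither differentiability nor equivariance is part of its definition. Both follow from its
  being a positive multiple of the wedge of the normal vectors, since the prescribed norm determines
  the multiple. Frames are described by signs (isometric, positive determinant, preserved ray),
  whereas invariance is available for the identity component \<open>Ggrp\<close>; so the stabiliser
  of the ray has to be joined to the identity explicitly, down to the rotations. The functional
  lives on a set of functions without a topology; along a curve it is differentiated by recovering
  tensors linearly from their values at finitely many arguments. Being distinguished is a condition
  on fields that are orthogonal to the normal bundle in every slice gauge, so a field orthogonal in
  one gauge must first be shown orthogonal in all. Coordinate lines suffice because slice charts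
  turn the submanifold into a coordinate subspace.\<close>

lemma Ck_on_mono_open: "Ck_on k U f \<Longrightarrow> V \<subseteq> U \<Longrightarrow> Ck_on k V f"
  by (induction k arbitrary: f) (auto intro: continuous_on_subset)

lemma Ck_on_Suc_imp: "Ck_on (Suc k) U f \<Longrightarrow> Ck_on k U f"
proof (induction k arbitrary: f)
  case 0
  then show ?case
    by (auto intro!: continuous_at_imp_continuous_on differentiable_imp_continuous_within)
next
  case (Suc k)
  then show ?case by auto
qed

text \<open>Openness turns pointwise equality into equality of germs, so that the derivatives
  selected by \<open>frechet_derivative\<close> coincide as well and the recursion can go
  on.\<close>

lemma Ck_on_cong:
  assumes "open U" "\<And>x. x \<in> U \<Longrightarrow> f x = g x"
  shows "Ck_on k U f \<longleftrightarrow> Ck_on k U g"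
proof -
  have "Ck_on k U g" if "Ck_on k U f" "\<And>x. x \<in> U \<Longrightarrow> f x = g x" for f g :: "'a \<Rightarrow> 'b"
    using that
  proof (induction k arbitrary: f g)
    case 0
    then show ?case by (simp cong: continuous_on_cong)
  next
    case (Suc k)
    have ev: "\<forall>\<^sub>F y in nhds x. f y = g y" if "x \<in> U" for x
      using assms(1) Suc.prems(2) that by (auto simp: eventually_nhds)
    have g: "g differentiable (at x)" "frechet_derivative f (at x) = frechet_derivative g (at x)" if "x \<in> U" for x
    proof -
      have "(f has_derivative frechet_derivative f (at x)) (at x)"
        using Suc.prems(1) that by (simp add: frechet_derivative_works)
      then have "(g has_derivative frechet_derivative f (at x)) (at x)"
        by (rule has_derivative_transform_within_open[OF _ assms(1) that]) (simp add: Suc.prems(2))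
      then show "g differentiable (at x)" "frechet_derivative f (at x) = frechet_derivative g (at x)"
        by (auto simp: differentiable_def frechet_derivative_at)
    qed
    have "Ck_on k U (\<lambda>x. frechet_derivative g (at x) b)" if b: "b \<in> Basis" for b
    proof (rule Suc.IH)
      show "Ck_on k U (\<lambda>x. frechet_derivative f (at x) b)"
        using Suc.prems(1) b by simp
      show "frechet_derivative f (at x) b = frechet_derivative g (at x) b" if "x \<in> U" for x
        by (simp only: g(2)[OF that])
    qed
    then show ?case using g(1) by simp
  qed
  from this[of f g] this[of g f] show ?thesis using assms(2) by auto
qed

lemma Ck_on_eqI:
  assumes "open U" "Ck_on k U g" "\<And>x. x \<in> U \<Longrightarrow> f x = g x"
  shows "Ck_on k U f"
  using Ck_on_cong[OF assms(1,3)] assms(2) by auto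

text \<open>By uniqueness of derivatives, an explicit formula may replace the selected
  \<open>frechet_derivative\<close>; the closure properties below rest on this rule.\<close>

lemma Ck_on_SucI:
  assumes "open U" "\<And>x. x \<in> U \<Longrightarrow> (f has_derivative f' x) (at x)"
    "\<And>b. b \<in> Basis \<Longrightarrow> Ck_on k U (\<lambda>x. f' x b)"
  shows "Ck_on (Suc k) U f"
proof -
  have "frechet_derivative f (at x) = f' x" if "x \<in> U" for x
    using frechet_derivative_at[OF assms(2)[OF that]] by simp
  then have "Ck_on k U (\<lambda>x. frechet_derivative f (at x) b)" if "b \<in> Basis" for b
    using Ck_on_cong[OF assms(1), of "\<lambda>x. frechet_derivative f (at x) b" "\<lambda>x. f' x b"] assms(3)[OF that]
    by auto
  then show ?thesis using assms(2) by (auto simp: differentiable_def)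
qed

lemma Ck_on_SucD:
  assumes "Ck_on (Suc k) U f"
  shows "x \<in> U \<Longrightarrow> (f has_derivative frechet_derivative f (at x)) (at x)"
    "b \<in> Basis \<Longrightarrow> Ck_on k U (\<lambda>x. frechet_derivative f (at x) b)"
  using assms by (auto simp: frechet_derivative_works)

lemma Ck_on_const: "open U \<Longrightarrow> Ck_on k U (\<lambda>x. c)"
proof (induction k arbitrary: c)
  case (Suc k)
  then show ?case by (intro Ck_on_SucI[where f' = "\<lambda>x h. 0"]) auto
qed auto

lemma Ck_on_linear:
  assumes "open U" "bounded_linear L" "Ck_on k U f"
  shows "Ck_on k U (\<lambda>x. L (f x))"
  using assms(3)
proof (induction k arbitrary: f)
  case 0
  then show ?case using assms(2) by (auto intro: linear_continuous_on_compose[unfolded o_def]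
    bounded_linear.continuous_on)
next
  case (Suc k)
  show ?case
    by (rule Ck_on_SucI[OF assms(1), where f' = "\<lambda>x h. L (frechet_derivative f (at x) h)"])
      (use Ck_on_SucD[OF Suc.prems] assms(2) Suc.IH in \<open>auto intro: bounded_linear.has_derivative\<close>)
qed

lemma Ck_on_add:
  assumes "open U" "Ck_on k U f" "Ck_on k U g"
  shows "Ck_on k U (\<lambda>x. f x + g x)"
  using assms(2,3)
proof (induction k arbitrary: f g)
  case 0
  then show ?case by (auto intro: continuous_intros)
next
  case (Suc k)
  show ?case
    by (rule Ck_on_SucI[OF assms(1), where f' = "\<lambda>x h. frechet_derivative f (at x) h + frechet_derivative g (at x) h"])
      (use Ck_on_SucD[OF Suc.prems(1)] Ck_on_SucD[OF Suc.prems(2)] Suc.IH in \<open>auto intro!: derivative_intros\<close>)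
qed

lemma Ck_on_bilinear:
  assumes "open U" "bounded_bilinear B" "Ck_on k U f" "Ck_on k U g"
  shows "Ck_on k U (\<lambda>x. B (f x) (g x))"
  using assms(3,4)
proof (induction k arbitrary: f g)
  case 0
  then show ?case using assms(2) by (auto intro: bounded_bilinear.continuous_on)
next
  case (Suc k)
  note D = Ck_on_SucD[OF Suc.prems(1)] Ck_on_SucD[OF Suc.prems(2)]
  show ?case
    by (rule Ck_on_SucI[OF assms(1), where f' = "\<lambda>x h. B (f x) (frechet_derivative g (at x) h)
        + B (frechet_derivative f (at x) h) (g x)"])
      (use D Suc.IH Ck_on_Suc_imp[OF Suc.prems(1)] Ck_on_Suc_imp[OF Suc.prems(2)] assms(1,2)
       in \<open>auto intro!: bounded_bilinear.FDERIV Ck_on_add\<close>)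
qed

lemma Ck_on_sum:
  assumes "open U" "\<And>i. i \<in> S \<Longrightarrow> Ck_on k U (f i)"
  shows "Ck_on k U (\<lambda>x. \<Sum>i\<in>S. f i x)"
  using assms(2) by (induction S rule: infinite_finite_induct) (auto intro: Ck_on_const Ck_on_add assms(1))

lemma Ck_on_compose:
  assumes "open U" "open W" "Ck_on k W f" "Ck_on k U \<phi>" "\<phi> ` U \<subseteq> W"
  shows "Ck_on k U (\<lambda>x. f (\<phi> x))"
  using assms(3,4)
proof (induction k arbitrary: f)
  case 0
  then show ?case using assms(5) by (auto intro: continuous_on_compose2)
next
  case (Suc k)
  note D = Ck_on_SucD[OF Suc.prems(1)] Ck_on_SucD[OF Suc.prems(2)]
  \<comment> \<open>The recursion controls derivatives in basis directions only, so the inner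
    derivative is expanded in the basis before the induction hypothesis is applied.\<close>
  have *: "frechet_derivative f (at (\<phi> x)) v = (\<Sum>e\<in>Basis. (v \<bullet> e) *\<^sub>R frechet_derivative f (at (\<phi> x)) e)"
    if "x \<in> U" for x v
  proof -
    have "linear (frechet_derivative f (at (\<phi> x)))"
      using D(1) assms(5) that by (blast intro: has_derivative_linear)
    then have "frechet_derivative f (at (\<phi> x)) (\<Sum>e\<in>Basis. (v \<bullet> e) *\<^sub>R e) =
        (\<Sum>e\<in>Basis. (v \<bullet> e) *\<^sub>R frechet_derivative f (at (\<phi> x)) e)"
      by (simp add: linear_sum linear_scale)
    then show ?thesis by (simp add: euclidean_representation)
  qed
  show ?case
  proof (rule Ck_on_SucI[OF assms(1), where f' = "\<lambda>x h. frechet_derivative f (at (\<phi> x)) (frechet_derivative \<phi> (at x) h)"])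
    show "((\<lambda>x. f (\<phi> x)) has_derivative (\<lambda>h. frechet_derivative f (at (\<phi> x)) (frechet_derivative \<phi> (at x) h))) (at x)"
      if "x \<in> U" for x
      using has_derivative_compose[OF D(3)[OF that] D(1)] assms(5) that by auto
    fix b :: 'a assume b: "b \<in> Basis"
    have "Ck_on k U (\<lambda>x. \<Sum>e\<in>Basis. (frechet_derivative \<phi> (at x) b \<bullet> e) *\<^sub>R frechet_derivative f (at (\<phi> x)) e)"
      by (intro Ck_on_sum assms(1) Ck_on_bilinear[OF _ bounded_bilinear_scaleR]
          Ck_on_linear[OF assms(1) bounded_linear_inner_left] D(4) b Suc.IH D(2) Ck_on_Suc_imp[OF Suc.prems(2)])
    then show "Ck_on k U (\<lambda>x. frechet_derivative f (at (\<phi> x)) (frechet_derivative \<phi> (at x) b))"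
      by (rule Ck_on_eqI[OF assms(1)]) (rule *)
  qed
qed

text \<open>The derivative is a derivative of \<open>f\<close> times two factors
  \<open>inverse (f x)\<close>, so class k of the inverse and class k + 1 of \<open>f\<close> give
  class k + 1 of the inverse.\<close>

lemma Ck_on_inverse:
  fixes f :: "'a::euclidean_space \<Rightarrow> real"
  assumes "open U" "Ck_on k U f" "\<And>x. x \<in> U \<Longrightarrow> f x \<noteq> 0"
  shows "Ck_on k U (\<lambda>x. inverse (f x))"
  using assms(2)
proof (induction k)
  case 0
  then show ?case using assms(3) by (auto intro: continuous_intros)
next
  case (Suc k)
  note D = Ck_on_SucD[OF Suc.prems(1)]
  have i: "Ck_on k U (\<lambda>x. inverse (f x))"
    using Suc by (blast intro: Ck_on_Suc_imp)
  show ?case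
  proof (rule Ck_on_SucI[OF assms(1), where f' = "\<lambda>x h. - (inverse (f x) * frechet_derivative f (at x) h * inverse (f x))"])
    show "((\<lambda>x. inverse (f x)) has_derivative (\<lambda>h. - (inverse (f x) * frechet_derivative f (at x) h * inverse (f x)))) (at x)"
      if "x \<in> U" for x using D(1) that assms(3) by (auto intro!: derivative_eq_intros)
    fix b :: 'a assume b: "b \<in> Basis"
    show "Ck_on k U (\<lambda>x. - (inverse (f x) * frechet_derivative f (at x) b * inverse (f x)))"
      by (intro Ck_on_linear[OF assms(1) bounded_linear_minus[OF bounded_linear_ident]]
         Ck_on_bilinear[OF assms(1) bounded_bilinear_mult] i D(2) b)
  qed
qed

lemma Ck_on_sqrt:
  fixes f :: "'a::euclidean_space \<Rightarrow> real"
  assumes "open U" "Ck_on k U f" "\<And>x. x \<in> U \<Longrightarrow> f x > 0"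
  shows "Ck_on k U (\<lambda>x. sqrt (f x))"
  using assms(2)
proof (induction k)
  case 0
  then show ?case by (auto intro: continuous_intros)
next
  case (Suc k)
  note D = Ck_on_SucD[OF Suc.prems(1)]
  have "Ck_on k U (\<lambda>x. sqrt (f x))"
    using Suc by (blast intro: Ck_on_Suc_imp)
  then have i: "Ck_on k U (\<lambda>x. inverse (sqrt (f x)))"
    using assms(1,3) by (intro Ck_on_inverse) force+
  show ?case
  proof (rule Ck_on_SucI[OF assms(1), where f' = "\<lambda>x h. (1/2) *\<^sub>R (frechet_derivative f (at x) h * inverse (sqrt (f x)))"])
    show "((\<lambda>x. sqrt (f x)) has_derivative (\<lambda>h. (1/2) *\<^sub>R (frechet_derivative f (at x) h * inverse (sqrt (f x))))) (at x)"
      if "x \<in> U" for x using D(1)[OF that] assms(3)[OF that] by (auto intro!: derivative_eq_intros simp: divide_simps)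
    fix b :: 'a assume b: "b \<in> Basis"
    show "Ck_on k U (\<lambda>x. (1/2) *\<^sub>R (frechet_derivative f (at x) b * inverse (sqrt (f x))))"
      by (intro Ck_on_linear[OF assms(1) bounded_linear_scaleR_right]
         Ck_on_bilinear[OF assms(1) bounded_bilinear_mult] i D(2) b)
  qed
qed

lemma Ck_on_ident: "open U \<Longrightarrow> Ck_on k U (\<lambda>x. x)"
  by (cases k) (auto intro!: Ck_on_SucI[where f' = "\<lambda>x h. h"] Ck_on_const simp del: Ck_on.simps(2))

section \<open>Closure properties of smooth maps\<close>

lemma smooth_on_subset: "smooth_on U f \<Longrightarrow> V \<subseteq> U \<Longrightarrow> smooth_on V f"
  by (auto simp: smooth_on_def intro: Ck_on_mono_open)

lemma smooth_on_eqI: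
  "open U \<Longrightarrow> smooth_on U g \<Longrightarrow> (\<And>x. x \<in> U \<Longrightarrow> f x = g x) \<Longrightarrow> smooth_on U f"
  using Ck_on_eqI[of U _ g f] by (auto simp: smooth_on_def)

lemma smooth_on_const: "open U \<Longrightarrow> smooth_on U (\<lambda>x. c)"
  by (simp add: smooth_on_def Ck_on_const)

lemma smooth_on_ident: "open U \<Longrightarrow> smooth_on U (\<lambda>x. x)"
  by (simp add: smooth_on_def Ck_on_ident)

lemma smooth_on_linear: "open U \<Longrightarrow> bounded_linear L \<Longrightarrow> smooth_on U f \<Longrightarrow> smooth_on U (\<lambda>x. L (f x))"
  by (simp add: smooth_on_def Ck_on_linear)

lemma smooth_on_add: "open U \<Longrightarrow> smooth_on U f \<Longrightarrow> smooth_on U g \<Longrightarrow> smooth_on U (\<lambda>x. f x + g x)"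
  by (simp add: smooth_on_def Ck_on_add)

lemma smooth_on_minus: "open U \<Longrightarrow> smooth_on U f \<Longrightarrow> smooth_on U (\<lambda>x. - f x)"
  by (rule smooth_on_linear[OF _ bounded_linear_minus[OF bounded_linear_ident]])

lemma smooth_on_diff: "open U \<Longrightarrow> smooth_on U f \<Longrightarrow> smooth_on U g \<Longrightarrow> smooth_on U (\<lambda>x. f x - g x)"
  using smooth_on_add[of U f "\<lambda>x. - g x"] smooth_on_minus[of U g] by simp

lemma smooth_on_bilinear:
  "open U \<Longrightarrow> bounded_bilinear B \<Longrightarrow> smooth_on U f \<Longrightarrow> smooth_on U g \<Longrightarrow> smooth_on U (\<lambda>x. B (f x) (g x))"
  by (simp add: smooth_on_def Ck_on_bilinear)

lemmas smooth_on_scaleR = smooth_on_bilinear[OF _ bounded_bilinear_scaleR]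

lemma smooth_on_mult:
  fixes f g :: "'a::euclidean_space \<Rightarrow> real"
  shows "open U \<Longrightarrow> smooth_on U f \<Longrightarrow> smooth_on U g \<Longrightarrow> smooth_on U (\<lambda>x. f x * g x)"
  by (rule smooth_on_bilinear[OF _ bounded_bilinear_mult])

lemma smooth_on_sum: "open U \<Longrightarrow> (\<And>i. i \<in> S \<Longrightarrow> smooth_on U (f i)) \<Longrightarrow> smooth_on U (\<lambda>x. \<Sum>i\<in>S. f i x)"
  by (simp add: smooth_on_def Ck_on_sum)

lemma smooth_on_prod:
  fixes f :: "'i \<Rightarrow> 'a::euclidean_space \<Rightarrow> real"
  shows "open U \<Longrightarrow> (\<And>i. i \<in> S \<Longrightarrow> smooth_on U (f i)) \<Longrightarrow> smooth_on U (\<lambda>x. \<Prod>i\<in>S. f i x)"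
  by (induction S rule: infinite_finite_induct) (auto intro: smooth_on_const smooth_on_mult)

lemma smooth_on_compose:
  "open U \<Longrightarrow> open W \<Longrightarrow> smooth_on W f \<Longrightarrow> smooth_on U \<phi> \<Longrightarrow> \<phi> ` U \<subseteq> W \<Longrightarrow> smooth_on U (\<lambda>x. f (\<phi> x))"
  by (simp add: smooth_on_def Ck_on_compose)

lemma smooth_on_inverse:
  fixes f :: "'a::euclidean_space \<Rightarrow> real"
  shows "open U \<Longrightarrow> smooth_on U f \<Longrightarrow> (\<And>x. x \<in> U \<Longrightarrow> f x \<noteq> 0) \<Longrightarrow> smooth_on U (\<lambda>x. inverse (f x))"
  by (simp add: smooth_on_def Ck_on_inverse)

lemma smooth_on_divide:
  fixes f g :: "'a::euclidean_space \<Rightarrow> real"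
  shows "open U \<Longrightarrow> smooth_on U f \<Longrightarrow> smooth_on U g \<Longrightarrow> (\<And>x. x \<in> U \<Longrightarrow> g x \<noteq> 0) \<Longrightarrow> smooth_on U (\<lambda>x. f x / g x)"
  unfolding divide_inverse by (intro smooth_on_mult smooth_on_inverse)

lemma smooth_on_sqrt:
  fixes f :: "'a::euclidean_space \<Rightarrow> real"
  shows "open U \<Longrightarrow> smooth_on U f \<Longrightarrow> (\<And>x. x \<in> U \<Longrightarrow> f x > 0) \<Longrightarrow> smooth_on U (\<lambda>x. sqrt (f x))"
  by (simp add: smooth_on_def Ck_on_sqrt)

lemma smooth_on_nth: "open U \<Longrightarrow> smooth_on U f \<Longrightarrow> smooth_on U (\<lambda>x. f x $ i)"
  by (rule smooth_on_linear[OF _ bounded_linear_vec_nth])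

lemma bounded_linear_axis: "bounded_linear (axis i :: 'b::real_normed_vector \<Rightarrow> 'b^'n)"
proof (rule bounded_linear_intro[where K = 1])
  show "norm (axis i x :: 'b^'n) \<le> norm x * 1" for x :: 'b
    by (simp add: norm_vec_def axis_def L2_set_def if_distrib[of norm] if_distrib[of "\<lambda>x. x\<^sup>2"] cong: if_cong)
qed (auto simp: axis_def vec_eq_iff)

lemma smooth_on_vec:
  fixes f :: "'a::euclidean_space \<Rightarrow> ('b::real_normed_vector)^'n"
  assumes "open U" "\<And>i. smooth_on U (\<lambda>x. f x $ i)"
  shows "smooth_on U f"
proof -
  have "f x = (\<Sum>i\<in>UNIV. axis i (f x $ i))" for x
    by (simp add: vec_eq_iff axis_def)
  then have "f = (\<lambda>x. \<Sum>i\<in>UNIV. axis i (f x $ i))" by blast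
  moreover have "smooth_on U (\<lambda>x. \<Sum>i\<in>UNIV. axis i (f x $ i))"
    by (intro smooth_on_sum smooth_on_linear[OF _ bounded_linear_axis] assms)
  ultimately show ?thesis by simp
qed

lemma smooth_on_vec_lambda:
  assumes "open U" "\<And>i. smooth_on U (f i)"
  shows "smooth_on U (\<lambda>x. \<chi> i. f i x)"
  using assms by (intro smooth_on_vec) auto

lemma smooth_on_inner:
  "open U \<Longrightarrow> smooth_on U f \<Longrightarrow> smooth_on U g \<Longrightarrow> smooth_on U (\<lambda>x. f x \<bullet> g x)"
  by (rule smooth_on_bilinear[OF _ bounded_bilinear_inner])

lemma smooth_on_matrix_vector_mult:
  fixes A :: "'a::euclidean_space \<Rightarrow> real^'n^'m"
  shows "open U \<Longrightarrow> smooth_on U A \<Longrightarrow> smooth_on U v \<Longrightarrow> smooth_on U (\<lambda>x. A x *v v x)"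
  unfolding matrix_vector_mult_def
  by (intro smooth_on_vec_lambda smooth_on_sum smooth_on_mult smooth_on_nth)

lemma smooth_on_matrix_mult:
  fixes A :: "'a::euclidean_space \<Rightarrow> real^'n^'m" and B :: "'a \<Rightarrow> real^'p^'n"
  shows "open U \<Longrightarrow> smooth_on U A \<Longrightarrow> smooth_on U B \<Longrightarrow> smooth_on U (\<lambda>x. A x ** B x)"
  unfolding matrix_matrix_mult_def
  by (intro smooth_on_vec_lambda smooth_on_sum smooth_on_mult smooth_on_nth)

lemma smooth_on_transpose:
  fixes A :: "'a::euclidean_space \<Rightarrow> real^'n^'m"
  shows "open U \<Longrightarrow> smooth_on U A \<Longrightarrow> smooth_on U (\<lambda>x. transpose (A x))"
  unfolding transpose_def by (intro smooth_on_vec_lambda smooth_on_nth)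

lemma smooth_on_det:
  fixes A :: "'a::euclidean_space \<Rightarrow> real^'n^'n"
  shows "open U \<Longrightarrow> smooth_on U A \<Longrightarrow> smooth_on U (\<lambda>x. det (A x))"
  unfolding det_def by (intro smooth_on_sum smooth_on_mult smooth_on_prod smooth_on_nth smooth_on_const)

section \<open>Inverses of smooth matrix functions\<close>

lemma matrix_inv_inverts:
  fixes A :: "real^'n^'n"
  assumes "det A \<noteq> 0"
  shows "A ** matrix_inv A = mat 1" "matrix_inv A ** A = mat 1"
proof -
  have "\<exists>B. A ** B = mat 1 \<and> B ** A = mat 1"
    using assms invertible_det_nz[of A] by (simp add: invertible_def)
  then have "A ** matrix_inv A = mat 1 \<and> matrix_inv A ** A = mat 1"
    unfolding matrix_inv_def by (rule someI_ex)
  then show "A ** matrix_inv A = mat 1" "matrix_inv A ** A = mat 1" by auto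
qed

text \<open>Cramer's rule makes the entries quotients of determinants, from which
  \<open>smooth_on_matrix_inv\<close> reads off smoothness.\<close>

lemma matrix_inv_cramer:
  fixes A :: "real^'n^'n"
  assumes "det A \<noteq> 0"
  shows "matrix_inv A $ i $ j = det (\<chi> r s. if s = i then axis j 1 $ r else A $ r $ s) / det A"
proof -
  have "A *v (matrix_inv A *v axis j 1) = axis j 1"
    by (simp add: matrix_vector_mul_assoc matrix_inv_inverts[OF assms])
  then have "matrix_inv A *v axis j 1 = (\<chi> k. det (\<chi> r s. if s = k then axis j 1 $ r else A $ r $ s) / det A)"
    using cramer[OF assms] by blast
  moreover have "(matrix_inv A *v axis j 1) $ i = matrix_inv A $ i $ j"
    by (simp add: matrix_vector_mult_basis column_def)
  ultimately show ?thesis by simp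
qed

lemma smooth_on_matrix_inv:
  fixes A :: "'a::euclidean_space \<Rightarrow> real^'n^'n"
  assumes "open U" "smooth_on U A" "\<And>x. x \<in> U \<Longrightarrow> det (A x) \<noteq> 0"
  shows "smooth_on U (\<lambda>x. matrix_inv (A x))"
proof (intro smooth_on_vec assms(1))
  fix i j
  have "smooth_on U (\<lambda>x. \<chi> r s. if s = i then axis j (1::real) $ r else A x $ r $ s)"
  proof (intro smooth_on_vec_lambda assms(1))
    show "smooth_on U (\<lambda>x. if s = i then axis j (1::real) $ r else A x $ r $ s)" for r s
      by (cases "s = i") (simp_all add: smooth_on_const smooth_on_nth assms)
  qed
  then have "smooth_on U (\<lambda>x. det (\<chi> r s. if s = i then axis j 1 $ r else A x $ r $ s) / det (A x))"
    by (intro smooth_on_divide smooth_on_det assms) auto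
  then show "smooth_on U (\<lambda>x. matrix_inv (A x) $ i $ j)"
    by (rule smooth_on_eqI[OF assms(1)]) (rule matrix_inv_cramer[OF assms(3)])
qed

section \<open>Derivatives and partial derivatives of smooth maps\<close>

lemma smooth_on_has_derivative:
  assumes "smooth_on U f" "x \<in> U"
  shows "(f has_derivative frechet_derivative f (at x)) (at x)"
proof -
  have "Ck_on (Suc 0) U f" using assms(1) by (auto simp only: smooth_on_def)
  from Ck_on_SucD(1)[OF this assms(2)] show ?thesis .
qed

lemma smooth_on_continuous_on: "smooth_on U f \<Longrightarrow> continuous_on U f"
  unfolding smooth_on_def by (metis Ck_on.simps(1))

lemma pd_eq:
  assumes "(f has_derivative f') (at y)"
  shows "((\<lambda>t. f (y + t *\<^sub>R axis a 1)) has_vector_derivative f' (axis a 1)) (at 0)" "pd a f y = f' (axis a 1)"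
proof -
  have "(f has_derivative f') (at (y + 0 *\<^sub>R axis a 1))" using assms by simp
  then have "((\<lambda>t. f (y + t *\<^sub>R axis a 1)) has_derivative (\<lambda>h. f' (h *\<^sub>R axis a 1))) (at 0)"
    by (rule has_derivative_compose[rotated]) (auto intro!: derivative_eq_intros)
  moreover have "f' (h *\<^sub>R axis a 1) = h *\<^sub>R f' (axis a 1)" for h
    using assms by (simp add: has_derivative_linear linear_scale)
  ultimately show 1: "((\<lambda>t. f (y + t *\<^sub>R axis a 1)) has_vector_derivative f' (axis a 1)) (at 0)"
    by (simp add: has_vector_derivative_def)
  then show "pd a f y = f' (axis a 1)"
    by (simp add: pd_def vector_derivative_at)
qed

lemma smooth_on_pd_derivative:
  assumes "smooth_on U f" "y \<in> U"
  shows "((\<lambda>t. f (y + t *\<^sub>R axis a 1)) has_vector_derivative pd a f y) (at 0)"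
  using pd_eq[OF smooth_on_has_derivative[OF assms], of a] by simp

lemma smooth_on_frechet:
  assumes "smooth_on U f" "b \<in> Basis"
  shows "smooth_on U (\<lambda>x. frechet_derivative f (at x) b)"
  unfolding smooth_on_def
proof
  fix k
  have "Ck_on (Suc k) U f" using assms(1) by (auto simp only: smooth_on_def)
  from Ck_on_SucD(2)[OF this assms(2)] show "Ck_on k U (\<lambda>x. frechet_derivative f (at x) b)" .
qed

lemma smooth_on_pd:
  assumes "open U" "smooth_on U f"
  shows "smooth_on U (pd a f)"
proof -
  have "smooth_on U (\<lambda>x. frechet_derivative f (at x) (axis a 1))"
    by (rule smooth_on_frechet[OF assms(2)]) (simp add: axis_in_Basis_iff)
  then show ?thesis
    by (rule smooth_on_eqI[OF assms(1)]) (rule pd_eq(2)[OF smooth_on_has_derivative[OF assms(2)]])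
qed

lemma pd_chain:
  fixes f :: "real^'n \<Rightarrow> 'b::real_normed_vector"
  assumes "(f has_derivative f') (at (\<phi> y))" "(\<phi> has_derivative \<phi>') (at y)"
  shows "pd a (\<lambda>x. f (\<phi> x)) y = (\<Sum>b\<in>UNIV. (matrix \<phi>' $ b $ a) *\<^sub>R pd b f (\<phi> y))"
proof -
  have "((\<lambda>x. f (\<phi> x)) has_derivative (\<lambda>h. f' (\<phi>' h))) (at y)"
    using assms by (rule has_derivative_compose[rotated])
  then have "pd a (\<lambda>x. f (\<phi> x)) y = f' (\<phi>' (axis a 1))" by (rule pd_eq)
  also have "\<phi>' (axis a 1) = (\<Sum>b\<in>UNIV. (matrix \<phi>' $ b $ a) *\<^sub>R axis b 1)"
    by (simp add: matrix_def vec_eq_iff axis_def if_distrib cong: if_cong)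
  also have "f' \<dots> = (\<Sum>b\<in>UNIV. (matrix \<phi>' $ b $ a) *\<^sub>R f' (axis b 1))"
    using assms(1) by (simp add: has_derivative_linear linear_scale linear_sum)
  finally show ?thesis using pd_eq(2)[OF assms(1)] by simp
qed

lemmas smooth_intros = smooth_on_const smooth_on_ident smooth_on_add smooth_on_diff smooth_on_minus
  smooth_on_scaleR smooth_on_mult smooth_on_sum smooth_on_prod smooth_on_nth
  smooth_on_vec_lambda smooth_on_inner smooth_on_matrix_vector_mult smooth_on_matrix_mult
  smooth_on_transpose smooth_on_det smooth_on_pd


section \<open>The identity component and the stabiliser of the null ray\<close>

lemma UNIV_tidx: "(UNIV :: 'n tidx set) = insert Top (insert Bot (range Mid))"
  using tidx.exhaust by auto

lemma sum_tidx: "(\<Sum>i\<in>UNIV. f i) = f Top + (\<Sum>a\<in>UNIV. f (Mid a)) + f (Bot :: 'n::finite tidx)"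
  for f :: "_ \<Rightarrow> 'a::comm_monoid_add"
proof -
  have "(\<Sum>i\<in>range (Mid :: 'n \<Rightarrow> _). f i) = (\<Sum>a\<in>UNIV. f (Mid a))"
    by (rule sum.reindex_cong[of Mid]) (auto intro: injI)
  then show ?thesis
    by (simp add: UNIV_tidx image_iff add_ac)
qed

lemma prod_tidx: "(\<Prod>i\<in>UNIV. f i) = f Top * (\<Prod>a\<in>UNIV. f (Mid a)) * f (Bot :: 'n::finite tidx)"
  for f :: "_ \<Rightarrow> 'a::comm_monoid_mult"
proof -
  have "(\<Prod>i\<in>range (Mid :: 'n \<Rightarrow> _). f i) = (\<Prod>a\<in>UNIV. f (Mid a))"
    by (rule prod.reindex_cong[of Mid]) (auto intro: injI)
  then show ?thesis
    by (simp add: UNIV_tidx image_iff mult_ac)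
qed

lemma tvec_nth [simp]: "tvec s m r $ Top = s" "tvec s m r $ Mid a = m $ a" "tvec s m r $ Bot = r" "mid (tvec s m r) = m"
  by (simp_all add: tvec_def mid_def vec_eq_iff)

lemma tvec_eqI: "v $ Top = w $ Top \<Longrightarrow> mid v = mid w \<Longrightarrow> v $ Bot = w $ Bot \<Longrightarrow> v = w"
  by (auto simp: vec_eq_iff mid_def intro: tidx.exhaust) (metis tidx.exhaust)

lemma tvec_collapse [simp]: "tvec (v $ Top) (mid v) (v $ Bot) = v"
  by (rule tvec_eqI) auto

lemma mid_nth: "mid v $ a = v $ Mid a"
  by (simp add: mid_def)

lemma mid_simps [simp]: "mid (v + w) = mid v + mid w" "mid (v - w) = mid v - mid w" "mid (r *\<^sub>R v) = r *\<^sub>R mid v"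
  "mid 0 = 0" "mid (- v) = - mid v"
  by (simp_all add: mid_def vec_eq_iff)

lemma mid_sum: "mid (\<Sum>i\<in>S. f i) = (\<Sum>i\<in>S. mid (f i))"
  by (induction S rule: infinite_finite_induct) auto

lemma axis_tidx: "axis Top 1 = tvec 1 0 0" "axis Bot 1 = tvec 0 0 1" "axis (Mid a) 1 = tvec 0 (axis a 1) 0"
  by (rule tvec_eqI; simp add: axis_def mid_def vec_eq_iff)+

section \<open>The Lorentzian form and its orthogonal group\<close>

lemma hform_sym: "hform v w = hform w v"
  by (simp add: hform_def inner_commute mult.commute)

lemma hform_simps:
  "hform (v + w) u = hform v u + hform w u" "hform u (v + w) = hform u v + hform u w"
  "hform (v - w) u = hform v u - hform w u" "hform u (v - w) = hform u v - hform u w"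
  "hform (c *\<^sub>R v) u = c * hform v u" "hform u (c *\<^sub>R v) = c * hform u v"
  "hform 0 u = 0" "hform u 0 = 0" "hform (- v) u = - hform v u" "hform u (- v) = - hform u v"
  by (simp_all add: hform_def inner_add_right inner_add_left inner_diff_left inner_diff_right algebra_simps)

lemma matrix_linear_works: "linear f \<Longrightarrow> matrix f *v x = f x" for f :: "real^'n \<Rightarrow> real^'m"
  by (rule fun_cong[OF matrix_vector_mul(2)])

text \<open>The Gram matrix of \<open>hform\<close>. It turns statements on \<open>hform\<close>
  into statements on the Euclidean inner product, for which transposes are at hand.\<close>

definition Hmat :: "real^('n::finite) tidx^'n tidx" where
  "Hmat = matrix (\<lambda>v. tvec (v $ Bot) (mid v) (v $ Top))"

lemma Hmat_works: "Hmat *v v = tvec (v $ Bot) (mid v) (v $ Top)"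
  unfolding Hmat_def by (rule matrix_linear_works) (auto intro!: linearI tvec_eqI)

lemma inner_tidx: "v \<bullet> w = v $ Top * w $ Top + mid v \<bullet> mid w + v $ Bot * w $ Bot" for v w :: "real^('n::finite) tidx"
  by (simp add: inner_vec_def sum_tidx mid_def)

lemma hform_Hmat: "hform v w = v \<bullet> (Hmat *v w)"
  by (simp add: Hmat_works inner_tidx hform_def)

lemma Hmat_sq: "Hmat ** Hmat = mat 1"
  by (rule matrix_eq[THEN iffD2]) (auto simp: Hmat_works simp flip: matrix_vector_mul_assoc)

lemma det_Hmat: "det (Hmat :: real^('n::finite) tidx^'n tidx) \<noteq> 0"
proof -
  have "det (Hmat ** Hmat :: real^'n tidx^'n tidx) = 1" by (simp only: Hmat_sq det_I)
  then show ?thesis by (auto simp: det_mul)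
qed

lemma inner_matrix_adjoint: "(B *v x) \<bullet> y = x \<bullet> (transpose B *v y)" for B :: "real^'n^'m"
  by (metis dot_lmul_matrix vector_transpose_matrix)

text \<open>Isometries of either determinant. As this is given by equations alone, membership can be
  checked along a whole path before the sign of the determinant is settled.\<close>

definition O_h :: "(real^('n::finite) tidx^'n tidx) set" where
  "O_h = {B. \<forall>v w. hform (B *v v) (B *v w) = hform v w}"

lemma O_hI: "(\<And>v w. hform (B *v v) (B *v w) = hform v w) \<Longrightarrow> B \<in> O_h"
  by (simp add: O_h_def)

lemma O_h_mult: "B \<in> O_h \<Longrightarrow> C \<in> O_h \<Longrightarrow> B ** C \<in> O_h"
  by (simp add: O_h_def flip: matrix_vector_mul_assoc)

lemma SO_h_eq: "SO_h = {B \<in> O_h. det B = 1}"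
  by (auto simp: SO_h_def O_h_def)

lemma O_h_transpose: "B \<in> O_h \<longleftrightarrow> transpose B ** Hmat ** B = Hmat"
proof -
  have "hform (B *v v) (B *v w) = v \<bullet> ((transpose B ** Hmat ** B) *v w)" for v w
    by (simp only: hform_Hmat inner_matrix_adjoint matrix_vector_mul_assoc matrix_mul_assoc)
  then have "B \<in> O_h \<longleftrightarrow> (\<forall>w v. v \<bullet> ((transpose B ** Hmat ** B) *v w) = v \<bullet> (Hmat *v w))"
    by (auto simp: O_h_def hform_Hmat)
  also have "\<dots> \<longleftrightarrow> (\<forall>w. (transpose B ** Hmat ** B) *v w = Hmat *v w)"
    by (metis vector_eq_ldot)
  finally show ?thesis by (simp add: matrix_eq)
qed

lemma det_O_h:
  fixes B :: "real^('n::finite) tidx^'n tidx"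
  assumes "B \<in> O_h"
  shows "det B = 1 \<or> det B = - 1"
proof -
  have "det (transpose B ** Hmat ** B) = det (Hmat :: real^'n tidx^'n tidx)"
    using assms by (simp add: O_h_transpose)
  then have "(det B)\<^sup>2 = 1"
    using det_Hmat[where ?'n = 'n] by (simp add: det_mul det_transpose power2_eq_square)
  then show ?thesis by (simp add: power2_eq_1_iff)
qed

text \<open>On \<open>O_h\<close> the determinant takes only the values 1 and -1; on a connected set
  through the identity the intermediate value theorem leaves only 1, so the set lies in
  \<open>SO_h\<close> and hence in the component of the identity.\<close>

lemma connected_O_h_subset:
  assumes "connected S" "S \<subseteq> O_h" "mat 1 \<in> S"
  shows "S \<subseteq> Ggrp"
proof -
  have cont: "continuous_on S (\<lambda>B. det B)"
    unfolding det_def by (intro continuous_intros)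
  have "det B = 1" if "B \<in> S" for B
  proof (rule ccontr)
    assume "det B \<noteq> 1"
    then have "det B = - 1" using det_O_h assms(2) that by blast
    moreover have "connected (det ` S)" using cont assms(1) by (rule connected_continuous_image)
    then have "is_interval (det ` S)" by (simp add: is_interval_connected_1)
    moreover have "det B \<in> det ` S" "1 \<in> det ` S" using that assms(3) by (auto intro!: image_eqI[of _ _ "mat 1"])
    ultimately have "0 \<in> det ` S"
      unfolding is_interval_1 by (metis neg_le_0_iff_le zero_le_one)
    then show False using det_O_h assms(2) by (force)
  qed
  then have "S \<subseteq> SO_h" using assms(2) by (auto simp: SO_h_eq)
  then show ?thesis unfolding Ggrp_def
    using assms connected_component_maximal by blast
qed

lemma Ggrp_path:
  assumes "continuous_on {0..1} p" "\<And>t. t \<in> {0..1} \<Longrightarrow> p t \<in> O_h" "p 0 = mat 1"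
  shows "p (1::real) \<in> Ggrp"
proof -
  have "connected (p ` {0..1})" using assms(1) by (rule connected_continuous_image) simp
  then have "p ` {0..1} \<subseteq> Ggrp"
    using assms by (intro connected_O_h_subset) (auto intro!: image_eqI[of _ _ 0])
  then show ?thesis by auto
qed

lemma mat_1_SO_h: "mat 1 \<in> SO_h"
  by (simp add: SO_h_def)

lemma Ggrp_SO_h: "Ggrp \<subseteq> SO_h"
  unfolding Ggrp_def by (rule connected_component_subset)

lemma Ggrp_one: "mat 1 \<in> Ggrp"
  unfolding Ggrp_def using mat_1_SO_h by simp

lemma Ggrp_det: "B \<in> Ggrp \<Longrightarrow> det B = 1"
  using Ggrp_SO_h by (auto simp: SO_h_eq)

lemma Ggrp_O_h: "B \<in> Ggrp \<Longrightarrow> B \<in> O_h"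
  using Ggrp_SO_h by (auto simp: SO_h_eq)

text \<open>The right translate of the identity component by \<open>C\<close> is connected and
  contains \<open>C\<close>, so it stays in the component of \<open>C\<close>, which is that of the
  identity.\<close>

lemma Ggrp_mult:
  fixes B C :: "real^('n::finite) tidx^'n tidx"
  assumes "B \<in> Ggrp" "C \<in> Ggrp"
  shows "B ** C \<in> Ggrp"
proof -
  have "continuous_on Ggrp (\<lambda>B. B ** C)"
    unfolding matrix_matrix_mult_def by (intro continuous_intros)
  moreover have "connected (Ggrp :: (real^'n tidx^'n tidx) set)"
    unfolding Ggrp_def by simp
  ultimately have "connected ((\<lambda>B. B ** C) ` Ggrp)"
    by (rule connected_continuous_image)
  moreover have "C \<in> (\<lambda>B. B ** C) ` Ggrp" using Ggrp_one by (force intro: image_eqI[of _ _ "mat 1"])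
  moreover have "(\<lambda>B. B ** C) ` Ggrp \<subseteq> SO_h"
    using assms(2) by (auto simp: SO_h_eq O_h_mult det_mul Ggrp_O_h Ggrp_det)
  ultimately have "(\<lambda>B. B ** C) ` Ggrp \<subseteq> connected_component_set SO_h C"
    by (intro connected_component_maximal)
  also have "\<dots> = Ggrp" unfolding Ggrp_def
    using assms(2) by (simp add: Ggrp_def connected_component_eq)
  finally show ?thesis using assms(1) by blast
qed

text \<open>The embedding as the middle block. On rotations its image is the rotation part of the
  Levi factor of the parabolic subgroup.\<close>

definition blk :: "real^'n^'n \<Rightarrow> real^('n::finite) tidx^'n tidx" where
  "blk M = (\<chi> i j. case i of
      Top \<Rightarrow> if j = Top then 1 else 0
    | Bot \<Rightarrow> if j = Bot then 1 else 0
    | Mid a \<Rightarrow> (case j of Mid b \<Rightarrow> M $ a $ b | _ \<Rightarrow> 0))"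

lemma blk_works: "blk M *v v = tvec (v $ Top) (M *v mid v) (v $ Bot)"
proof (rule tvec_eqI)
  show "mid (blk M *v v) = mid (tvec (v $ Top) (M *v mid v) (v $ Bot))"
    by (simp add: vec_eq_iff mid_nth blk_def matrix_vector_mult_def sum_tidx)
qed (simp_all add: blk_def matrix_vector_mult_def sum_tidx)

lemma blk_mult: "blk (A ** B) = blk A ** blk B"
  by (rule matrix_eq[THEN iffD2]) (auto simp: blk_works simp flip: matrix_vector_mul_assoc)

lemma blk_one: "blk (mat 1) = mat 1"
  by (rule matrix_eq[THEN iffD2]) (auto simp: blk_works)

text \<open>Both sides are multiplicative, so it suffices to treat matrices with a zero row,
  diagonal matrices, transpositions and transvections, where both sides are computed
  directly.\<close>

lemma det_blk: "det (blk M) = det M" for M :: "real^'n^('n::finite)"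
proof (rule induct_matrix_elementary[of "\<lambda>M. det (blk M) = det M"])
  fix A B :: "real^'n^'n"
  assume "det (blk A) = det A" "det (blk B) = det B"
  then show "det (blk (A ** B)) = det (A ** B)" by (simp add: blk_mult det_mul)
next
  fix A :: "real^'n^'n" and i
  assume a: "row i A = 0"
  then have "row (Mid i) (blk A) = 0"
    by (auto simp: row_def vec_eq_iff blk_def split: tidx.split)
  then show "det (blk A) = det A"
    using a det_zero_row(2) by metis
next
  fix A :: "real^'n^'n"
  assume a: "\<And>i j. i \<noteq> j \<Longrightarrow> A$i$j = 0"
  then have "blk A $ i $ j = 0" if "i \<noteq> j" for i j
    using that by (auto simp: blk_def split: tidx.split)
  then have "det (blk A) = (\<Prod>i\<in>UNIV. blk A $ i $ i)" by (rule det_diagonal)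
  also have "\<dots> = det A" using a by (simp add: det_diagonal prod_tidx blk_def)
  finally show "det (blk A) = det A" .
next
  fix m n :: 'n
  assume mn: "m \<noteq> n"
  have e: "blk (\<chi> i j. mat 1 $ i $ Transposition.transpose m n j) = (\<chi> i j. mat 1 $ i $ Transposition.transpose (Mid m) (Mid n) j)"
    by (auto simp: blk_def vec_eq_iff mat_def Transposition.transpose_def split: tidx.split)
  have s: "det (\<chi> i j. (mat 1 $ i $ Transposition.transpose m n j :: real)) = - 1" if "m \<noteq> n" for m n :: "'k::finite"
    using det_permute_columns[of "Transposition.transpose m n" "mat 1 :: real^'k^'k"] that
    by (simp add: sign_swap_id permutes_swap_id)
  show "det (blk (\<chi> i j. mat 1 $ i $ Transposition.transpose m n j)) = det (\<chi> i j. (mat 1 $ i $ Transposition.transpose m n j :: real))"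
    unfolding e using mn by (simp add: s)
next
  fix m n :: 'n and c :: real
  assume mn: "m \<noteq> n"
  have e: "blk (\<chi> i j. if i = m \<and> j = n then c else of_bool (i = j)) = (\<chi> i j. if i = Mid m \<and> j = Mid n then c else of_bool (i = j))"
    by (auto simp: blk_def vec_eq_iff split: tidx.split)
  have s: "det (\<chi> i j. if i = m \<and> j = n then c else of_bool (i = j)) = (1::real)" if "m \<noteq> n" for m n :: "'k::finite"
  proof -
    have "(\<chi> i j. if i = m \<and> j = n then c else of_bool (i = j)) =
        (\<chi> k. if k = m then row m (mat 1 :: real^'k^'k) + c *s row n (mat 1) else row k (mat 1))"
      using that by (auto simp: vec_eq_iff row_def mat_def)
    then show ?thesis using det_row_operation[OF that, of "mat 1" c] by simp
  qed
  show "det (blk (\<chi> i j. if i = m \<and> j = n then c else of_bool (i = j))) = det (\<chi> i j. if i = m \<and> j = n then c else of_bool (i = j))"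
    unfolding e using mn by (simp add: s)
qed

lemma blk_O_h:
  assumes "orthogonal_matrix M"
  shows "blk M \<in> O_h"
proof (rule O_hI)
  fix v w
  have "(M *v x) \<bullet> (M *v y) = x \<bullet> y" for x y
    using assms by (metis dot_lmul_matrix matrix_vector_mul_assoc matrix_vector_mul_lid orthogonal_matrix_def vector_transpose_matrix)
  then show "hform (blk M *v v) (blk M *v w) = hform v w"
    by (simp add: blk_works hform_def)
qed

definition refl_mat :: "real^'n \<Rightarrow> real^'n^('n::finite)" where
  "refl_mat a = (\<chi> i j. (if i = j then 1 else 0) - 2 * a $ i * a $ j / (a \<bullet> a))"

lemma refl_mat_works: "refl_mat a *v x = x - (2 * (a \<bullet> x) / (a \<bullet> a)) *\<^sub>R a"
proof (rule vec_eq_iff[THEN iffD2], rule allI)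
  fix i
  define k where "k = 2 / (a \<bullet> a) * a $ i"
  have "(refl_mat a *v x) $ i = (\<Sum>j\<in>UNIV. (if i = j then x $ j else 0) - k * (a $ j * x $ j))"
    unfolding refl_mat_def matrix_vector_mult_def k_def by (auto intro!: sum.cong simp: algebra_simps)
  also have "\<dots> = x $ i - k * (a \<bullet> x)"
    by (simp add: sum_subtractf inner_vec_def flip: sum_distrib_left)
  finally show "(refl_mat a *v x) $ i = (x - (2 * (a \<bullet> x) / (a \<bullet> a)) *\<^sub>R a) $ i" by (simp add: k_def mult_ac)
qed

lemma refl_mat_sq: "a \<noteq> 0 \<Longrightarrow> refl_mat a ** refl_mat a = mat 1"
  by (rule matrix_eq[THEN iffD2])
    (auto simp: refl_mat_works inner_diff_right field_simps simp flip: matrix_vector_mul_assoc)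

lemma refl_mat_orthogonal: "a \<noteq> 0 \<Longrightarrow> orthogonal_matrix (refl_mat a)"
proof -
  assume "a \<noteq> 0"
  moreover have "transpose (refl_mat a) = refl_mat a"
    by (auto simp: transpose_def refl_mat_def vec_eq_iff)
  ultimately show ?thesis by (simp add: orthogonal_matrix refl_mat_sq)
qed

text \<open>The normal of the second mirror travels along the segment from \<open>b\<close> to
  \<open>a\<close>. Avoiding 0 keeps every reflection on the way defined and continuous, and at the
  start two equal reflections cancel.\<close>

lemma refl_mat_pair_Ggrp:
  assumes "0 \<notin> closed_segment b a"
  shows "blk (refl_mat b ** refl_mat a) \<in> Ggrp"
proof -
  define s where "s t = (1 - t) *\<^sub>R b + t *\<^sub>R a" for t :: real
  have s0: "s t \<noteq> 0" if "t \<in> {0..1}" for t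
    using assms that by (auto simp: s_def closed_segment_def)
  have b0: "b \<noteq> 0" using s0[of 0] by (simp add: s_def)
  have "continuous_on {0..1} (\<lambda>t. (case i of
      Top \<Rightarrow> if j = Top then 1 else 0
    | Bot \<Rightarrow> if j = Bot then 1 else 0
    | Mid p \<Rightarrow> (case j of Mid q \<Rightarrow> (refl_mat b ** refl_mat (s t)) $ p $ q | _ \<Rightarrow> 0)))" for i j
    unfolding matrix_matrix_mult_def refl_mat_def s_def
    by (cases i; cases j) (auto intro!: continuous_intros simp: s0[unfolded s_def])
  then have "continuous_on {0..1} (\<lambda>t. blk (refl_mat b ** refl_mat (s t)))"
    unfolding blk_def by (intro continuous_on_vec_lambda)
  moreover have "blk (refl_mat b ** refl_mat (s t)) \<in> O_h" if "t \<in> {0..1}" for t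
    using s0[OF that] b0 by (intro blk_O_h orthogonal_matrix_mul refl_mat_orthogonal)
  ultimately have "blk (refl_mat b ** refl_mat (s 1)) \<in> Ggrp"
  proof (rule Ggrp_path)
    have "s 0 = b" by (simp add: s_def)
    then show "blk (refl_mat b ** refl_mat (s 0)) = mat 1" by (simp only: refl_mat_sq[OF b0] blk_one)
  qed
  then show ?thesis by (simp add: s_def)
qed

text \<open>Induction on the number of moved basis vectors: one of them is moved back by a product of two
  reflections, and such a product is joined to the identity by moving one mirror onto the other.\<close>

lemma blk_rotation_Ggrp:
  fixes M :: "real^'n^('n::finite)"
  assumes "orthogonal_matrix M" "det M > 0"
  shows "blk M \<in> Ggrp"
  using assms
proof (induction "card {j. M *v axis j 1 \<noteq> axis j 1}" arbitrary: M rule: less_induct)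
  case less
  have iso: "(M *v x) \<bullet> (M *v y) = x \<bullet> y" for x y
    using less.prems(1) by (metis dot_lmul_matrix matrix_vector_mul_assoc matrix_vector_mul_lid orthogonal_matrix_def vector_transpose_matrix)
  \<comment> \<open>Common to the cases below: a product of two reflections that puts e_j back and
    keeps the fixed basis vectors fixed leaves a rotation with fewer moved vectors. The same
    reflections in the opposite order then recover \<open>M\<close>.\<close>
  have step: ?case if seg: "0 \<notin> closed_segment b a"
    and fx: "\<And>i. M *v axis i 1 = axis i 1 \<Longrightarrow> a \<bullet> axis i 1 = 0 \<and> b \<bullet> axis i 1 = 0"
    and mv: "M *v axis j 1 \<noteq> axis j 1" "refl_mat b *v (refl_mat a *v (M *v axis j 1)) = axis j 1" for a b j
  proof -
    define R where "R = refl_mat b ** refl_mat a"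
    define R' where "R' = refl_mat a ** refl_mat b"
    have ne: "a \<noteq> 0" "b \<noteq> 0" using seg by (metis ends_in_segment)+
    have R: "blk R \<in> Ggrp" "blk R' \<in> Ggrp" using seg unfolding R_def R'_def
      by (auto intro: refl_mat_pair_Ggrp simp: closed_segment_commute)
    have "R' ** R = refl_mat a ** (refl_mat b ** refl_mat b) ** refl_mat a"
      by (simp add: R_def R'_def matrix_mul_assoc)
    then have R'R: "R' ** R = mat 1" using ne by (simp add: refl_mat_sq)
    have "det R = 1" using Ggrp_det[OF R(1)] by (simp add: det_blk)
    have "blk (R ** M) \<in> Ggrp"
    proof (rule less.hyps)
      have "{j. (R ** M) *v axis j 1 \<noteq> axis j 1} \<subset> {j. M *v axis j 1 \<noteq> axis j 1}"
      proof
        show "{j. (R ** M) *v axis j 1 \<noteq> axis j 1} \<subseteq> {j. M *v axis j 1 \<noteq> axis j 1}"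
          using fx by (auto simp: R_def refl_mat_works simp flip: matrix_vector_mul_assoc)
        have "(R ** M) *v axis j 1 = axis j 1" using mv(2) by (simp add: R_def flip: matrix_vector_mul_assoc)
        then show "{j. (R ** M) *v axis j 1 \<noteq> axis j 1} \<noteq> {j. M *v axis j 1 \<noteq> axis j 1}"
          using mv(1) by auto
      qed
      then show "card {j. (R ** M) *v axis j 1 \<noteq> axis j 1} < card {j. M *v axis j 1 \<noteq> axis j 1}"
        by (rule psubset_card_mono[rotated]) simp
      show "orthogonal_matrix (R ** M)" unfolding R_def
        by (intro orthogonal_matrix_mul refl_mat_orthogonal ne less.prems)
      show "det (R ** M) > 0" using less.prems \<open>det R = 1\<close> by (simp add: det_mul)
    qed
    with R(2) have "blk R' ** blk (R ** M) \<in> Ggrp" by (rule Ggrp_mult)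
    then show ?case by (simp add: R'R matrix_mul_assoc flip: blk_mult)
  qed
  show ?case
  proof (cases "\<exists>j. M *v axis j 1 \<noteq> axis j 1")
    case False
    then have "column j M = axis j 1" for j
      using matrix_vector_mult_basis[of M j] by simp
    then have "M $ i $ j = axis j 1 $ i" for i j
      by (metis column_def vec_lambda_beta)
    then have "M = mat 1"
      by (simp add: vec_eq_iff mat_def axis_def)
    then show ?thesis by (simp add: blk_one Ggrp_one)
  next
    case True
    show ?thesis
    proof (cases "\<exists>j. M *v axis j 1 \<noteq> axis j 1 \<and> M *v axis j 1 \<noteq> - axis j 1")
      case True
      then obtain j where j: "M *v axis j 1 \<noteq> axis j 1" "M *v axis j 1 \<noteq> - axis j 1" by blast
      define v where "v = M *v axis j 1"
      have vv: "v \<bullet> v = 1" by (simp add: v_def iso inner_axis_axis)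
      show ?thesis
      \<comment> \<open>As v is a unit vector, the mirror normal to v + e_j sends v to -e_j, and the
        mirror normal to e_j turns this into e_j. The segment from e_j to v + e_j could meet 0 only
        if v were -e_j.\<close>
      proof (rule step[of "axis j 1" "v + axis j 1" j])
        show "0 \<notin> closed_segment (axis j 1) (v + axis j 1)"
        proof
          assume "0 \<in> closed_segment (axis j 1) (v + axis j 1)"
          then obtain t where t: "0 \<le> t" "t \<le> 1" "0 = (1 - t) *\<^sub>R axis j 1 + t *\<^sub>R (v + axis j 1)"
            by (auto simp: closed_segment_def)
          then have e: "t *\<^sub>R v = - axis j 1" by (simp add: algebra_simps) (metis add_eq_0_iff add.commute)
          then have "(t *\<^sub>R v) \<bullet> (t *\<^sub>R v) = 1" by (simp add: inner_axis_axis)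
          then have "t = 1" using vv t(1) by (simp add: power2_eq_1_iff flip: power2_eq_square)
          then show False using e j(2) by (simp add: v_def)
        qed
        show "(v + axis j 1) \<bullet> axis i 1 = 0 \<and> (axis j 1 :: real^'n) \<bullet> axis i 1 = 0" if "M *v axis i 1 = axis i 1" for i
        proof -
          have "i \<noteq> j" using that j by auto
          then have "(axis j 1 :: real^'n) \<bullet> axis i 1 = 0" by (simp add: inner_axis_axis)
          moreover have "v \<bullet> axis i 1 = 0"
            using iso[of "axis j 1" "axis i 1"] that calculation by (simp add: v_def)
          ultimately show ?thesis by (simp add: inner_add_left)
        qed
        have ne: "1 + v \<bullet> axis j 1 \<noteq> 0"
        proof
          assume "1 + v \<bullet> axis j 1 = 0"
          then have "(v + axis j 1) \<bullet> (v + axis j 1) = 0"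
            by (simp add: inner_add_left inner_add_right vv inner_axis_axis inner_commute)
          then show False using j(2) by (simp add: v_def add_eq_0_iff2)
        qed
        have "2 * ((v + axis j 1) \<bullet> v) / ((v + axis j 1) \<bullet> (v + axis j 1)) = 1"
          using ne by (simp add: inner_add_left inner_add_right vv inner_axis_axis inner_commute)
        then have "refl_mat (v + axis j 1) *v v = - axis j 1"
          by (simp only: refl_mat_works) simp
        moreover have "refl_mat (axis j 1) *v - axis j 1 = (axis j 1 :: real^'n)"
          by (simp add: refl_mat_works inner_axis_axis) (simp add: vec_eq_iff)
        ultimately show "refl_mat (axis j 1) *v (refl_mat (v + axis j 1) *v (M *v axis j 1)) = axis j 1"
          by (simp only: v_def[symmetric])
      qed (rule j)
    next
      case False
      then have neg: "M *v axis j 1 = - axis j 1" if "M *v axis j 1 \<noteq> axis j 1" for j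
        using that by blast
      obtain j where j: "M *v axis j 1 \<noteq> axis j 1" using True by blast
      show ?thesis
      proof (cases "\<exists>i. i \<noteq> j \<and> M *v axis i 1 \<noteq> axis i 1")
        case True
        then obtain i where i: "i \<noteq> j" "M *v axis i 1 \<noteq> axis i 1" by blast
        show ?thesis
        \<comment> \<open>Here e_i and e_j are both sent to their negatives: the mirror normal to
          e_j restores e_j, and the one normal to e_i does not move it.\<close>
        proof (rule step[of "axis i 1" "axis j 1" j])
          show "0 \<notin> closed_segment (axis i 1) (axis j 1 :: real^'n)"
          proof
            assume "0 \<in> closed_segment (axis i 1) (axis j 1 :: real^'n)"
            then obtain t where t: "0 = (1 - t) *\<^sub>R axis i 1 + t *\<^sub>R (axis j 1 :: real^'n)"
              by (auto simp: closed_segment_def)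
            have "(0 :: real^'n) $ i = 0" "(0 :: real^'n) $ j = 0" by auto
            then show False unfolding t using i(1) by (simp add: axis_def)
          qed
          show "(axis j 1 :: real^'n) \<bullet> axis l 1 = 0 \<and> (axis i 1 :: real^'n) \<bullet> axis l 1 = 0" if "M *v axis l 1 = axis l 1" for l
            using that i j by (auto simp: inner_axis_axis)
          show "refl_mat (axis i 1) *v (refl_mat (axis j 1) *v (M *v axis j 1)) = axis j 1"
          proof -
            have "refl_mat (axis j 1) *v - axis j 1 = (axis j 1 :: real^'n)"
              by (simp add: refl_mat_works inner_axis_axis) (simp add: vec_eq_iff)
            moreover have "refl_mat (axis i 1) *v axis j 1 = (axis j 1 :: real^'n)"
              using i(1) by (simp add: refl_mat_works inner_axis_axis)
            ultimately show ?thesis by (simp only: neg[OF j])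
          qed
        qed (rule j)
      next
        case False
        \<comment> \<open>A single negated basis vector would leave a diagonal matrix of determinant
          -1, against the assumption.\<close>
        have M: "M $ p $ q = (if p = q then if q = j then - 1 else 1 else 0)" for p q
        proof -
          have "M $ p $ q = (M *v axis q 1) $ p" by (simp add: matrix_vector_mult_basis column_def)
          also have "\<dots> = (if p = q then if q = j then - 1 else 1 else 0)"
            using False neg[OF j] by (cases "q = j") (auto simp: axis_def)
          finally show ?thesis .
        qed
        then have "det M = (\<Prod>p\<in>UNIV. M $ p $ p)" by (intro det_diagonal) simp
        also have "\<dots> = - 1" by (simp add: M prod.delta)
        finally show ?thesis using less.prems by simp
      qed
    qed
  qed
qed

text \<open>The unipotent part of the parabolic subgroup: the change of a tractor under a conformal
  rescaling with logarithmic derivative \<open>Y\<close>, written in an orthonormal frame and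
  without the powers of the scale.\<close>

definition trans_mat :: "real^'n \<Rightarrow> real^('n::finite) tidx^'n tidx" where
  "trans_mat Y = matrix (\<lambda>v. tvec (v $ Top) (mid v + v $ Top *\<^sub>R Y) (v $ Bot - Y \<bullet> mid v - (1/2) * (Y \<bullet> Y) * v $ Top))"

lemma trans_mat_works:
  "trans_mat Y *v v = tvec (v $ Top) (mid v + v $ Top *\<^sub>R Y) (v $ Bot - Y \<bullet> mid v - (1/2) * (Y \<bullet> Y) * v $ Top)"
  unfolding trans_mat_def
  by (rule matrix_linear_works) (auto intro!: linearI tvec_eqI simp: algebra_simps inner_add_right)

lemma trans_mat_Ggrp: "trans_mat Y \<in> Ggrp"
proof -
  have 1: "trans_mat (t *\<^sub>R Y) \<in> O_h" for t
    by (rule O_hI) (auto simp: trans_mat_works hform_def inner_add_right inner_add_left algebra_simps inner_commute)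
  have "continuous_on {0..1} (\<lambda>t. trans_mat (t *\<^sub>R Y) $ i $ j)" for i j
  proof -
    have *: "trans_mat (t *\<^sub>R Y) $ i $ j = (trans_mat (t *\<^sub>R Y) *v axis j 1) $ i" for t
      by (simp add: matrix_vector_mult_basis column_def)
    show ?thesis unfolding * trans_mat_works
      by (cases i) (auto intro!: continuous_intros)
  qed
  then have "continuous_on {0..1} (\<lambda>t. \<chi> i. \<chi> j. trans_mat (t *\<^sub>R Y) $ i $ j)"
    by (intro continuous_on_vec_lambda)
  then have "continuous_on {0..1} (\<lambda>t. trans_mat (t *\<^sub>R Y))"
    by (simp only: vec_lambda_eta)
  then have "trans_mat (1 *\<^sub>R Y) \<in> Ggrp"
    by (rule Ggrp_path) (auto simp: 1 trans_mat_works matrix_eq)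
  then show ?thesis by simp
qed

text \<open>For positive \<open>r\<close> these form the one-parameter group generated by
  \<open>grading\<close>, with \<open>r\<close> the exponential of minus the parameter.\<close>

definition scale_mat :: "real \<Rightarrow> real^('n::finite) tidx^'n tidx" where
  "scale_mat r = matrix (\<lambda>v. tvec (r * v $ Top) (mid v) (v $ Bot / r))"

lemma scale_mat_works: "scale_mat r *v v = tvec (r * v $ Top) (mid v) (v $ Bot / r)"
  unfolding scale_mat_def
  by (rule matrix_linear_works) (auto intro!: linearI tvec_eqI simp: algebra_simps add_divide_distrib)

lemma scale_mat_Ggrp:
  assumes "r > 0"
  shows "scale_mat r \<in> Ggrp"
proof -
  define s where "s t = (1 - t) + t * r" for t
  have s: "s t > 0" if "t \<in> {0..1}" for t
  proof (cases "t = 1")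
    case False
    then have "1 - t > 0" "t * r \<ge> 0" using that assms by auto
    then show ?thesis by (simp add: s_def)
  qed (simp add: s_def assms)
  have 1: "scale_mat (s t) \<in> O_h" if "t \<in> {0..1}" for t
    using s[OF that] by (intro O_hI) (auto simp: scale_mat_works hform_def)
  have "continuous_on {0..1} (\<lambda>t. scale_mat (s t) $ i $ j)" for i j
  proof -
    have *: "scale_mat (s t) $ i $ j = (scale_mat (s t) *v axis j 1) $ i" for t
      by (simp add: matrix_vector_mult_basis column_def)
    have "continuous_on {0..1} s" unfolding s_def by (intro continuous_intros)
    moreover have "s t \<noteq> 0" if "t \<in> {0..1}" for t using s[OF that] by simp
    ultimately show ?thesis unfolding * scale_mat_works
      by (cases i) (auto intro!: continuous_intros)
  qed
  then have "continuous_on {0..1} (\<lambda>t. \<chi> i. \<chi> j. scale_mat (s t) $ i $ j)"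
    by (intro continuous_on_vec_lambda)
  then have "continuous_on {0..1} (\<lambda>t. scale_mat (s t))"
    by (simp only: vec_lambda_eta)
  then have "scale_mat (s 1) \<in> Ggrp"
  proof (rule Ggrp_path)
    show "scale_mat (s t) \<in> O_h" if "t \<in> {0..1}" for t by (rule 1[OF that])
  qed (auto simp: scale_mat_works matrix_eq s_def)
  then show ?thesis by (simp add: s_def)
qed

text \<open>The Levi decomposition by hand. A dilation makes \<open>p\<close> fix the vector
  \<open>axis Bot 1\<close> itself, a translation makes it fix \<open>axis Top 1\<close> as well,
  and what remains preserves the orthogonal complement of these two vectors, hence is a rotation of
  the middle slot. Each of the three factors lies in the identity component.\<close>

lemma ray_stabiliser_Ggrp:
  fixes p :: "real^('n::finite) tidx^'n tidx"
  assumes p: "p \<in> O_h" "det p > 0" and r: "r > 0" "p *v axis Bot 1 = r *\<^sub>R axis Bot 1"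
  shows "p \<in> Ggrp"
proof -
  define w where "w = scale_mat r *v (p *v axis Top 1)"
  have w_Oh: "scale_mat r ** p \<in> O_h" using p(1) by (intro O_h_mult Ggrp_O_h[OF scale_mat_Ggrp[OF r(1)]])
  then have SH: "hform (scale_mat r *v (p *v x)) (scale_mat r *v (p *v y)) = hform x y" for x y
    by (simp add: O_h_def flip: matrix_vector_mul_assoc)
  have fixB: "scale_mat r *v (p *v axis Bot 1) = axis Bot 1"
    using r by (simp add: scale_mat_works axis_tidx)
  have "hform w (axis Bot 1) = hform (axis Top 1) (axis Bot 1 :: real^'n tidx)"
    using SH[of "axis Top 1" "axis Bot 1"] unfolding fixB w_def .
  then have w1: "w $ Top = 1" by (simp add: hform_def axis_tidx)
  have "hform w w = hform (axis Top 1) (axis Top 1 :: real^'n tidx)"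
    using SH[of "axis Top 1" "axis Top 1"] unfolding w_def .
  then have w2: "w $ Bot = - (mid w \<bullet> mid w) / 2" using w1 by (simp add: hform_def axis_tidx)
  \<comment> \<open>The image \<open>w\<close> of \<open>axis Top 1\<close> is null with first
    component 1, which determines its last component; hence translation by \<open>- mid w\<close>
    takes it back to \<open>axis Top 1\<close>.\<close>
  define q where "q = trans_mat (- mid w) ** (scale_mat r ** p)"
  have q_Oh: "q \<in> O_h" unfolding q_def by (intro O_h_mult[OF Ggrp_O_h[OF trans_mat_Ggrp] w_Oh])
  have q_works: "q *v x = trans_mat (- mid w) *v (scale_mat r *v (p *v x))" for x
    by (simp add: q_def flip: matrix_vector_mul_assoc)
  have qT: "q *v axis Top 1 = axis Top 1"
    by (simp only: q_works w_def[symmetric]) (simp add: trans_mat_works w1 w2 axis_tidx)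
  have qB: "q *v axis Bot 1 = axis Bot 1"
    by (simp only: q_works fixB) (simp add: trans_mat_works axis_tidx)
  have q_hform: "hform (q *v x) (q *v y) = hform x y" for x y using q_Oh by (simp add: O_h_def)
  define M where "M = matrix (\<lambda>m. mid (q *v tvec 0 m 0))"
  have tv_add: "tvec 0 (m + m') 0 = tvec 0 m 0 + tvec 0 m' 0" "tvec 0 (k *\<^sub>R m) 0 = k *\<^sub>R tvec 0 m 0" for m m' :: "real^'n" and k
    by (auto intro!: tvec_eqI)
  have M: "M *v m = mid (q *v tvec 0 m 0)" for m
    unfolding M_def by (rule matrix_linear_works)
      (auto intro!: linearI simp: tv_add matrix_vector_right_distrib matrix_vector_mult_scaleR)
  have qM: "q *v tvec 0 m 0 = tvec 0 (M *v m) 0" for m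
  proof (rule tvec_eqI)
    show "(q *v tvec 0 m 0) $ Top = tvec 0 (M *v m) 0 $ Top"
      using q_hform[of "tvec 0 m 0" "axis Bot 1"] unfolding qB by (simp add: hform_def axis_tidx)
    show "(q *v tvec 0 m 0) $ Bot = tvec 0 (M *v m) 0 $ Bot"
      using q_hform[of "tvec 0 m 0" "axis Top 1"] unfolding qT by (simp add: hform_def axis_tidx)
  qed (simp add: M)
  have q_blk: "q = blk M"
  proof (rule matrix_eq[THEN iffD2], rule allI)
    fix x :: "real^'n tidx"
    have "x = x $ Top *\<^sub>R axis Top 1 + tvec 0 (mid x) 0 + x $ Bot *\<^sub>R axis Bot 1"
      by (rule tvec_eqI) (auto simp: axis_tidx)
    then have "q *v x = q *v (x $ Top *\<^sub>R axis Top 1 + tvec 0 (mid x) 0 + x $ Bot *\<^sub>R axis Bot 1)"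
      by simp
    also have "\<dots> = blk M *v x"
      unfolding matrix_vector_right_distrib matrix_vector_mult_scaleR qT qB qM
      by (rule tvec_eqI) (auto simp: blk_works axis_tidx)
    finally show "q *v x = blk M *v x" .
  qed
  have "(M *v x) \<bullet> (M *v y) = x \<bullet> y" for x y
    using q_hform[of "tvec 0 x 0" "tvec 0 y 0"] by (simp add: qM hform_def)
  then have "orthogonal_transformation ((*v) M)"
    by (simp add: orthogonal_transformation_def)
  then have "orthogonal_matrix M" by (simp add: orthogonal_transformation_matrix)
  moreover have "det M > 0"
  proof -
    have "det M = det q" by (simp add: q_blk det_blk)
    also have "\<dots> = det p" using r(1) by (simp add: q_def det_mul Ggrp_det trans_mat_Ggrp scale_mat_Ggrp)
    finally show ?thesis using p by simp
  qed
  ultimately have "q \<in> Ggrp" unfolding q_blk by (rule blk_rotation_Ggrp)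
  have "scale_mat (1/r) ** (trans_mat (mid w) ** q) = p"
  proof (rule matrix_eq[THEN iffD2], rule allI)
    fix x :: "real^'n tidx"
    have "trans_mat (mid w) *v (trans_mat (- mid w) *v y) = y" for y
      by (rule tvec_eqI) (auto simp: trans_mat_works inner_add_right inner_diff_right algebra_simps)
    moreover have "scale_mat (1/r) *v (scale_mat r *v y) = y" for y
      using r by (intro tvec_eqI) (auto simp: scale_mat_works)
    ultimately show "(scale_mat (1/r) ** (trans_mat (mid w) ** q)) *v x = p *v x"
      by (simp add: q_works flip: matrix_vector_mul_assoc)
  qed
  moreover have "scale_mat (1/r) ** (trans_mat (mid w) ** q) \<in> Ggrp"
    using r(1) \<open>q \<in> Ggrp\<close> by (intro Ggrp_mult scale_mat_Ggrp trans_mat_Ggrp) auto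
  ultimately show ?thesis by simp
qed


section \<open>Exterior powers\<close>

lemma finite_lists_length: "finite {I :: 'k::finite list. length I = d}"
  using finite_lists_length_eq[of "UNIV :: 'k set" d] by simp

text \<open>Distributivity with multi-indices as lists, by splitting off the first slot. It serves
  to compose actions on arrays, to act on wedge products and to contract them.\<close>

lemma sum_prod_lists:
  fixes f :: "nat \<Rightarrow> 'k::finite \<Rightarrow> real"
  shows "(\<Sum>I | length I = d. \<Prod>i<d. f i (I ! i)) = (\<Prod>i<d. \<Sum>a\<in>UNIV. f i a)"
proof (induction d arbitrary: f)
  case (Suc d)
  have img: "{I :: 'k list. length I = Suc d} = (\<lambda>(a, I). a # I) ` (UNIV \<times> {I. length I = d})"
    by (auto simp: length_Suc_conv)
  have "(\<Sum>I | length I = Suc d. \<Prod>i<Suc d. f i (I ! i)) =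
      (\<Sum>(a, I)\<in>UNIV \<times> {I. length I = d}. f 0 a * (\<Prod>i<d. f (Suc i) (I ! i)))"
    unfolding img by (subst sum.reindex) (auto simp: inj_on_def prod.lessThan_Suc_shift intro!: sum.cong simp del: prod.lessThan_Suc)
  also have "\<dots> = (\<Sum>a\<in>UNIV. f 0 a) * (\<Sum>I | length I = d. \<Prod>i<d. f (Suc i) (I ! i))"
    by (simp add: sum_product sum.cartesian_product)
  also have "\<dots> = (\<Prod>i<Suc d. \<Sum>a\<in>UNIV. f i a)"
    by (subst Suc.IH) (simp add: prod.lessThan_Suc_shift del: prod.lessThan_Suc)
  finally show ?case .
qed simp

lemma ext_act_one: "ext_act (mat 1) w = w"
proof
  fix I :: "'a tidx list"
  have "(\<Prod>i<length I. mat 1 $ (I ! i) $ (J ! i)) * w J = (if J = I then w J else 0)"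
    if "length J = length I" for J
  proof (cases "J = I")
    case False
    then obtain i where "i < length I" "J ! i \<noteq> I ! i" using \<open>length J = length I\<close> by (auto simp: list_eq_iff_nth_eq)
    then have "(\<Prod>i<length I. mat 1 $ (I ! i) $ (J ! i) :: real) = 0" by (intro prod_zero bexI[of _ i]) (auto simp: mat_def)
    then show ?thesis using False by simp
  qed (simp add: mat_def)
  then have "ext_act (mat 1) w I = (\<Sum>J | length J = length I. if J = I then w J else 0)"
    unfolding ext_act_def by (intro sum.cong) auto
  also have "\<dots> = w I" using finite_lists_length by (subst sum.delta) auto
  finally show "ext_act (mat 1) w I = w I" .
qed

lemma ext_act_mult: "ext_act A (ext_act B w) = ext_act (A ** B) w"
proof
  fix I :: "'a tidx list"
  define d where "d = length I"
  have "ext_act A (ext_act B w) I =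
      (\<Sum>J | length J = d. \<Sum>K | length K = d. (\<Prod>i<d. A $ (I ! i) $ (J ! i) * B $ (J ! i) $ (K ! i)) * w K)"
    unfolding ext_act_def d_def by (intro sum.cong) (auto simp: sum_distrib_left prod.distrib mult_ac)
  also have "\<dots> = (\<Sum>K | length K = d. (\<Sum>J | length J = d. \<Prod>i<d. A $ (I ! i) $ (J ! i) * B $ (J ! i) $ (K ! i)) * w K)"
    by (subst sum.swap) (simp add: sum_distrib_right)
  also have "\<dots> = ext_act (A ** B) w I"
    unfolding ext_act_def d_def[symmetric] 
    by (intro sum.cong refl) (simp add: sum_prod_lists[where f = "\<lambda>i a. A $ (I ! i) $ a * B $ a $ (_ ! i)"] matrix_matrix_mult_def)
  finally show "ext_act A (ext_act B w) I = ext_act (A ** B) w I" .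
qed

lemma ext_act_scale: "ext_act B (\<lambda>I. r * w I) = (\<lambda>I. r * ext_act B w I)"
  unfolding ext_act_def by (auto simp: sum_distrib_left mult_ac)

lemma ext_act_transpose:
  "(\<Sum>I | length I = d. ext_act B w I * v I) = (\<Sum>I | length I = d. w I * ext_act (transpose B) v I)"
proof -
  have "(\<Sum>I | length I = d. ext_act B w I * v I) =
      (\<Sum>I | length I = d. \<Sum>J | length J = d. (\<Prod>i<d. B $ (I ! i) $ (J ! i)) * w J * v I)"
    unfolding ext_act_def by (auto simp: sum_distrib_right intro!: sum.cong)
  also have "\<dots> = (\<Sum>J | length J = d. \<Sum>I | length I = d. (\<Prod>i<d. B $ (I ! i) $ (J ! i)) * w J * v I)"
    by (rule sum.swap)
  also have "\<dots> = (\<Sum>I | length I = d. w I * ext_act (transpose B) v I)"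
    unfolding ext_act_def by (auto simp: sum_distrib_left transpose_def mult_ac intro!: sum.cong)
  finally show ?thesis .
qed

lemma list_swap_nth:
  assumes "i < length I" "j < length I" "l < length I"
  shows "I[i := I ! j, j := I ! i] ! l = I ! (Transposition.transpose i j l)"
  using assms by (auto simp: nth_list_update Transposition.transpose_def)

lemma ext_power_swap:
  "w \<in> ext_power d \<Longrightarrow> length I = d \<Longrightarrow> i < d \<Longrightarrow> j < d \<Longrightarrow> i \<noteq> j \<Longrightarrow> w (I[i := I ! j, j := I ! i]) = - w I"
  by (simp add: ext_power_def)

lemma ext_power_support: "w \<in> ext_power d \<Longrightarrow> length I \<noteq> d \<Longrightarrow> w I = 0"
  by (simp add: ext_power_def)

text \<open>Interchanging two entries of the index and the same two entries of the summation index
  only permutes the factors of the product, so that just the sign of \<open>w\<close>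
  remains.\<close>

lemma ext_act_ext_power:
  fixes w :: "'n::finite tidx list \<Rightarrow> real"
  assumes w: "w \<in> ext_power d"
  shows "ext_act B w \<in> ext_power d"
  unfolding ext_power_def
proof (intro CollectI conjI allI impI)
  fix I :: "'n tidx list"
  assume "length I \<noteq> d"
  then show "ext_act B w I = 0"
    unfolding ext_act_def by (intro sum.neutral) (auto simp: ext_power_support[OF w])
next
  fix I :: "'n tidx list" and i j
  assume *: "length I = d \<and> i < d \<and> j < d \<and> i \<noteq> j"
  define \<tau> where "\<tau> K = K[i := K ! j, j := K ! i]" for K :: "'n tidx list"
  have \<tau>\<tau>: "\<tau> (\<tau> K) = K" if "length K = d" for K
    using that * by (auto simp: \<tau>_def list_eq_iff_nth_eq nth_list_update)
  have \<tau>nth: "\<tau> K ! l = K ! (Transposition.transpose i j l)" if "length K = d" "l < d" for K l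
    using that * by (auto simp: \<tau>_def list_swap_nth)
  have \<tau>len: "length (\<tau> K) = length K" for K by (simp add: \<tau>_def)
  have pr: "(\<Prod>l<d. B $ (\<tau> I ! l) $ (\<tau> K ! l)) = (\<Prod>l<d. B $ (I ! l) $ (K ! l))" if "length K = d" for K
  proof -
    have "(\<Prod>l<d. B $ (\<tau> I ! l) $ (\<tau> K ! l)) =
        (\<Prod>l<d. ((\<lambda>l. B $ (I ! l) $ (K ! l)) \<circ> Transposition.transpose i j) l)"
      using that * by (auto intro!: prod.cong simp: \<tau>nth)
    also have "\<dots> = (\<Prod>l<d. B $ (I ! l) $ (K ! l))"
      by (rule prod.permute[symmetric]) (use * in \<open>auto intro: permutes_swap_id\<close>)
    finally show ?thesis .
  qed
  have "ext_act B w (\<tau> I) = (\<Sum>J | length J = d. (\<Prod>l<d. B $ (\<tau> I ! l) $ (J ! l)) * w J)"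
    unfolding ext_act_def using * by (simp add: \<tau>len)
  also have "\<dots> = (\<Sum>K | length K = d. (\<Prod>l<d. B $ (\<tau> I ! l) $ (\<tau> K ! l)) * w (\<tau> K))"
    by (rule sum.reindex_bij_witness[of _ \<tau> \<tau>]) (auto simp: \<tau>len \<tau>\<tau>)
  also have "\<dots> = (\<Sum>K | length K = d. (\<Prod>l<d. B $ (I ! l) $ (K ! l)) * - w K)"
  proof (intro sum.cong refl)
    fix K :: "'n tidx list"
    assume "K \<in> {K. length K = d}"
    then have "length K = d" by simp
    moreover from this have "w (\<tau> K) = - w K"
      using * ext_power_swap[OF w] by (simp add: \<tau>_def)
    ultimately show "(\<Prod>l<d. B $ (\<tau> I ! l) $ (\<tau> K ! l)) * w (\<tau> K) = (\<Prod>l<d. B $ (I ! l) $ (K ! l)) * - w K"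
      by (simp add: pr)
  qed
  also have "\<dots> = - ext_act B w I"
    unfolding ext_act_def using * by (simp add: sum_negf)
  finally show "ext_act B w (I[i := I ! j, j := I ! i]) = - ext_act B w I" by (simp add: \<tau>_def)
qed

lemma ext_act_wedge: "ext_act B (wedge vs) = wedge (map (\<lambda>v. B *v v) vs)"
proof
  fix I
  show "ext_act B (wedge vs) I = wedge (map (\<lambda>v. B *v v) vs) I"
  proof (cases "length I = length vs")
    case True
    define d where "d = length vs"
    have "ext_act B (wedge vs) I = (\<Sum>J | length J = d. \<Sum>p | p permutes {..<d}. of_int (sign p) *
        (\<Prod>i<d. B $ (I ! i) $ (J ! i) * (vs ! p i) $ (J ! i)))"
      unfolding ext_act_def wedge_def d_def using True
      by (intro sum.cong) (auto simp: sum_distrib_left prod.distrib mult_ac)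
    also have "\<dots> = (\<Sum>p | p permutes {..<d}. of_int (sign p) *
        (\<Sum>J | length J = d. (\<Prod>i<d. B $ (I ! i) $ (J ! i) * (vs ! p i) $ (J ! i))))"
      by (subst sum.swap) (simp add: sum_distrib_left)
    also have "\<dots> = (\<Sum>p | p permutes {..<d}. of_int (sign p) * (\<Prod>i<d. (map (\<lambda>v. B *v v) vs ! p i) $ (I ! i)))"
    proof (intro sum.cong refl arg_cong2[where f = "(*)"])
      fix p assume "p \<in> {p. p permutes {..<d}}"
      then have "p i < length vs" if "i < d" for i
        using that permutes_in_image[of p "{..<d}" i] by (auto simp: d_def)
      then show "(\<Sum>J | length J = d. (\<Prod>i<d. B $ (I ! i) $ (J ! i) * (vs ! p i) $ (J ! i))) =
          (\<Prod>i<d. (map (\<lambda>v. B *v v) vs ! p i) $ (I ! i))"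
        unfolding sum_prod_lists[where f = "\<lambda>i a. B $ (I ! i) $ a * (vs ! p i) $ a"]
        by (intro prod.cong) (auto simp: matrix_vector_mult_def)
    qed
    also have "\<dots> = wedge (map (\<lambda>v. B *v v) vs) I"
      using True by (simp add: wedge_def d_def)
    finally show ?thesis .
  next
    case False
    then show ?thesis by (auto simp: ext_act_def wedge_def intro!: sum.neutral)
  qed
qed

text \<open>The pairing with the tensor product of the \<beta> i, regarded as covectors through the
  Euclidean product; on a wedge product it is a determinant.\<close>

definition contract :: "nat \<Rightarrow> (nat \<Rightarrow> real^('n::finite) tidx) \<Rightarrow> ('n tidx list \<Rightarrow> real) \<Rightarrow> real" where
  "contract d \<beta> w = (\<Sum>I | length I = d. (\<Prod>i<d. \<beta> i $ (I ! i)) * w I)"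

lemma contract_wedge:
  assumes "length vs = d"
  shows "contract d \<beta> (wedge vs) = (\<Sum>p | p permutes {..<d}. of_int (sign p) * (\<Prod>i<d. \<beta> i \<bullet> (vs ! p i)))"
proof -
  have "contract d \<beta> (wedge vs) = (\<Sum>J | length J = d. \<Sum>p | p permutes {..<d}. of_int (sign p) *
        (\<Prod>i<d. \<beta> i $ (J ! i) * (vs ! p i) $ (J ! i)))"
    unfolding contract_def wedge_def using assms
    by (intro sum.cong) (auto simp: sum_distrib_left prod.distrib mult_ac)
  also have "\<dots> = (\<Sum>p | p permutes {..<d}. of_int (sign p) *
        (\<Sum>J | length J = d. (\<Prod>i<d. \<beta> i $ (J ! i) * (vs ! p i) $ (J ! i))))"
    by (subst sum.swap) (simp add: sum_distrib_left)
  also have "\<dots> = (\<Sum>p | p permutes {..<d}. of_int (sign p) * (\<Prod>i<d. \<beta> i \<bullet> (vs ! p i)))"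
    unfolding sum_prod_lists[where f = "\<lambda>i a. \<beta> i $ a * (vs ! _ i) $ a"] by (simp add: inner_vec_def)
  finally show ?thesis .
qed

text \<open>Contracting with the functionals dual to \<open>ws\<close>, one of them replaced by \<open>\<alpha>\<close>, leaves only the identity
  permutation.\<close>

lemma wedge_annihilator:
  fixes vs ws :: "(real^('n::finite) tidx) list"
  assumes len: "length vs = d" "length ws = d"
    and eq: "(\<lambda>I. r * wedge vs I) = (\<lambda>I. s * wedge ws I)" and s: "s \<noteq> 0"
    and dual: "\<And>i j. i < d \<Longrightarrow> j < d \<Longrightarrow> \<beta> i \<bullet> (ws ! j) = (if i = j then 1 else 0)"
    and ann: "\<And>j. j < d \<Longrightarrow> \<alpha> \<bullet> (vs ! j) = 0" and j: "j < d"
  shows "\<alpha> \<bullet> (ws ! j) = 0"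
proof -
  define \<gamma> where "\<gamma> = \<beta>(j := \<alpha>)"
  have scale: "contract d \<gamma> (\<lambda>I. c * w I) = c * contract d \<gamma> w" for c w
    unfolding contract_def by (simp add: sum_distrib_left mult_ac)
  have "contract d \<gamma> (wedge vs) = 0"
    unfolding contract_wedge[OF len(1)]
  proof (intro sum.neutral ballI)
    fix p assume "p \<in> {p. p permutes {..<d}}"
    then have "p j < d" using j permutes_in_image[of p "{..<d}" j] by simp
    then have "\<gamma> j \<bullet> (vs ! p j) = 0" by (simp add: \<gamma>_def ann)
    then have "(\<Prod>i<d. \<gamma> i \<bullet> (vs ! p i)) = 0" using j by (intro prod_zero) auto
    then show "of_int (sign p) * (\<Prod>i<d. \<gamma> i \<bullet> (vs ! p i)) = 0" by simp
  qed
  then have "contract d \<gamma> (wedge ws) = 0"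
    using scale[of r "wedge vs"] scale[of s "wedge ws"] s unfolding eq by simp
  moreover have "contract d \<gamma> (wedge ws) = \<alpha> \<bullet> (ws ! j)"
  proof -
    have z: "(\<Prod>i<d. \<gamma> i \<bullet> (ws ! p i)) = 0" if p: "p permutes {..<d}" "p \<noteq> id" for p
    proof -
      \<comment> \<open>A permutation cannot move one point alone, so one other than the identity
        moves some slot besides \<open>j\<close>, and there duality gives a zero factor.\<close>
      have "\<exists>i<d. i \<noteq> j \<and> p i \<noteq> i"
      proof (rule ccontr)
        assume "\<not> ?thesis"
        then have fx: "p i = i" if "i \<noteq> j" for i
          using that p(1) by (metis lessThan_iff permutes_not_in)
        moreover have "p j = j"
        proof (rule ccontr)
          assume "p j \<noteq> j"
          then have "p (p j) = p j" using fx by blast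
          then show False using \<open>p j \<noteq> j\<close> p(1) by (metis permutes_inj injD)
        qed
        ultimately have "p = id" by (metis eq_id_iff)
        then show False using p(2) by simp
      qed
      then obtain i where i: "i < d" "i \<noteq> j" "p i \<noteq> i" by blast
      moreover have "p i < d" using i p(1) permutes_in_image[of p "{..<d}" i] by simp
      ultimately have "\<gamma> i \<bullet> (ws ! p i) = 0" by (simp add: \<gamma>_def dual)
      then show ?thesis using i by (intro prod_zero) auto
    qed
    have "contract d \<gamma> (wedge ws) = (\<Sum>p | p permutes {..<d}. if p = id then \<Prod>i<d. \<gamma> i \<bullet> (ws ! i) else 0)"
      unfolding contract_wedge[OF len(2)] by (intro sum.cong refl) (auto simp: z sign_id)
    also have "\<dots> = (\<Prod>i<d. \<gamma> i \<bullet> (ws ! i))"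
      by (subst sum.delta) (auto simp: finite_permutations permutes_id)
    also have "\<dots> = (\<Prod>i<d. if i = j then \<alpha> \<bullet> (ws ! j) else 1)"
      by (intro prod.cong) (auto simp: \<gamma>_def dual)
    also have "\<dots> = \<alpha> \<bullet> (ws ! j)" using j by (subst prod.delta) auto
    finally show ?thesis .
  qed
  ultimately show ?thesis by simp
qed

section \<open>Contraction of arrays with the Lorentzian form\<close>

lemma hform_axis: "hform (axis a 1) (axis b 1) = Hmat $ a $ b"
proof -
  have "hform (axis a 1) (axis b 1) = axis a 1 \<bullet> column b Hmat"
    by (simp add: hform_Hmat matrix_vector_mult_basis)
  then show ?thesis by (simp add: inner_axis' column_def)
qed

lemma full_contraction_ext_act:
  "full_contraction d w w' = (\<Sum>I | length I = d. w I * ext_act Hmat w' I)"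
  unfolding full_contraction_def ext_act_def hform_axis
  by (intro sum.cong refl) (auto simp: sum_distrib_left mult_ac)

text \<open>Moving one action across the sum leaves the action of the transpose of \<open>B\<close>
  times \<open>Hmat\<close> times \<open>B\<close>, which is \<open>Hmat\<close> again.\<close>

lemma full_contraction_invariant:
  assumes "B \<in> O_h"
  shows "full_contraction d (ext_act B w) (ext_act B w') = full_contraction d w w'"
  unfolding full_contraction_ext_act ext_act_mult
  by (subst ext_act_transpose) (use assms in \<open>simp add: ext_act_mult O_h_transpose matrix_mul_assoc\<close>)

lemma full_contraction_sym: "full_contraction d w w' = full_contraction d w' w"
  unfolding full_contraction_def
  by (subst sum.swap) (auto intro!: sum.cong simp: hform_sym mult_ac)

lemma full_contraction_scale: "full_contraction d (\<lambda>I. r * w I) (\<lambda>I. s * w' I) = r * s * full_contraction d w w'"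
  unfolding full_contraction_def by (simp add: sum_distrib_left mult_ac)

lemma full_contraction_add_right:
  "full_contraction d w (\<lambda>I. u I + v I) = full_contraction d w u + full_contraction d w v"
  unfolding full_contraction_def by (simp add: algebra_simps sum.distrib)

text \<open>In the term of \<open>p\<close>, vector number \<open>k\<close> occupies the slot
  \<open>inv p k\<close>. Separating that factor exhibits linearity in this vector and prepares the
  product rule.\<close>

lemma wedge_update:
  assumes len: "length vs = d" "length I = d" and k: "k < d"
  shows "wedge (vs[k := x]) I = (\<Sum>p | p permutes {..<d}. of_int (sign p) *
    (x $ (I ! inv p k) * (\<Prod>i\<in>{..<d} - {inv p k}. (vs ! p i) $ (I ! i))))"
proof -
  have "(\<Prod>i<d. (vs[k := x] ! p i) $ (I ! i)) = x $ (I ! inv p k) * (\<Prod>i\<in>{..<d} - {inv p k}. (vs ! p i) $ (I ! i))"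
    if p: "p permutes {..<d}" for p
  proof -
    have ik: "inv p k < d" "p (inv p k) = k"
      using permutes_in_image[OF permutes_inv[OF p], of k] k permutes_inverses[OF p] by auto
    have "(\<Prod>i<d. (vs[k := x] ! p i) $ (I ! i)) = (vs[k := x] ! p (inv p k)) $ (I ! inv p k) *
        (\<Prod>i\<in>{..<d} - {inv p k}. (vs[k := x] ! p i) $ (I ! i))"
      by (rule prod.remove) (use ik in auto)
    also have "(\<Prod>i\<in>{..<d} - {inv p k}. (vs[k := x] ! p i) $ (I ! i)) = (\<Prod>i\<in>{..<d} - {inv p k}. (vs ! p i) $ (I ! i))"
    proof (intro prod.cong refl)
      fix i assume "i \<in> {..<d} - {inv p k}"
      then have "p i \<noteq> k" using permutes_inverses[OF p] by auto
      then show "(vs[k := x] ! p i) $ (I ! i) = (vs ! p i) $ (I ! i)" by simp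
    qed
    finally show ?thesis using ik k len by simp
  qed
  then show ?thesis using len by (simp add: wedge_def)
qed

lemma wedge_update_linear:
  assumes len: "length vs = d" and k: "k < d"
  shows "linear (\<lambda>x. wedge (vs[k := x]) I)"
proof (cases "length I = d")
  case True
  show ?thesis unfolding wedge_update[OF len True k]
    by (rule linearI) (auto simp: algebra_simps sum.distrib sum_distrib_left)
next
  case False
  then have "wedge (vs[k := x]) I = 0" for x using len by (simp add: wedge_def)
  then show ?thesis by (simp add: linearI)
qed

text \<open>Exchanging the two equal vectors maps the sum over permutations to its negative.\<close>

lemma wedge_repeated:
  assumes "k < length vs" "l < length vs" "k \<noteq> l" "vs ! k = vs ! l"
  shows "wedge vs I = 0"
proof (cases "length I = length vs")
  case True
  define d where "d = length vs"
  define \<tau> where "\<tau> = Transposition.transpose k l"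
  have \<tau>: "\<tau> permutes {..<d}" unfolding \<tau>_def using assms by (intro permutes_swap_id) (auto simp: d_def)
  have \<tau>\<tau>: "\<tau> \<circ> (\<tau> \<circ> p) = p" for p :: "nat \<Rightarrow> nat" by (simp add: \<tau>_def fun_eq_iff)
  have vs: "vs ! \<tau> i = vs ! i" for i
    using assms by (auto simp: \<tau>_def Transposition.transpose_def)
  have "wedge vs I = (\<Sum>p | p permutes {..<d}. of_int (sign p) * (\<Prod>i<d. (vs ! p i) $ (I ! i)))"
    using True by (simp add: wedge_def d_def)
  also have "\<dots> = (\<Sum>p | p permutes {..<d}. of_int (sign (\<tau> \<circ> p)) * (\<Prod>i<d. (vs ! (\<tau> \<circ> p) i) $ (I ! i)))"
    by (rule sum.reindex_bij_witness[of _ "\<lambda>p. \<tau> \<circ> p" "\<lambda>p. \<tau> \<circ> p"])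
      (auto simp: \<tau>\<tau> intro: permutes_compose[OF _ \<tau>])
  also have "\<dots> = - (\<Sum>p | p permutes {..<d}. of_int (sign p) * (\<Prod>i<d. (vs ! p i) $ (I ! i)))"
  proof -
    have "sign (\<tau> \<circ> p) = - sign p" if "p permutes {..<d}" for p
      using that \<tau> assms(3) sign_swap_id[of k l] unfolding \<tau>_def
      by (subst sign_compose) (auto simp: permutation_permutes intro: permutation_swap_id)
    then show ?thesis unfolding sum_negf[symmetric] by (intro sum.cong) (auto simp: vs)
  qed
  also have "\<dots> = - wedge vs I" using True by (simp add: wedge_def d_def)
  finally show ?thesis by simp
qed (simp add: wedge_def)

lemma wedge_has_derivative:
  fixes vs :: "real \<Rightarrow> (real^('n::finite) tidx) list"
  assumes len: "\<And>t. length (vs t) = d" and der: "\<And>k. k < d \<Longrightarrow> ((\<lambda>t. vs t ! k) has_vector_derivative v' k) (at t0)"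
  shows "((\<lambda>t. wedge (vs t) I) has_real_derivative (\<Sum>k<d. wedge ((vs t0)[k := v' k]) I)) (at t0)"
proof (cases "length I = d")
  case True
  have 1: "((\<lambda>t. (vs t ! k) $ a) has_real_derivative v' k $ a) (at t0)" if "k < d" for k a
    using der[OF that] unfolding has_real_derivative_iff_has_vector_derivative
    by (rule bounded_linear.has_vector_derivative[OF bounded_linear_vec_nth])
  have 2: "((\<lambda>t. \<Prod>i<d. (vs t ! p i) $ (I ! i)) has_real_derivative
      (\<Sum>k<d. v' k $ (I ! inv p k) * (\<Prod>i\<in>{..<d} - {inv p k}. (vs t0 ! p i) $ (I ! i)))) (at t0)"
    if p: "p permutes {..<d}" for p
  proof -
    have pd: "p i < d" if "i < d" for i using that p permutes_in_image[of p "{..<d}" i] by auto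
    have "((\<lambda>t. \<Prod>i<d. (vs t ! p i) $ (I ! i)) has_derivative
        (\<lambda>y. \<Sum>i<d. (v' (p i) $ (I ! i) * y) * (\<Prod>j\<in>{..<d} - {i}. (vs t0 ! p j) $ (I ! j)))) (at t0)"
      by (rule has_derivative_prod) (use 1 pd in \<open>auto simp: has_field_derivative_def\<close>)
    \<comment> \<open>The product rule runs over slots, the claim over vectors; \<open>p\<close>
      translates between the two.\<close>
    moreover have "(\<Sum>i<d. (v' (p i) $ (I ! i) * y) * (\<Prod>j\<in>{..<d} - {i}. (vs t0 ! p j) $ (I ! j))) =
        (\<Sum>k<d. v' k $ (I ! inv p k) * (\<Prod>i\<in>{..<d} - {inv p k}. (vs t0 ! p i) $ (I ! i))) * y" for y
      unfolding sum_distrib_right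
      by (rule sum.reindex_bij_witness[of _ "inv p" p])
        (use pd permutes_inverses[OF p] permutes_in_image[OF permutes_inv[OF p], of i for i] in \<open>auto simp: mult_ac\<close>)
    ultimately show ?thesis by (simp add: has_field_derivative_def)
  qed
  have "((\<lambda>t. \<Sum>p | p permutes {..<d}. of_int (sign p) * (\<Prod>i<d. (vs t ! p i) $ (I ! i))) has_real_derivative
      (\<Sum>p | p permutes {..<d}. of_int (sign p) *
        (\<Sum>k<d. v' k $ (I ! inv p k) * (\<Prod>i\<in>{..<d} - {inv p k}. (vs t0 ! p i) $ (I ! i))))) (at t0)"
    by (intro DERIV_sum DERIV_cmult) (use 2 in auto)
  moreover have "(\<Sum>p | p permutes {..<d}. of_int (sign p) *
        (\<Sum>k<d. v' k $ (I ! inv p k) * (\<Prod>i\<in>{..<d} - {inv p k}. (vs t0 ! p i) $ (I ! i)))) =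
      (\<Sum>k<d. wedge ((vs t0)[k := v' k]) I)"
    by (simp add: wedge_update[OF len True] sum_distrib_left sum.swap[of _ "{..<d}"])
  ultimately show ?thesis using True len by (simp add: wedge_def)
next
  case False
  then show ?thesis using len by (simp add: wedge_def)
qed

lemma full_contraction_has_derivative:
  assumes "\<And>I. ((\<lambda>t. w t I) has_real_derivative w' I) (at t0)"
  shows "((\<lambda>t. full_contraction d (w t) (w t)) has_real_derivative 2 * full_contraction d (w t0) w') (at t0)"
proof -
  have "((\<lambda>t. full_contraction d (w t) (w t)) has_real_derivative
      (\<Sum>I | length I = d. \<Sum>J | length J = d. (\<Prod>i<d. hform (axis (I ! i) 1) (axis (J ! i) 1)) * (w' I * w t0 J + w t0 I * w' J))) (at t0)"
    unfolding full_contraction_def mult.assoc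
    by (intro DERIV_sum DERIV_cmult) (auto intro!: derivative_eq_intros assms)
  also have "(\<Sum>I | length I = d. \<Sum>J | length J = d. (\<Prod>i<d. hform (axis (I ! i) 1) (axis (J ! i) 1)) * (w' I * w t0 J + w t0 I * w' J))
     = full_contraction d w' (w t0) + full_contraction d (w t0) w'"
    unfolding full_contraction_def by (simp add: algebra_simps sum.distrib)
  finally show ?thesis by (simp add: full_contraction_sym)
qed

text \<open>If the derivative of the vectors \<open>n\<close> is the infinitesimal action of \<open>- \<omega>\<close> up to their span, then that of
  their normalised wedge product is exactly the infinitesimal action: the trace of the error is killed by
  the normalisation.\<close>

lemma normalised_wedge_derivative:
  fixes n :: "real \<Rightarrow> (real^('n::finite) tidx) list"
  assumes len: "\<And>t. length (n t) = d"
    and der: "\<And>k. k < d \<Longrightarrow> ((\<lambda>t. n t ! k) has_vector_derivative (\<Sum>l<d. a k l *\<^sub>R (n 0 ! l)) - \<omega> *v (n 0 ! k)) (at 0)"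
    and N: "\<forall>\<^sub>F t in nhds 0. N t = (\<lambda>I. r t * wedge (n t) I) \<and> r t > 0 \<and> full_contraction d (N t) (N t) = fact d"
    and C: "\<And>t. C t \<in> O_h" "C 0 = mat 1" "(C has_vector_derivative - \<omega>) (at 0)"
  obtains D where "\<And>I. ((\<lambda>t. N t I) has_real_derivative D I) (at 0)"
    "\<And>I. ((\<lambda>t. ext_act (C t) (N 0) I) has_real_derivative D I) (at 0)"
proof -
  define w where "w t = wedge (n t)" for t
  define E where "E I = (\<Sum>k<d. wedge ((n 0)[k := - (\<omega> *v (n 0 ! k))]) I)" for I
  define tr where "tr = (\<Sum>k<d. a k k)"
  \<comment> \<open>When vector \<open>k\<close> is replaced by a combination of all of them, only
    its own coefficient survives, as every other term repeats a vector. Summing over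
    \<open>k\<close> gives the trace of \<open>a\<close>.\<close>
  have slot: "wedge ((n 0)[k := (\<Sum>l<d. a k l *\<^sub>R (n 0 ! l)) - \<omega> *v (n 0 ! k)]) I =
      a k k * w 0 I + wedge ((n 0)[k := - (\<omega> *v (n 0 ! k))]) I" if k: "k < d" for k I
  proof -
    note lin = wedge_update_linear[OF len k, of 0 I]
    have "wedge ((n 0)[k := n 0 ! l]) I = (if l = k then w 0 I else 0)" if "l < d" for l
    proof (cases "l = k")
      case False
      then show ?thesis using k that len wedge_repeated[of k "(n 0)[k := n 0 ! l]" l I] by simp
    qed (simp add: w_def)
    then have "(\<Sum>l<d. a k l * wedge ((n 0)[k := n 0 ! l]) I) = (\<Sum>l<d. if l = k then a k l * w 0 I else 0)"
      by (intro sum.cong) auto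
    also have "\<dots> = a k k * w 0 I" using k by (simp add: sum.delta)
    finally have *: "wedge ((n 0)[k := (\<Sum>l<d. a k l *\<^sub>R (n 0 ! l))]) I = a k k * w 0 I"
      by (simp add: linear_sum[OF lin] linear_scale[OF lin])
    show ?thesis using linear_add[OF lin, of "\<Sum>l<d. a k l *\<^sub>R (n 0 ! l)" "- (\<omega> *v (n 0 ! k))"] * by simp
  qed
  have dw: "((\<lambda>t. w t I) has_real_derivative tr * w 0 I + E I) (at 0)" for I
    using wedge_has_derivative[of n d, OF len der, of I] slot
    unfolding w_def[symmetric] by (simp add: sum.distrib tr_def E_def sum_distrib_right w_def)
  define q where "q t = full_contraction d (w t) (w t)" for t
  \<comment> \<open>No regularity of \<open>r\<close> is given. The normalisation expresses it near
    0 as the square root of a differentiable function, its positivity selecting the root.\<close>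
  have rq: "\<forall>\<^sub>F t in nhds 0. r t = sqrt (fact d / q t) \<and> q t > 0"
    using N
  proof eventually_elim
    case (elim t)
    then have e: "N t = (\<lambda>I. r t * w t I)" and "full_contraction d (N t) (N t) = fact d" by (auto simp: w_def)
    from this(2) have "full_contraction d (\<lambda>I. r t * w t I) (\<lambda>I. r t * w t I) = fact d" unfolding e .
    then have "(r t)\<^sup>2 * q t = fact d"
      by (simp add: full_contraction_scale q_def power2_eq_square)
    moreover from this have "q t > 0"
      by (metis elim fact_gt_zero zero_less_mult_pos zero_less_power)
    ultimately have "(r t)\<^sup>2 = fact d / q t" by (simp add: field_simps)
    then show ?case using elim \<open>q t > 0\<close> real_sqrt_unique[of "r t"] by simp
  qed
  then have q0: "q 0 > 0" "r 0 = sqrt (fact d / q 0)" by (auto dest: eventually_nhds_x_imp_x)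
  obtain q' where q': "(q has_real_derivative q') (at 0)"
    unfolding q_def using full_contraction_has_derivative[of w, OF dw] by blast
  have "((\<lambda>t. fact d / q t) has_real_derivative (0 * q 0 - fact d * q') / (q 0 * q 0)) (at 0)"
    by (rule DERIV_divide) (use q' q0 in auto)
  then obtain r' where "((\<lambda>t. sqrt (fact d / q t)) has_real_derivative r') (at 0)"
    using DERIV_chain2[OF DERIV_real_sqrt] q0(1) by (metis divide_pos_pos fact_gt_zero)
  then have r': "(r has_real_derivative r') (at 0)"
    using rq by (subst DERIV_cong_ev) (auto elim: eventually_mono)
  have N0: "N 0 = (\<lambda>I. r 0 * w 0 I)" "r 0 > 0" "full_contraction d (N 0) (N 0) = fact d"
    using eventually_nhds_x_imp_x[OF N] by (auto simp: w_def)
  \<comment> \<open>The total coefficient of \<open>N 0\<close> in the derivative: the logarithmic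
    derivative of the factor \<open>r\<close> plus the trace.\<close>
  define lam where "lam = r' / r 0 + tr"
  have dN: "((\<lambda>t. N t I) has_real_derivative r 0 * E I + lam * N 0 I) (at 0)" for I
  proof -
    have "((\<lambda>t. r t * w t I) has_real_derivative r' * w 0 I + (tr * w 0 I + E I) * r 0) (at 0)"
      by (rule DERIV_mult[OF r' dw])
    moreover have "r' * w 0 I + (tr * w 0 I + E I) * r 0 = r 0 * E I + lam * N 0 I"
      using N0(2) unfolding N0(1) by (simp add: lam_def field_simps)
    moreover have "\<forall>\<^sub>F t in nhds 0. N t I = r t * w t I"
      using N by eventually_elim (simp add: w_def)
    ultimately show ?thesis by (subst DERIV_cong_ev) auto
  qed
  have dC: "((\<lambda>t. ext_act (C t) (N 0) I) has_real_derivative r 0 * E I) (at 0)" for I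
  proof -
    have eq: "ext_act (C t) (N 0) I = r 0 * wedge (map (\<lambda>v. C t *v v) (n 0)) I" for t
      by (simp add: N0(1) w_def ext_act_scale ext_act_wedge)
    have mv: "bounded_linear (\<lambda>M :: real^'n tidx^'n tidx. M *v x)" for x
      by (rule linear_conv_bounded_linear[THEN iffD1], rule linearI)
        (auto simp: matrix_vector_mult_add_rdistrib scaleR_matrix_vector_assoc)
    have "((\<lambda>t. wedge (map (\<lambda>v. C t *v v) (n 0)) I) has_real_derivative
        (\<Sum>k<d. wedge ((map (\<lambda>v. C 0 *v v) (n 0))[k := (- \<omega>) *v (n 0 ! k)]) I)) (at 0)"
      by (rule wedge_has_derivative)
        (use len bounded_linear.has_vector_derivative[OF mv C(3)] in auto)
    moreover have "(- \<omega>) *v x = - (\<omega> *v x)" for x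
      by (simp add: matrix_vector_mult_def vec_eq_iff sum_negf)
    ultimately show ?thesis unfolding eq E_def by (intro DERIV_cmult) (simp add: C(2))
  qed
  \<comment> \<open>Both curves have constant norm, so contracting \<open>N 0\<close> with either
    derivative gives 0. The derivatives differ by \<open>lam\<close> times \<open>N 0\<close>, and
    \<open>N 0\<close> has nonzero norm.\<close>
  have "lam = 0"
  proof -
    have "((\<lambda>t. full_contraction d (N t) (N t)) has_real_derivative 0) (at 0)"
      using N by (subst DERIV_cong_ev[where g = "\<lambda>t. fact d"]) (auto elim: eventually_mono)
    with full_contraction_has_derivative[of N, OF dN]
    have 1: "full_contraction d (N 0) (\<lambda>I. r 0 * E I + lam * N 0 I) = 0"
      using DERIV_unique by fastforce
    have "((\<lambda>t. full_contraction d (ext_act (C t) (N 0)) (ext_act (C t) (N 0))) has_real_derivative 0) (at 0)"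
      by (simp add: full_contraction_invariant[OF C(1)])
    with full_contraction_has_derivative[of "\<lambda>t. ext_act (C t) (N 0)", OF dC]
    have 2: "full_contraction d (N 0) (\<lambda>I. r 0 * E I) = 0"
      using DERIV_unique by (fastforce simp: C(2) ext_act_one)
    have "full_contraction d (N 0) (\<lambda>I. lam * N 0 I) = lam * fact d"
      using full_contraction_scale[of d 1 "N 0" lam "N 0"] N0(3) by simp
    then show ?thesis using 1 2 unfolding full_contraction_add_right by simp
  qed
  then show ?thesis using that[of "\<lambda>I. r 0 * E I"] dN dC by simp
qed


section \<open>Differentiating representations\<close>

text \<open>The Cayley transform, which avoids the matrix exponential.\<close>

lemma skew_curve_Ggrp:
  fixes Y :: "real^('n::finite) tidx^'n tidx"
  assumes skew: "\<And>v w. hform (Y *v v) w + hform v (Y *v w) = 0"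
  obtains C where "\<And>t. C t \<in> Ggrp" "C 0 = mat 1" "(C has_vector_derivative Y) (at (0::real))"
proof -
  define a where "a t = mat 1 - (t / 2) *\<^sub>R Y" for t :: real
  define b where "b t = mat 1 + (t / 2) *\<^sub>R Y" for t :: real
  define c where "c t = b t ** matrix_inv (a t)" for t
  have a_works: "a t *v v = v - (t / 2) *\<^sub>R (Y *v v)" and b_works: "b t *v v = v + (t / 2) *\<^sub>R (Y *v v)" for t v
    by (simp_all add: a_def b_def matrix_vector_mult_diff_rdistrib matrix_vector_mult_add_rdistrib scaleR_matrix_vector_assoc)
  have sm: "smooth_on UNIV a" unfolding a_def by (intro smooth_intros smooth_on_divide) auto
  \<comment> \<open>The terms of order 0 and 2 in t agree, and the two sides differ by t times the
    skewness expression. Hence \<open>c t\<close>, the Cayley transform, is an isometry wherever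
    \<open>a t\<close> is invertible.\<close>
  have ab: "hform (b t *v v) (b t *v w) = hform (a t *v v) (a t *v w)" for t v w
    using skew[of v w] by (simp add: a_works b_works hform_simps algebra_simps) (simp add: add_divide_distrib flip: distrib_left)
  define U where "U = {t. det (a t) \<noteq> 0}"
  have "continuous_on UNIV (\<lambda>t. det (a t))"
    by (intro smooth_on_continuous_on smooth_on_det sm) auto
  then have "open U" unfolding U_def by (intro open_Collect_neq) (auto intro: continuous_intros)
  moreover have "0 \<in> U" by (simp add: U_def a_def)
  ultimately obtain e where e: "e > 0" "ball 0 e \<subseteq> U" by (meson openE)
  have cont: "continuous_on U (\<lambda>t. matrix_inv (a t))"
    by (intro smooth_on_continuous_on smooth_on_matrix_inv \<open>open U\<close> smooth_on_subset[OF sm]) (auto simp: U_def)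
  have O: "c t \<in> O_h" if "t \<in> U" for t
  proof (rule O_hI)
    fix v w
    have "a t *v (matrix_inv (a t) *v x) = x" for x
      using that matrix_inv_inverts(1)[of "a t"] by (simp add: U_def matrix_vector_mul_assoc)
    then show "hform (c t *v v) (c t *v w) = hform v w"
      by (simp add: c_def ab flip: matrix_vector_mul_assoc)
  qed
  have "continuous_on (ball 0 e) c" unfolding c_def b_def matrix_matrix_mult_def
    by (intro continuous_intros continuous_on_subset[OF cont e(2)]) auto
  then have "connected (c ` ball 0 e)" by (rule connected_continuous_image) simp
  moreover have c0: "c 0 = mat 1"
    using matrix_inv_inverts(1)[of "mat 1 :: real^'n tidx^'n tidx"] by (simp add: c_def a_def b_def)
  ultimately have G: "c ` ball 0 e \<subseteq> Ggrp"
    using O e by (intro connected_O_h_subset) (auto intro!: image_eqI[of _ _ 0])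
  \<comment> \<open>Away from 0 the inverse need not exist, so the curve is completed by the
    identity. The possible jump is harmless, as only the derivative at 0 is asked for.\<close>
  define C where "C t = (if t \<in> ball 0 e then c t else mat 1)" for t
  have "C t \<in> Ggrp" for t using G by (auto simp: C_def Ggrp_one)
  moreover have "C 0 = mat 1" using e by (simp add: C_def c0)
  moreover have "(C has_vector_derivative Y) (at 0)"
  proof -
    have "((\<lambda>t. Y ** matrix_inv (a t)) \<longlongrightarrow> Y ** matrix_inv (a 0)) (at 0)"
    proof -
      have "continuous_on U (\<lambda>t. Y ** matrix_inv (a t))"
        unfolding matrix_matrix_mult_def by (intro continuous_intros cont)
      then show ?thesis using \<open>open U\<close> \<open>0 \<in> U\<close> by (simp add: continuous_on_eq_continuous_at isCont_def)
    qed
    also have "Y ** matrix_inv (a 0) = Y"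
      using matrix_inv_inverts(1)[of "mat 1 :: real^'n tidx^'n tidx"] by (simp add: a_def)
    finally have lim: "((\<lambda>t. Y ** matrix_inv (a t)) \<longlongrightarrow> Y) (at 0)" .
    have sub: "(P - Q) ** R = P ** R - Q ** R" for P Q R :: "real^'n tidx^'n tidx"
      by (simp add: matrix_matrix_mult_def vec_eq_iff left_diff_distrib sum_subtractf)
    have "\<forall>\<^sub>F t in at 0. Y ** matrix_inv (a t) = (C t - C 0) /\<^sub>R t"
      unfolding eventually_at_topological
    proof (intro exI[of _ "ball 0 e"] conjI ballI impI)
      fix t :: real assume t: "t \<in> ball 0 e" "t \<noteq> 0"
      then have d: "det (a t) \<noteq> 0" using e by (auto simp: U_def)
      \<comment> \<open>The difference quotient is exactly \<open>Y\<close> times the inverse of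
        \<open>a t\<close>, so continuity of the inverse is enough and its derivative is never
        computed.\<close>
      have "C t - C 0 = (b t - a t) ** matrix_inv (a t)"
        using t e by (simp add: C_def c0) (simp add: c_def sub matrix_inv_inverts[OF d])
      also have "b t - a t = t *\<^sub>R Y" by (simp add: a_def b_def flip: scaleR_left.add)
      finally have "C t - C 0 = t *\<^sub>R (Y ** matrix_inv (a t))" by (simp add: scalar_matrix_assoc)
      then show "Y ** matrix_inv (a t) = (C t - C 0) /\<^sub>R t" using t by simp
    qed (use e in auto)
    with lim have "((\<lambda>t. (C t - C 0) /\<^sub>R t) \<longlongrightarrow> Y) (at 0)"
      by (rule Lim_transform_eventually)
    then have "((\<lambda>t. norm ((C t - C 0) /\<^sub>R t - Y)) \<longlongrightarrow> 0) (at 0)"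
      by (intro tendsto_norm_zero) (rule Lim_null[THEN iffD1])
    then have "((\<lambda>t. norm (C t - C 0 - t *\<^sub>R Y) / \<bar>t\<bar>) \<longlongrightarrow> 0) (at 0)"
    proof (rule Lim_transform_eventually)
      have "norm ((C t - C 0) /\<^sub>R t - Y) = norm (C t - C 0 - t *\<^sub>R Y) / \<bar>t\<bar>" if "t \<noteq> 0" for t
      proof -
        have "(C t - C 0) /\<^sub>R t - Y = (1 / t) *\<^sub>R (C t - C 0 - t *\<^sub>R Y)"
          using that by (simp add: scaleR_diff_right divide_inverse)
        then show ?thesis by (simp only: norm_scaleR) simp
      qed
      then show "\<forall>\<^sub>F t in at 0. norm ((C t - C 0) /\<^sub>R t - Y) = norm (C t - C 0 - t *\<^sub>R Y) / \<bar>t\<bar>"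
        by (auto simp: eventually_at_filter)
    qed
    then show ?thesis by (simp add: has_vector_derivative_def has_derivative_at bounded_linear_scaleR_left)
  qed
  ultimately show ?thesis using that by blast
qed

text \<open>\<open>drep\<close> asks for a vector that serves all curves with velocity
  \<open>Y\<close>. The smooth extension of the orbit map provides one by the chain rule, and the
  curve supplied here makes it unique.\<close>

lemma drep_curve:
  assumes rep: "representation \<rho> V" and v: "v \<in> V"
    and C: "\<And>t. C t \<in> Ggrp" "C 0 = mat 1" "(C has_vector_derivative Y) (at (0::real))"
  shows "((\<lambda>t. \<rho> (C t) v) has_vector_derivative drep \<rho> Y v) (at 0)"
proof -
  obtain O' F where F: "open O'" "Ggrp \<subseteq> O'" "smooth_on O' F" "\<forall>B\<in>Ggrp. F B = \<rho> B v"
    using rep v unfolding representation_def by blast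
  have "mat 1 \<in> O'" using F(2) Ggrp_one by blast
  then have dF: "(F has_derivative frechet_derivative F (at (mat 1))) (at (mat 1))"
    using F(3) by (rule smooth_on_has_derivative[rotated])
  have D: "((\<lambda>t. \<rho> (C t) v) has_vector_derivative frechet_derivative F (at (mat 1)) Y) (at 0)"
    if C: "\<And>t. C t \<in> Ggrp" "C 0 = mat 1" "(C has_vector_derivative Y) (at (0::real))" for C
  proof -
    have "((\<lambda>t. F (C t)) has_derivative (\<lambda>h. frechet_derivative F (at (mat 1)) (h *\<^sub>R Y))) (at 0)"
      by (rule has_derivative_compose[of C]) (use C dF in \<open>auto simp: has_vector_derivative_def\<close>)
    then show ?thesis
      using C(1) F(4) has_derivative_linear[OF dF] by (simp add: has_vector_derivative_def linear_scale)
  qed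
  have "drep \<rho> Y v = frechet_derivative F (at (mat 1)) Y"
    unfolding drep_def
  proof (rule the_equality)
    fix w
    assume "\<forall>C. (\<forall>t. C t \<in> Ggrp) \<and> C 0 = mat 1 \<and> (C has_vector_derivative Y) (at 0) \<longrightarrow>
         ((\<lambda>t. \<rho> (C t) v) has_vector_derivative w) (at 0)"
    then have "((\<lambda>t. \<rho> (C t) v) has_vector_derivative w) (at 0)" using C by blast
    then show "w = frechet_derivative F (at (mat 1)) Y"
      using D[OF C] by (rule vector_derivative_unique_at)
  qed (use D in blast)
  then show ?thesis using D[OF C] by simp
qed

text \<open>Running the curve backwards gives velocity \<open>Y\<close>, so the sign comes from the
  chain rule instead of linearity of \<open>drep\<close> in its matrix argument.\<close>

lemma drep_uminus_curve:
  assumes rep: "representation \<rho> V" and v: "v \<in> V"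
    and C: "\<And>t. C t \<in> Ggrp" "C 0 = mat 1" "(C has_vector_derivative - Y) (at (0::real))"
  shows "((\<lambda>t. \<rho> (C t) v) has_vector_derivative - drep \<rho> Y v) (at 0)"
proof -
  have neg: "(uminus has_vector_derivative - 1) (at (0::real))"
    by (auto simp: has_real_derivative_iff_has_vector_derivative[symmetric] intro!: derivative_eq_intros)
  have "((\<lambda>t. C (- t)) has_vector_derivative Y) (at 0)"
    using vector_diff_chain_at[OF neg, of C "- Y"] C(3) by (simp add: o_def)
  then have "((\<lambda>t. \<rho> (C (- t)) v) has_vector_derivative drep \<rho> Y v) (at 0)"
    using C by (intro drep_curve[OF rep v, where C = "\<lambda>t. C (- t)"]) auto
  then show ?thesis
    using vector_diff_chain_at[OF neg, of "\<lambda>t. \<rho> (C (- t)) v" "drep \<rho> Y v"] by (simp add: o_def)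
qed


section \<open>Jets and invariant functionals\<close>

text \<open>Interpolation: functions determined by their values on a finite set are recovered
  linearly from the values on a subset. Points are added one at a time. Either all functions vanish
  at the new point, or one does not and becomes, after correction, the coefficient function of that
  point.\<close>

lemma finite_dim_evaluation_basis:
  fixes W :: "('z \<Rightarrow> real) set"
  assumes "finite X" "(\<lambda>z. 0) \<in> W"
    "\<And>s t. s \<in> W \<Longrightarrow> t \<in> W \<Longrightarrow> (\<lambda>z. s z + t z) \<in> W" "\<And>s r. s \<in> W \<Longrightarrow> (\<lambda>z. r * s z) \<in> W"
    "\<And>s. s \<in> W \<Longrightarrow> (\<And>x. x \<in> X \<Longrightarrow> s x = 0) \<Longrightarrow> s = (\<lambda>z. 0)"
  shows "\<exists>Y b. Y \<subseteq> X \<and> (\<forall>y\<in>Y. b y \<in> W) \<and> (\<forall>s\<in>W. s = (\<lambda>z. \<Sum>y\<in>Y. s y * b y z))"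
  using assms
proof (induction X arbitrary: W rule: finite_induct)
  case empty
  then show ?case by (intro exI[of _ "{}"]) auto
next
  case (insert x X)
  note add = insert.prems(2) and scale = insert.prems(3)
  define W0 where "W0 = {w \<in> W. w x = 0}"
  have "\<exists>Y b. Y \<subseteq> X \<and> (\<forall>y\<in>Y. b y \<in> W0) \<and> (\<forall>s\<in>W0. s = (\<lambda>z. \<Sum>y\<in>Y. s y * b y z))"
  proof (rule insert.IH)
    show "(\<lambda>z. 0) \<in> W0" using insert.prems(1) by (simp add: W0_def)
    show "(\<lambda>z. s z + t z) \<in> W0" if "s \<in> W0" "t \<in> W0" for s t using that add by (simp add: W0_def)
    show "(\<lambda>z. r * s z) \<in> W0" if "s \<in> W0" for s r using that scale by (simp add: W0_def)
    show "s = (\<lambda>z. 0)" if "s \<in> W0" "\<And>x. x \<in> X \<Longrightarrow> s x = 0" for s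
      by (rule insert.prems(4)) (use that in \<open>auto simp: W0_def\<close>)
  qed
  then obtain Y b where Y: "Y \<subseteq> X" "\<And>y. y \<in> Y \<Longrightarrow> b y \<in> W0" "\<And>s. s \<in> W0 \<Longrightarrow> s = (\<lambda>z. \<Sum>y\<in>Y. s y * b y z)"
    by blast
  have finY: "finite Y" using Y(1) insert.hyps(1) by (rule finite_subset)
  show ?case
  proof (cases "W0 = W")
    case True
    then show ?thesis using Y by blast
  next
    case False
    then obtain w where w: "w \<in> W" "w x \<noteq> 0" by (auto simp: W0_def)
    define w1 where "w1 = (\<lambda>z. (1 / w x) * w z)"
    have w1: "w1 \<in> W" "w1 x = 1" unfolding w1_def by (rule scale[OF w(1)]) (use w(2) in simp)
    have bW: "b y \<in> W" if "y \<in> Y" for y using Y(2)[OF that] by (simp add: W0_def)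
    have sums: "(\<lambda>z. \<Sum>y\<in>T. c y * b y z) \<in> W" if "T \<subseteq> Y" for T c
      using finite_subset[OF that finY] that
    proof (induction T rule: finite_induct)
      case empty
      show ?case using insert.prems(1) by simp
    next
      case (insert y T)
      then have "(\<lambda>z. c y * b y z + (\<Sum>y\<in>T. c y * b y z)) \<in> W"
        by (intro add scale bW) auto
      then show ?case using insert.hyps by simp
    qed
    \<comment> \<open>From \<open>w1\<close>, with value 1 at \<open>x\<close>, the expansion over
      \<open>Y\<close> of its values there is subtracted. For any \<open>s\<close>, the function
      \<open>s - s x * w1\<close> vanishes at \<open>x\<close> and can be expanded over
      \<open>Y\<close>; collecting the terms with \<open>s x\<close> yields
      \<open>bx\<close>.\<close>
    define bx where "bx = (\<lambda>z. w1 z + (\<Sum>y\<in>Y. (- w1 y) * b y z))"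
    have bx: "bx \<in> W" unfolding bx_def by (rule add[OF w1(1) sums]) simp
    have xY: "x \<notin> Y" using Y(1) insert.hyps by auto
    have "s z = (\<Sum>y\<in>insert x Y. s y * (b(x := bx)) y z)" if s: "s \<in> W" for s z
    proof -
      define t where "t = (\<lambda>z. s z + (- s x) * w1 z)"
      have "t \<in> W0" unfolding t_def W0_def using add[OF s scale[OF w1(1)], of "- s x"] w1(2) by simp
      then have "t z = (\<Sum>y\<in>Y. t y * b y z)" by (metis Y(3))
      then have "s z = s x * w1 z + (\<Sum>y\<in>Y. (s y - s x * w1 y) * b y z)" by (simp add: t_def)
      also have "\<dots> = s x * bx z + (\<Sum>y\<in>Y. s y * b y z)"
        by (simp add: bx_def algebra_simps sum.distrib sum_subtractf sum_distrib_left sum_negf)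
      also have "(\<Sum>y\<in>Y. s y * b y z) = (\<Sum>y\<in>Y. s y * (b(x := bx)) y z)"
        using xY by (intro sum.cong) auto
      finally show ?thesis using finY xY by simp
    qed
    moreover have "(b(x := bx)) y \<in> W" if "y \<in> insert x Y" for y
      using that bx bW by auto
    ultimately show ?thesis using Y(1)
      by (intro exI[of _ "insert x Y"] exI[of _ "b(x := bx)"] conjI ballI ext) blast+
  qed
qed

definition slots :: "nat \<Rightarrow> (nat \<Rightarrow> nat) \<Rightarrow> (nat \<times> nat) set" where
  "slots k m = (SIGMA i:{1..k}. {..<m i})"

text \<open>The properties of tensors by which finitely many values determine them.\<close>

definition tensor_like :: "nat \<Rightarrow> nat \<Rightarrow> (nat \<Rightarrow> nat) \<Rightarrow> ('n, 'v::euclidean_space) tensor \<Rightarrow> bool" where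
  "tensor_like d k m s \<longleftrightarrow>
     (\<forall>I b I' b'. (\<forall>j<m 0. I j = I' j) \<and> (\<forall>(i, j)\<in>slots k m. b i j = b' i j) \<longrightarrow> s (I, b) = s (I', b')) \<and>
     (\<forall>I b j. j < m 0 \<and> length (I j) \<noteq> d \<longrightarrow> s (I, b) = 0) \<and>
     (\<forall>I b i j. (i, j) \<in> slots k m \<longrightarrow> linear (\<lambda>x. s (I, b(i := (b i)(j := x)))))"

lemma tensor_like_cong:
  "tensor_like d k m s \<Longrightarrow> (\<And>j. j < m 0 \<Longrightarrow> I j = I' j) \<Longrightarrow> (\<And>i j. (i, j) \<in> slots k m \<Longrightarrow> b i j = b' i j) \<Longrightarrow>
    s (I, b) = s (I', b')"
  unfolding tensor_like_def by (elim conjE allE[of _ I] allE[of _ b] allE[of _ I'] allE[of _ b'] mp) auto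

lemma tensor_like_zero: "tensor_like d k m s \<Longrightarrow> j < m 0 \<Longrightarrow> length (I j) \<noteq> d \<Longrightarrow> s (I, b) = 0"
  unfolding tensor_like_def by blast

lemma tensor_like_linear: "tensor_like d k m s \<Longrightarrow> (i, j) \<in> slots k m \<Longrightarrow> linear (\<lambda>x. s (I, b(i := (b i)(j := x))))"
  unfolding tensor_like_def by blast

lemma tensor_likeI:
  "(\<And>I b I' b'. (\<And>j. j < m 0 \<Longrightarrow> I j = I' j) \<Longrightarrow> (\<And>i j. (i, j) \<in> slots k m \<Longrightarrow> b i j = b' i j) \<Longrightarrow> s (I, b) = s (I', b')) \<Longrightarrow>
   (\<And>I b j. j < m 0 \<Longrightarrow> length (I j) \<noteq> d \<Longrightarrow> s (I, b) = 0) \<Longrightarrow>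
   (\<And>I b i j. (i, j) \<in> slots k m \<Longrightarrow> linear (\<lambda>x. s (I, b(i := (b i)(j := x))))) \<Longrightarrow> tensor_like d k m s"
  unfolding tensor_like_def by (intro conjI allI impI) blast+

lemma sym_prod_tensor_like:
  fixes w :: "nat \<Rightarrow> 'n tidx list \<Rightarrow> real" and v :: "nat \<Rightarrow> nat \<Rightarrow> 'v::euclidean_space"
  assumes w: "\<And>j. j < m 0 \<Longrightarrow> w j \<in> ext_power d"
  shows "tensor_like d k m (sym_prod k m w v)"
proof (rule tensor_likeI)
  fix I I' :: "nat \<Rightarrow> 'n tidx list" and b b' :: "nat \<Rightarrow> nat \<Rightarrow> 'v"
  assume "\<And>j. j < m 0 \<Longrightarrow> I j = I' j" "\<And>i j. (i, j) \<in> slots k m \<Longrightarrow> b i j = b' i j"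
  then show "sym_prod k m w v (I, b) = sym_prod k m w v (I', b')"
    unfolding sym_prod_def slots_def by simp
next
  fix I :: "nat \<Rightarrow> 'n tidx list" and b :: "nat \<Rightarrow> nat \<Rightarrow> 'v" and j
  assume j: "j < m 0" "length (I j) \<noteq> d"
  have "(\<Prod>j<m 0. w (p j) (I j)) = 0" if "p permutes {..<m 0}" for p
  proof (rule prod_zero)
    have "p j < m 0" using that j permutes_in_image[of p "{..<m 0}" j] by simp
    then show "\<exists>j\<in>{..<m 0}. w (p j) (I j) = 0" using j ext_power_support[OF w] by blast
  qed simp
  then have "(\<Sum>p | p permutes {..<m 0}. \<Prod>j<m 0. w (p j) (I j)) = 0" by (intro sum.neutral) auto
  then show "sym_prod k m w v (I, b) = 0" unfolding sym_prod_def by simp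
next
  fix I :: "nat \<Rightarrow> 'n tidx list" and b :: "nat \<Rightarrow> nat \<Rightarrow> 'v" and i0 j0
  assume "(i0, j0) \<in> slots k m"
  then have i0: "i0 \<in> {1..k}" and j0: "j0 < m i0" by (auto simp: slots_def)
  \<comment> \<open>\<open>A\<close>, \<open>B\<close> and \<open>R\<close> collect the factors free
    of the slot \<open>(i0, j0)\<close>; each permutation of the remaining factor then contributes a
    single linear expression.\<close>
  define A where "A = (\<Sum>p | p permutes {..<m 0}. \<Prod>j<m 0. w (p j) (I j)) / fact (m 0)"
  define B where "B = (\<Prod>i\<in>{1..k} - {i0}. (\<Sum>p | p permutes {..<m i}. \<Prod>j<m i. v i (p j) \<bullet> b i j) / fact (m i))"
  define R where "R p = (\<Prod>j\<in>{..<m i0} - {j0}. v i0 (p j) \<bullet> b i0 j)" for p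
  have "sym_prod k m w v (I, b(i0 := (b i0)(j0 := x))) =
      A * (((\<Sum>p | p permutes {..<m i0}. (v i0 (p j0) \<bullet> x) * R p) / fact (m i0)) * B)" for x
  proof -
    define b' where "b' = b(i0 := (b i0)(j0 := x))"
    have 1: "(\<Prod>i\<in>{1..k} - {i0}. (\<Sum>p | p permutes {..<m i}. \<Prod>j<m i. v i (p j) \<bullet> b' i j) / fact (m i)) = B"
      unfolding B_def by (intro prod.cong) (auto simp: b'_def)
    have 2: "(\<Prod>j<m i0. v i0 (p j) \<bullet> b' i0 j) = (v i0 (p j0) \<bullet> x) * R p" for p
    proof -
      have "(\<Prod>j\<in>{..<m i0} - {j0}. v i0 (p j) \<bullet> b' i0 j) = R p"
        unfolding R_def by (intro prod.cong) (auto simp: b'_def)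
      then show ?thesis using prod.remove[of "{..<m i0}" j0 "\<lambda>j. v i0 (p j) \<bullet> b' i0 j"] j0
        by (simp add: b'_def)
    qed
    have 3: "(\<Prod>i\<in>{1..k}. (\<Sum>p | p permutes {..<m i}. \<Prod>j<m i. v i (p j) \<bullet> b' i j) / fact (m i)) =
        ((\<Sum>p | p permutes {..<m i0}. (v i0 (p j0) \<bullet> x) * R p) / fact (m i0)) * B"
      unfolding 1[symmetric] 2[symmetric] by (rule prod.remove) (use i0 in auto)
    show ?thesis unfolding b'_def[symmetric] sym_prod_def A_def by (simp only: prod.case 3)
  qed
  then show "linear (\<lambda>x. sym_prod k m w v (I, b(i0 := (b i0)(j0 := x))))"
    by (auto intro!: linearI simp: inner_add_right algebra_simps sum.distrib add_divide_distrib sum_distrib_left)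
qed

lemma sym_tensors_tensor_like: "s \<in> sym_tensors d k m V \<Longrightarrow> tensor_like d k m s"
proof (induction rule: sym_tensors.induct)
  case (gen w v)
  then show ?case by (intro sym_prod_tensor_like)
next
  case (add s t)
  show ?case
  proof (rule tensor_likeI)
    show "s (I, b) + t (I, b) = s (I', b') + t (I', b')"
      if "\<And>j. j < m 0 \<Longrightarrow> I j = I' j" "\<And>i j. (i, j) \<in> slots k m \<Longrightarrow> b i j = b' i j" for I b I' b'
      by (intro arg_cong2[where f = "(+)"] tensor_like_cong[OF add.IH(1)] tensor_like_cong[OF add.IH(2)] that)
    show "s (I, b) + t (I, b) = 0" if "j < m 0" "length (I j) \<noteq> d" for I b j
      using tensor_like_zero[where I = I, OF add.IH(1) that] tensor_like_zero[where I = I, OF add.IH(2) that] by simp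
    show "linear (\<lambda>x. s (I, b(i := (b i)(j := x))) + t (I, b(i := (b i)(j := x))))" if "(i, j) \<in> slots k m" for I b i j
      by (intro linear_compose_add tensor_like_linear[OF add.IH(1) that] tensor_like_linear[OF add.IH(2) that])
  qed
next
  case (scale s r)
  show ?case
  proof (rule tensor_likeI)
    show "r * s (I, b) = r * s (I', b')"
      if "\<And>j. j < m 0 \<Longrightarrow> I j = I' j" "\<And>i j. (i, j) \<in> slots k m \<Longrightarrow> b i j = b' i j" for I b I' b'
      by (intro arg_cong2[where f = "(*)"] refl tensor_like_cong[OF scale.IH] that)
    show "r * s (I, b) = 0" if "j < m 0" "length (I j) \<noteq> d" for I b j
      using tensor_like_zero[where I = I, OF scale.IH that] by simp
    show "linear (\<lambda>x. r * s (I, b(i := (b i)(j := x))))" if "(i, j) \<in> slots k m" for I b i j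
      using linear_compose_scale_right[OF tensor_like_linear[OF scale.IH that], of r] by simp
  qed
qed

section \<open>Finitely many arguments that determine a tensor\<close>

lemma finite_slots: "finite (slots k m)"
  by (simp add: slots_def)

text \<open>Arguments are functions on all of \<open>nat\<close>. The fixed defaults
  \<open>[]\<close> and 0 outside the slots that count keep the set finite.\<close>

definition test_points :: "nat \<Rightarrow> nat \<Rightarrow> (nat \<Rightarrow> nat) \<Rightarrow> ((nat \<Rightarrow> 'n tidx list) \<times> (nat \<Rightarrow> nat \<Rightarrow> 'v::euclidean_space)) set" where
  "test_points d k m = (\<lambda>(L, \<beta>). (\<lambda>j. if j < m 0 then L j else [], \<lambda>i j. if (i, j) \<in> slots k m then \<beta> (i, j) else 0)) `
     (PiE {..<m 0} (\<lambda>_. {I. length I = d}) \<times> PiE (slots k m) (\<lambda>_. Basis))"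

lemma finite_test_points: "finite (test_points d k m :: ((nat \<Rightarrow> ('n::finite) tidx list) \<times> (nat \<Rightarrow> nat \<Rightarrow> 'v::euclidean_space)) set)"
  unfolding test_points_def
  by (intro finite_imageI finite_cartesian_product finite_PiE finite_slots) (auto simp: finite_lists_length)

text \<open>Induction on the set of vector slots not yet filled by basis vectors, each being
  expanded in the basis by linearity. Once all are basis vectors, the argument agrees with a test
  point in every slot that counts.\<close>

lemma tensor_like_determined:
  fixes s :: "('n::finite, 'v::euclidean_space) tensor"
  assumes s: "tensor_like d k m s" and z: "\<And>x. x \<in> test_points d k m \<Longrightarrow> s x = 0"
  shows "s = (\<lambda>z. 0)"
proof -
  have "s (I, b) = 0" if "P \<subseteq> slots k m" "\<And>i j. (i, j) \<in> slots k m - P \<Longrightarrow> b i j \<in> Basis"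
    "\<And>j. j < m 0 \<Longrightarrow> length (I j) = d" for P I b
    using finite_subset[OF that(1) finite_slots] that
  proof (induction P arbitrary: b rule: finite_induct)
    case empty
    define I' where "I' j = (if j < m 0 then restrict I {..<m 0} j else [])" for j
    define b' where "b' i j = (if (i, j) \<in> slots k m then restrict (\<lambda>(i, j). b i j) (slots k m) (i, j) else 0)" for i j
    have "(I', b') \<in> test_points d k m"
      unfolding test_points_def
      by (rule image_eqI[of _ _ "(restrict I {..<m 0}, restrict (\<lambda>(i, j). b i j) (slots k m))"])
        (use empty in \<open>auto simp: I'_def b'_def fun_eq_iff\<close>)
    then have "s (I', b') = 0" by (rule z)
    moreover have "s (I, b) = s (I', b')"
      by (rule tensor_like_cong[OF s]) (simp_all add: I'_def b'_def)
    ultimately show ?case by simp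
  next
    case (insert p P)
    obtain i j where p: "p = (i, j)" by force
    have lin: "linear (\<lambda>x. s (I, b(i := (b i)(j := x))))"
      by (rule tensor_like_linear[OF s]) (use insert.prems(1) p in auto)
    have e0: "s (I, b(i := (b i)(j := e))) = 0" if "e \<in> Basis" for e
      by (rule insert.IH) (use insert.prems insert.hyps that in \<open>auto simp: p\<close>)
    have "s (I, b) = s (I, b(i := (b i)(j := \<Sum>e\<in>Basis. (b i j \<bullet> e) *\<^sub>R e)))"
      by (simp add: euclidean_representation)
    also have "\<dots> = 0"
      using linear_sum[OF lin, of "\<lambda>e. (b i j \<bullet> e) *\<^sub>R e" Basis] by (simp add: linear_scale[OF lin] e0)
    finally show ?case .
  qed
  note main = this[of "slots k m"]
  show ?thesis
  proof
    fix z :: "(nat \<Rightarrow> 'n tidx list) \<times> (nat \<Rightarrow> nat \<Rightarrow> 'v)"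
    obtain I b where zz: "z = (I, b)" by force
    show "s z = 0"
    proof (cases "\<forall>j<m 0. length (I j) = d")
      case True
      then show ?thesis unfolding zz by (intro main) auto
    next
      case False
      then show ?thesis unfolding zz using tensor_like_zero[OF s] by blast
    qed
  qed
qed

text \<open>Differentiability is part of the relation, so that it passes through sums and products
  without side conditions.\<close>

definition same_jet :: "(real \<Rightarrow> real) \<Rightarrow> (real \<Rightarrow> real) \<Rightarrow> bool" where
  "same_jet f g \<longleftrightarrow> f 0 = g 0 \<and> (\<exists>D. (f has_real_derivative D) (at 0) \<and> (g has_real_derivative D) (at 0))"

lemma same_jet_const: "same_jet (\<lambda>t. c) (\<lambda>t. c)"
  by (auto simp: same_jet_def intro!: exI[of _ 0])

lemma same_jet_mult: "same_jet f g \<Longrightarrow> same_jet f' g' \<Longrightarrow> same_jet (\<lambda>t. f t * f' t) (\<lambda>t. g t * g' t)"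
proof -
  assume "same_jet f g" "same_jet f' g'"
  then obtain D D' where D: "(f has_real_derivative D) (at 0)" "(g has_real_derivative D) (at 0)"
    "(f' has_real_derivative D') (at 0)" "(g' has_real_derivative D') (at 0)" and e: "f 0 = g 0" "f' 0 = g' 0"
    unfolding same_jet_def by blast
  show ?thesis using DERIV_mult[OF D(1,3)] DERIV_mult[OF D(2,4)] e unfolding same_jet_def by auto
qed

lemma same_jet_add: "same_jet f g \<Longrightarrow> same_jet f' g' \<Longrightarrow> same_jet (\<lambda>t. f t + f' t) (\<lambda>t. g t + g' t)"
proof -
  assume "same_jet f g" "same_jet f' g'"
  then obtain D D' where D: "(f has_real_derivative D) (at 0)" "(g has_real_derivative D) (at 0)"
    "(f' has_real_derivative D') (at 0)" "(g' has_real_derivative D') (at 0)" and e: "f 0 = g 0" "f' 0 = g' 0"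
    unfolding same_jet_def by blast
  show ?thesis using DERIV_add[OF D(1,3)] DERIV_add[OF D(2,4)] e unfolding same_jet_def by auto
qed

lemma same_jet_divide: "same_jet f g \<Longrightarrow> same_jet (\<lambda>t. f t / c) (\<lambda>t. g t / c)"
  unfolding divide_inverse by (intro same_jet_mult same_jet_const)

lemma same_jet_sum: "(\<And>i. i \<in> S \<Longrightarrow> same_jet (f i) (g i)) \<Longrightarrow> same_jet (\<lambda>t. \<Sum>i\<in>S. f i t) (\<lambda>t. \<Sum>i\<in>S. g i t)"
  by (induction S rule: infinite_finite_induct) (auto intro: same_jet_const same_jet_add)

lemma same_jet_prod: "(\<And>i. i \<in> S \<Longrightarrow> same_jet (f i) (g i)) \<Longrightarrow> same_jet (\<lambda>t. \<Prod>i\<in>S. f i t) (\<lambda>t. \<Prod>i\<in>S. g i t)"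
  by (induction S rule: infinite_finite_induct) (auto intro: same_jet_const same_jet_mult)

lemma sym_prod_same_jet:
  assumes "\<And>I. same_jet (\<lambda>t. w t I) (\<lambda>t. w' t I)"
    and "\<And>i e. i \<in> {1..k} \<Longrightarrow> same_jet (\<lambda>t. v i t \<bullet> e) (\<lambda>t. v' i t \<bullet> e)"
  shows "same_jet (\<lambda>t. sym_prod k m (\<lambda>j. w t) (\<lambda>i j. v i t) z) (\<lambda>t. sym_prod k m (\<lambda>j. w' t) (\<lambda>i j. v' i t) z)"
  unfolding sym_prod_def by (cases z) (auto intro!: same_jet_mult same_jet_divide same_jet_sum same_jet_prod same_jet_const assms)

section \<open>Invariant functionals along curves\<close>

lemma invariant_functionalD:
  assumes "invariant_functional d k m \<rho> V \<phi>"
  shows "s \<in> sym_tensors d k m V \<Longrightarrow> t \<in> sym_tensors d k m V \<Longrightarrow> \<phi> (\<lambda>z. s z + t z) = \<phi> s + \<phi> t"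
    and "s \<in> sym_tensors d k m V \<Longrightarrow> \<phi> (\<lambda>z. r * s z) = r * \<phi> s"
    and "B \<in> Ggrp \<Longrightarrow> (\<And>j. j < m 0 \<Longrightarrow> w j \<in> ext_power d) \<Longrightarrow> (\<And>i j. i \<in> {1..k} \<Longrightarrow> j < m i \<Longrightarrow> v i j \<in> V i) \<Longrightarrow>
      \<phi> (sym_prod k m (\<lambda>j. ext_act B (w j)) (\<lambda>i j. \<rho> i B (v i j))) = \<phi> (sym_prod k m w v)"
  using assms unfolding invariant_functional_def by simp_all

text \<open>Additivity of \<phi> is given only on \<open>sym_tensors\<close>, so membership of the
  partial sums is proved along with the formula. The empty sum comes from homogeneity with factor
  0.\<close>

lemma invariant_functional_sum:
  fixes \<phi> :: "('n::finite, 'v::euclidean_space) tensor \<Rightarrow> real"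
  assumes inv: "invariant_functional d k m \<rho> V \<phi>" and z: "(\<lambda>z. 0) \<in> (sym_tensors d k m V :: ('n, 'v) tensor set)"
    and "finite Y" "\<And>y. y \<in> Y \<Longrightarrow> b y \<in> sym_tensors d k m V"
  shows "(\<lambda>z. \<Sum>y\<in>Y. c y * b y z) \<in> sym_tensors d k m V \<and>
    \<phi> (\<lambda>z. \<Sum>y\<in>Y. c y * b y z) = (\<Sum>y\<in>Y. c y * \<phi> (b y))"
  using assms(3,4)
proof (induction Y rule: finite_induct)
  case empty
  have "\<phi> (\<lambda>z. 0 * 0) = 0 * \<phi> (\<lambda>z. 0)" by (rule invariant_functionalD(2)[OF inv z])
  then show ?case using z by simp
next
  case (insert y Y)
  have 1: "(\<lambda>z. c y * b y z) \<in> sym_tensors d k m V" "\<phi> (\<lambda>z. c y * b y z) = c y * \<phi> (b y)"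
    using insert.prems[of y] by (auto intro: sym_tensors.scale invariant_functionalD(2)[OF inv])
  have 2: "(\<lambda>z. \<Sum>y\<in>Y. c y * b y z) \<in> sym_tensors d k m V"
    "\<phi> (\<lambda>z. \<Sum>y\<in>Y. c y * b y z) = (\<Sum>y\<in>Y. c y * \<phi> (b y))"
    using insert by auto
  have "\<phi> (\<lambda>z. c y * b y z + (\<Sum>y\<in>Y. c y * b y z)) = c y * \<phi> (b y) + (\<Sum>y\<in>Y. c y * \<phi> (b y))"
    using invariant_functionalD(1)[OF inv 1(1) 2(1)] 1(2) 2(2) by simp
  then show ?case using insert.hyps sym_tensors.add[OF 1(1) 2(1)] by simp
qed

text \<open>The functional is linear in evaluations of tensors at finitely many points, so that its derivative
  along a curve depends only on the one-jet, and a curve in an orbit realises this jet.\<close>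

lemma invariant_functional_derivative_zero:
  fixes \<rho> :: "nat \<Rightarrow> ('n::finite, 'v::euclidean_space) rep"
  assumes inv: "invariant_functional d k m \<rho> V \<phi>"
    and sub: "\<And>i. i \<in> {1..k} \<Longrightarrow> subspace (V i)"
    and mem: "\<forall>\<^sub>F t in nhds 0. w t \<in> ext_power d \<and> (\<forall>i\<in>{1..k}. v i t \<in> V i)"
    and C: "\<And>t. C t \<in> Ggrp" and pres: "\<And>i t. i \<in> {1..k} \<Longrightarrow> \<rho> i (C t) (v i 0) \<in> V i"
    and wjet: "\<And>I. same_jet (\<lambda>t. w t I) (\<lambda>t. ext_act (C t) (w 0) I)"
    and vjet: "\<And>i e. i \<in> {1..k} \<Longrightarrow> same_jet (\<lambda>t. v i t \<bullet> e) (\<lambda>t. \<rho> i (C t) (v i 0) \<bullet> e)"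
  shows "((\<lambda>t. \<phi> (sym_prod k m (\<lambda>j. w t) (\<lambda>i j. v i t))) has_real_derivative 0) (at (0::real))"
proof -
  let ?W = "sym_tensors d k m V :: ('n, 'v) tensor set"
  have zero: "(\<lambda>z. 0) \<in> ?W"
  proof -
    \<comment> \<open>\<open>sym_tensors\<close> is built from generators, so the zero tensor is
      obtained as 0 times one of them.\<close>
    have "sym_prod k m (\<lambda>j I. 0) (\<lambda>i j. 0) \<in> ?W"
      by (rule sym_tensors.gen) (auto simp: ext_power_def subspace_0 sub)
    from sym_tensors.scale[OF this, of 0] show ?thesis by simp
  qed
  have "\<exists>Y b. Y \<subseteq> test_points d k m \<and> (\<forall>y\<in>Y. b y \<in> ?W) \<and> (\<forall>s\<in>?W. s = (\<lambda>z. \<Sum>y\<in>Y. s y * b y z))"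
  proof (rule finite_dim_evaluation_basis[OF finite_test_points zero])
    show "s = (\<lambda>z. 0)" if "s \<in> ?W" "\<And>x. x \<in> test_points d k m \<Longrightarrow> s x = 0" for s
      by (rule tensor_like_determined[OF sym_tensors_tensor_like[OF that(1)] that(2)])
  qed (auto intro: sym_tensors.add sym_tensors.scale)
  then obtain Y b where Y: "Y \<subseteq> test_points d k m" "\<forall>y\<in>Y. b y \<in> ?W"
    "\<forall>s\<in>?W. s = (\<lambda>z. \<Sum>y\<in>Y. s y * b y z)"
    by (elim exE conjE)
  have finY: "finite Y" using Y(1) finite_test_points by (rule finite_subset)
  have ev: "\<phi> s = (\<Sum>y\<in>Y. s y * \<phi> (b y))" if "s \<in> ?W" for s
  proof -
    have "\<phi> (\<lambda>z. \<Sum>y\<in>Y. s y * b y z) = (\<Sum>y\<in>Y. s y * \<phi> (b y))"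
      using invariant_functional_sum[OF inv zero finY, of b s] Y(2) by blast
    then show ?thesis using Y(3)[rule_format, OF that] by simp
  qed
  define s where "s t = sym_prod k m (\<lambda>j. w t) (\<lambda>i j. v i t)" for t
  define s' where "s' t = sym_prod k m (\<lambda>j. ext_act (C t) (w 0)) (\<lambda>i j. \<rho> i (C t) (v i 0))" for t
  have m0: "w 0 \<in> ext_power d" "\<And>i. i \<in> {1..k} \<Longrightarrow> v i 0 \<in> V i"
    using eventually_nhds_x_imp_x[OF mem] by auto
  have "same_jet (\<lambda>t. s t y) (\<lambda>t. s' t y)" for y
    unfolding s_def s'_def by (rule sym_prod_same_jet[OF wjet vjet])
  then have "same_jet (\<lambda>t. \<Sum>y\<in>Y. s t y * \<phi> (b y)) (\<lambda>t. \<Sum>y\<in>Y. s' t y * \<phi> (b y))"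
    by (intro same_jet_sum same_jet_mult same_jet_const)
  moreover have "(\<Sum>y\<in>Y. s' t y * \<phi> (b y)) = \<phi> (s 0)" for t
  proof -
    have "s' t \<in> ?W" unfolding s'_def
      by (rule sym_tensors.gen) (auto intro: ext_act_ext_power m0 pres)
    then have "(\<Sum>y\<in>Y. s' t y * \<phi> (b y)) = \<phi> (s' t)" by (simp add: ev)
    also have "\<dots> = \<phi> (s 0)" unfolding s_def s'_def
      by (rule invariant_functionalD(3)[OF inv C]) (auto simp: m0)
    finally show ?thesis .
  qed
  ultimately have "((\<lambda>t. \<Sum>y\<in>Y. s t y * \<phi> (b y)) has_real_derivative 0) (at 0)"
    unfolding same_jet_def using DERIV_unique[OF _ DERIV_const] by auto
  moreover have "\<forall>\<^sub>F t in nhds 0. \<phi> (s t) = (\<Sum>y\<in>Y. s t y * \<phi> (b y))"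
    using mem by eventually_elim (auto simp: s_def intro!: ev sym_tensors.gen)
  ultimately show ?thesis unfolding s_def by (subst DERIV_cong_ev) auto
qed


section \<open>Gauges and tractors\<close>

lemma posdef_det:
  fixes G :: "real^'n^'n"
  assumes "\<And>v. v \<noteq> 0 \<Longrightarrow> v \<bullet> (G *v v) > 0"
  shows "det G \<noteq> 0"
proof -
  have "\<forall>x. G *v x = 0 \<longrightarrow> x = 0"
    using assms by (metis inner_zero_right less_irrefl)
  then have "\<exists>B. B ** G = mat 1" by (simp add: matrix_left_invertible_ker)
  then show ?thesis by (simp add: invertible_left_inverse flip: invertible_det_nz)
qed

lemma smooth_on_mid: "open U \<Longrightarrow> smooth_on U f \<Longrightarrow> smooth_on U (\<lambda>x. mid (f x))"
  unfolding mid_def by (intro smooth_intros)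

lemma smooth_on_tvec:
  assumes "open U" "smooth_on U s" "smooth_on U m" "smooth_on U r"
  shows "smooth_on U (\<lambda>x. tvec (s x) (m x) (r x))"
proof (rule smooth_on_vec[OF assms(1)])
  show "smooth_on U (\<lambda>x. tvec (s x) (m x) (r x) $ i)" for i
    by (cases i) (use assms in \<open>auto intro: smooth_on_nth\<close>)
qed

section \<open>Charts, Jacobians and the metrics of the conformal class\<close>

locale conformal_manifold =
  fixes A :: "('m::topological_space, 'n::finite) chart set" and c :: "('m, 'n) metric set"
  assumes atlas: "oriented_smooth_structure A" and conf: "conformal_class A c"
begin

lemma
  assumes "\<kappa> \<in> A"
  shows chart_open: "open (cdom \<kappa>)" "open (coord \<kappa> ` cdom \<kappa>)"
    and chart_homeo: "homeomorphism (cdom \<kappa>) (coord \<kappa> ` cdom \<kappa>) (coord \<kappa>) (cinv \<kappa>)"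
proof -
  have "is_chart \<kappa>" using assms atlas by (simp add: oriented_smooth_structure_def)
  then show "open (cdom \<kappa>)" "open (coord \<kappa> ` cdom \<kappa>)"
    "homeomorphism (cdom \<kappa>) (coord \<kappa> ` cdom \<kappa>) (coord \<kappa>) (cinv \<kappa>)"
    unfolding is_chart_def by simp_all
qed

lemma charts_compatible: "\<kappa> \<in> A \<Longrightarrow> \<kappa>' \<in> A \<Longrightarrow> compatible \<kappa> \<kappa>'"
  using atlas by (simp add: oriented_smooth_structure_def)

lemma class_riemannian: "g \<in> c \<Longrightarrow> riemannian A g"
  using conf by (simp add: conformal_class_def)

lemma
  assumes "\<kappa> \<in> A"
  shows cinv_coord: "x \<in> cdom \<kappa> \<Longrightarrow> cinv \<kappa> (coord \<kappa> x) = x"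
    and coord_cinv: "y \<in> coord \<kappa> ` cdom \<kappa> \<Longrightarrow> coord \<kappa> (cinv \<kappa> y) = y"
    and cinv_cdom: "y \<in> coord \<kappa> ` cdom \<kappa> \<Longrightarrow> cinv \<kappa> y \<in> cdom \<kappa>"
proof -
  have h: "\<forall>x\<in>cdom \<kappa>. cinv \<kappa> (coord \<kappa> x) = x" "\<forall>y\<in>coord \<kappa> ` cdom \<kappa>. coord \<kappa> (cinv \<kappa> y) = y"
    "cinv \<kappa> ` coord \<kappa> ` cdom \<kappa> = cdom \<kappa>"
    using chart_homeo[OF assms] by (simp_all add: homeomorphism_def)
  show "x \<in> cdom \<kappa> \<Longrightarrow> cinv \<kappa> (coord \<kappa> x) = x" using h(1) by simp
  show "y \<in> coord \<kappa> ` cdom \<kappa> \<Longrightarrow> coord \<kappa> (cinv \<kappa> y) = y" using h(2) by blast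
  show "y \<in> coord \<kappa> ` cdom \<kappa> \<Longrightarrow> cinv \<kappa> y \<in> cdom \<kappa>" using h(3) by blast
qed

lemma coord_image_iff:
  assumes "\<kappa> \<in> A"
  shows "y \<in> coord \<kappa> ` (W \<inter> cdom \<kappa>) \<longleftrightarrow> y \<in> coord \<kappa> ` cdom \<kappa> \<and> cinv \<kappa> y \<in> W"
proof
  assume "y \<in> coord \<kappa> ` (W \<inter> cdom \<kappa>)"
  then obtain x where "x \<in> W" "x \<in> cdom \<kappa>" "y = coord \<kappa> x" by blast
  then show "y \<in> coord \<kappa> ` cdom \<kappa> \<and> cinv \<kappa> y \<in> W" using cinv_coord[OF assms] by simp
next
  assume y: "y \<in> coord \<kappa> ` cdom \<kappa> \<and> cinv \<kappa> y \<in> W"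
  then have "y = coord \<kappa> (cinv \<kappa> y)" "cinv \<kappa> y \<in> W \<inter> cdom \<kappa>"
    using coord_cinv[OF assms] cinv_cdom[OF assms] by (simp, blast)
  then show "y \<in> coord \<kappa> ` (W \<inter> cdom \<kappa>)" by (rule image_eqI)
qed

lemma coord_image_open:
  assumes "\<kappa> \<in> A" "open W"
  shows "open (coord \<kappa> ` (W \<inter> cdom \<kappa>))"
proof -
  have "coord \<kappa> ` (W \<inter> cdom \<kappa>) = coord \<kappa> ` cdom \<kappa> \<inter> cinv \<kappa> -` W"
    by (rule set_eqI) (simp only: coord_image_iff[OF assms(1)] Int_iff vimage_eq)
  moreover have "continuous_on (coord \<kappa> ` cdom \<kappa>) (cinv \<kappa>)"
    using chart_homeo[OF assms(1)] by (simp add: homeomorphism_def)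
  ultimately show ?thesis
    using continuous_open_preimage[OF _ chart_open(2)[OF assms(1)] assms(2)] by simp
qed

lemma chart_exists: "\<exists>\<kappa>\<in>A. x \<in> cdom \<kappa>"
  using atlas unfolding oriented_smooth_structure_def by blast

lemma
  assumes "\<kappa> \<in> A" "g \<in> c"
  shows metric_smooth: "smooth_on (coord \<kappa> ` cdom \<kappa>) (g \<kappa>)"
    and metric_sym: "y \<in> coord \<kappa> ` cdom \<kappa> \<Longrightarrow> transpose (g \<kappa> y) = g \<kappa> y"
    and metric_pos: "y \<in> coord \<kappa> ` cdom \<kappa> \<Longrightarrow> v \<noteq> 0 \<Longrightarrow> v \<bullet> (g \<kappa> y *v v) > 0"
    and metric_change: "\<kappa>' \<in> A \<Longrightarrow> x \<in> cdom \<kappa> \<Longrightarrow> x \<in> cdom \<kappa>' \<Longrightarrow>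
      g \<kappa> (coord \<kappa> x) = transpose (jac \<kappa> \<kappa>' x) ** g \<kappa>' (coord \<kappa>' x) ** jac \<kappa> \<kappa>' x"
proof -
  note r = class_riemannian[OF assms(2), unfolded riemannian_def]
  note r1 = bspec[OF conjunct1[OF r] assms(1)]
  show "smooth_on (coord \<kappa> ` cdom \<kappa>) (g \<kappa>)" by (rule conjunct1[OF r1])
  show "transpose (g \<kappa> y) = g \<kappa> y" if "y \<in> coord \<kappa> ` cdom \<kappa>"
    by (rule conjunct1[OF bspec[OF conjunct2[OF r1] that]])
  show "v \<bullet> (g \<kappa> y *v v) > 0" if "y \<in> coord \<kappa> ` cdom \<kappa>" "v \<noteq> 0"
    by (rule conjunct2[OF bspec[OF conjunct2[OF r1] that(1)], rule_format, OF that(2)])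
  show "g \<kappa> (coord \<kappa> x) = transpose (jac \<kappa> \<kappa>' x) ** g \<kappa>' (coord \<kappa>' x) ** jac \<kappa> \<kappa>' x"
    if "\<kappa>' \<in> A" "x \<in> cdom \<kappa>" "x \<in> cdom \<kappa>'"
    by (rule bspec[OF bspec[OF bspec[OF conjunct2[OF r] assms(1)] that(1)]]) (use that in simp)
qed

lemma metric_det: "\<kappa> \<in> A \<Longrightarrow> g \<in> c \<Longrightarrow> y \<in> coord \<kappa> ` cdom \<kappa> \<Longrightarrow> det (g \<kappa> y) \<noteq> 0"
  by (rule posdef_det) (rule metric_pos)

lemma metric_inv_smooth: "\<kappa> \<in> A \<Longrightarrow> g \<in> c \<Longrightarrow> smooth_on (coord \<kappa> ` cdom \<kappa>) (\<lambda>y. matrix_inv (g \<kappa> y))"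
  by (intro smooth_on_matrix_inv chart_open metric_smooth metric_det)

definition ginv :: "('m, 'n) gauge \<Rightarrow> 'm \<Rightarrow> real^'n^'n" where
  "ginv \<gamma> x = matrix_inv (snd \<gamma> (fst \<gamma>) (coord (fst \<gamma>) x))"

lemma
  assumes "\<kappa> \<in> A" "g \<in> c" "x \<in> cdom \<kappa>"
  shows ginv_right: "g \<kappa> (coord \<kappa> x) *v (ginv (\<kappa>, g) x *v v) = v"
    and ginv_left: "ginv (\<kappa>, g) x *v (g \<kappa> (coord \<kappa> x) *v v) = v"
  using matrix_inv_inverts[OF metric_det[OF assms(1,2) imageI[OF assms(3)]]]
  by (simp_all add: ginv_def matrix_vector_mul_assoc)

lemma metric_inner:
  assumes "\<kappa> \<in> A" "g \<in> c" "x \<in> cdom \<kappa>"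
  shows "v \<bullet> (g \<kappa> (coord \<kappa> x) *v w) = w \<bullet> (g \<kappa> (coord \<kappa> x) *v v)"
  using inner_matrix_adjoint[of "g \<kappa> (coord \<kappa> x)" v w] metric_sym[OF assms(1,2) imageI[OF assms(3)]]
  by (simp add: inner_commute)

lemma ginv_inner:
  assumes "\<kappa> \<in> A" "g \<in> c" "x \<in> cdom \<kappa>"
  shows "v \<bullet> (ginv (\<kappa>, g) x *v w) = w \<bullet> (ginv (\<kappa>, g) x *v v)"
proof -
  have "v \<bullet> (ginv (\<kappa>, g) x *v w) = (g \<kappa> (coord \<kappa> x) *v (ginv (\<kappa>, g) x *v v)) \<bullet> (ginv (\<kappa>, g) x *v w)"
    by (simp add: ginv_right[OF assms])
  also have "\<dots> = (ginv (\<kappa>, g) x *v v) \<bullet> (g \<kappa> (coord \<kappa> x) *v (ginv (\<kappa>, g) x *v w))"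
    by (metis inner_commute metric_inner[OF assms])
  also have "\<dots> = w \<bullet> (ginv (\<kappa>, g) x *v v)" by (simp add: ginv_right[OF assms] inner_commute)
  finally show ?thesis .
qed

lemma ginv_pos:
  assumes "\<kappa> \<in> A" "g \<in> c" "x \<in> cdom \<kappa>" "v \<noteq> 0"
  shows "v \<bullet> (ginv (\<kappa>, g) x *v v) > 0"
proof -
  define u where "u = ginv (\<kappa>, g) x *v v"
  have v: "v = g \<kappa> (coord \<kappa> x) *v u" by (simp add: u_def ginv_right[OF assms(1-3)])
  then have "u \<noteq> 0" using assms(4) by auto
  then have "u \<bullet> v > 0" using metric_pos[OF assms(1,2) imageI[OF assms(3)]] v by simp
  then show ?thesis by (simp add: u_def inner_commute)
qed

lemma transition_smooth:
  assumes "\<kappa> \<in> A" "\<kappa>' \<in> A"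
  shows "smooth_on (coord \<kappa> ` (cdom \<kappa>' \<inter> cdom \<kappa>)) (\<lambda>y. coord \<kappa>' (cinv \<kappa> y))"
  using charts_compatible[OF assms] by (simp add: compatible_def o_def Int_commute)

lemma jac_det: "\<kappa> \<in> A \<Longrightarrow> \<kappa>' \<in> A \<Longrightarrow> x \<in> cdom \<kappa> \<Longrightarrow> x \<in> cdom \<kappa>' \<Longrightarrow> det (jac \<kappa> \<kappa>' x) > 0"
  using charts_compatible[of \<kappa> \<kappa>'] by (simp add: compatible_def)

lemma transition_derivative:
  assumes "\<kappa> \<in> A" "\<kappa>' \<in> A" "x \<in> cdom \<kappa>" "x \<in> cdom \<kappa>'"
  shows "((\<lambda>y. coord \<kappa>' (cinv \<kappa> y)) has_derivative (\<lambda>h. jac \<kappa> \<kappa>' x *v h)) (at (coord \<kappa> x))"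
proof -
  have "((\<lambda>y. coord \<kappa>' (cinv \<kappa> y)) has_derivative frechet_derivative (\<lambda>y. coord \<kappa>' (cinv \<kappa> y)) (at (coord \<kappa> x))) (at (coord \<kappa> x))"
    by (rule smooth_on_has_derivative[OF transition_smooth[OF assms(1,2)]]) (use assms in auto)
  moreover from this have "frechet_derivative (\<lambda>y. coord \<kappa>' (cinv \<kappa> y)) (at (coord \<kappa> x)) = (\<lambda>h. jac \<kappa> \<kappa>' x *v h)"
    unfolding jac_def o_def by (intro ext matrix_linear_works[symmetric] has_derivative_linear)
  ultimately show ?thesis by simp
qed

text \<open>The composite coordinate change agrees with the direct one only where the middle chart
  is defined; this is a neighbourhood of the point, so uniqueness of derivatives compares the
  matrices.\<close>

lemma jac_comp:
  assumes "\<kappa> \<in> A" "\<kappa>' \<in> A" "\<kappa>'' \<in> A" "x \<in> cdom \<kappa>" "x \<in> cdom \<kappa>'" "x \<in> cdom \<kappa>''"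
  shows "jac \<kappa> \<kappa>'' x = jac \<kappa>' \<kappa>'' x ** jac \<kappa> \<kappa>' x"
proof -
  define U where "U = coord \<kappa> ` ((cdom \<kappa>' \<inter> cdom \<kappa>'') \<inter> cdom \<kappa>)"
  have U: "open U" "coord \<kappa> x \<in> U" unfolding U_def
    using assms coord_image_open[of \<kappa>] by (auto intro!: coord_image_open chart_open)
  have "((\<lambda>y. coord \<kappa>'' (cinv \<kappa>' (coord \<kappa>' (cinv \<kappa> y)))) has_derivative (\<lambda>h. jac \<kappa>' \<kappa>'' x *v (jac \<kappa> \<kappa>' x *v h))) (at (coord \<kappa> x))"
    by (rule has_derivative_compose[OF transition_derivative[OF assms(1,2,4,5)]])
      (use transition_derivative[OF assms(2,3,5,6)] cinv_coord assms in simp)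
  then have "((\<lambda>y. coord \<kappa>'' (cinv \<kappa> y)) has_derivative (\<lambda>h. jac \<kappa>' \<kappa>'' x *v (jac \<kappa> \<kappa>' x *v h))) (at (coord \<kappa> x))"
    by (rule has_derivative_transform_within_open[OF _ U])
      (use assms cinv_coord in \<open>auto simp: U_def\<close>)
  from has_derivative_unique[OF this transition_derivative[OF assms(1,3,4,6)]]
  show ?thesis by (simp add: matrix_eq fun_eq_iff flip: matrix_vector_mul_assoc)
qed

lemma jac_self:
  assumes "\<kappa> \<in> A" "x \<in> cdom \<kappa>"
  shows "jac \<kappa> \<kappa> x = mat 1"
proof -
  have "((\<lambda>y. coord \<kappa> (cinv \<kappa> y)) has_derivative (\<lambda>h. h)) (at (coord \<kappa> x))"
    by (rule has_derivative_transform_within_open[OF has_derivative_ident chart_open(2)[OF assms(1)]])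
      (use assms coord_cinv in auto)
  from has_derivative_unique[OF this transition_derivative[OF assms(1,1,2,2)]]
  show ?thesis by (simp add: matrix_eq fun_eq_iff)
qed

lemma jac_inverse:
  assumes "\<kappa> \<in> A" "\<kappa>' \<in> A" "x \<in> cdom \<kappa>" "x \<in> cdom \<kappa>'"
  shows "jac \<kappa>' \<kappa> x *v (jac \<kappa> \<kappa>' x *v v) = v"
proof -
  have "jac \<kappa>' \<kappa> x ** jac \<kappa> \<kappa>' x = mat 1"
    using jac_comp[OF assms(1,2,1,3,4,3)] jac_self[OF assms(1,3)] by (rule trans[OF sym])
  then show ?thesis by (simp add: matrix_vector_mul_assoc)
qed

text \<open>\<open>Upsilon\<close> is the covector d log \<Omega>, so the chain rule lets it
  transform by the transposed Jacobian.\<close>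

lemma Upsilon_change:
  assumes "\<kappa> \<in> A" "\<kappa>' \<in> A" "x \<in> cdom \<kappa>" "x \<in> cdom \<kappa>'" and \<Omega>: "msmooth A UNIV \<Omega>"
  shows "Upsilon \<Omega> \<kappa>' x = transpose (jac \<kappa>' \<kappa> x) *v Upsilon \<Omega> \<kappa> x"
proof -
  have sm: "smooth_on (coord \<kappa>'' ` cdom \<kappa>'') (\<Omega> \<circ> cinv \<kappa>'')" if "\<kappa>'' \<in> A" for \<kappa>''
    using \<Omega> that unfolding msmooth_def by force
  define U where "U = coord \<kappa>' ` (cdom \<kappa> \<inter> cdom \<kappa>')"
  have U: "open U" "coord \<kappa>' x \<in> U" unfolding U_def using assms by (auto intro!: coord_image_open chart_open)
  have d: "((\<Omega> \<circ> cinv \<kappa>) has_derivative frechet_derivative (\<Omega> \<circ> cinv \<kappa>) (at (coord \<kappa> x))) (at (coord \<kappa> x))"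
    by (rule smooth_on_has_derivative[OF sm]) (use assms in auto)
  have "pd a (\<Omega> \<circ> cinv \<kappa>') (coord \<kappa>' x) = (\<Sum>b\<in>UNIV. jac \<kappa>' \<kappa> x $ b $ a * pd b (\<Omega> \<circ> cinv \<kappa>) (coord \<kappa> x))" for a
  proof -
    have c: "coord \<kappa> (cinv \<kappa>' (coord \<kappa>' x)) = coord \<kappa> x" using assms cinv_coord by simp
    have h1: "((\<lambda>y. (\<Omega> \<circ> cinv \<kappa>) (coord \<kappa> (cinv \<kappa>' y))) has_derivative
        (\<lambda>h. frechet_derivative (\<Omega> \<circ> cinv \<kappa>) (at (coord \<kappa> x)) (jac \<kappa>' \<kappa> x *v h))) (at (coord \<kappa>' x))"
      by (rule has_derivative_compose[OF transition_derivative[OF assms(2,1,4,3)]]) (unfold c, rule d)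
    then have "((\<Omega> \<circ> cinv \<kappa>') has_derivative
        (\<lambda>h. frechet_derivative (\<Omega> \<circ> cinv \<kappa>) (at (coord \<kappa> x)) (jac \<kappa>' \<kappa> x *v h))) (at (coord \<kappa>' x))"
      by (rule has_derivative_transform_within_open[OF _ U])
        (use assms cinv_coord in \<open>auto simp: U_def\<close>)
    from pd_eq(2)[OF this, of a]
    have "pd a (\<Omega> \<circ> cinv \<kappa>') (coord \<kappa>' x) = pd a (\<lambda>y. (\<Omega> \<circ> cinv \<kappa>) (coord \<kappa> (cinv \<kappa>' y))) (coord \<kappa>' x)"
      using pd_eq(2)[OF h1, of a] by simp
    also have "\<dots> = (\<Sum>b\<in>UNIV. matrix ((*v) (jac \<kappa>' \<kappa> x)) $ b $ a *\<^sub>R pd b (\<Omega> \<circ> cinv \<kappa>) (coord \<kappa> (cinv \<kappa>' (coord \<kappa>' x))))"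
      by (rule pd_chain[OF _ transition_derivative[OF assms(2,1,4,3)]]) (unfold c, rule d)
    finally show ?thesis by (simp only: c matrix_of_matrix_vector_mul real_scaleR_def)
  qed
  then show ?thesis
    unfolding Upsilon_def matrix_vector_mult_def transpose_def by (simp add: vec_eq_iff sum_divide_distrib)
qed

section \<open>Rescalings\<close>

lemma msmooth_const: "msmooth A UNIV (\<lambda>x. r)"
  unfolding msmooth_def o_def by (auto intro!: smooth_on_const chart_open)

lemma msmooth_mult: "msmooth A UNIV f \<Longrightarrow> msmooth A UNIV h \<Longrightarrow> msmooth A UNIV (\<lambda>x. f x * h x :: real)"
  unfolding msmooth_def o_def by (auto intro!: smooth_on_mult chart_open)

lemma rescaling_refl: "rescaling A (\<lambda>x. 1) g g"
  by (simp add: rescaling_def msmooth_const)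

lemma rescaling_trans: "rescaling A \<Omega> g g' \<Longrightarrow> rescaling A \<Omega>' g' g'' \<Longrightarrow> rescaling A (\<lambda>x. \<Omega> x * \<Omega>' x) g g''"
  unfolding rescaling_def by (auto simp: msmooth_mult power_mult_distrib mult.commute)

lemma rescaling_exists: "g \<in> c \<Longrightarrow> g' \<in> c \<Longrightarrow> \<exists>\<Omega>. rescaling A \<Omega> g g'"
  using conf unfolding conformal_class_def by blast

text \<open>The metric is nonzero, so the square of the factor is determined, and positivity fixes
  the sign. This makes the choice of a factor in \<open>extend\<close> harmless.\<close>

lemma rescaling_unique:
  assumes "g \<in> c" "rescaling A \<Omega> g g'" "rescaling A \<Omega>' g g'"
  shows "\<Omega> = \<Omega>'"
proof
  fix x
  obtain \<kappa> where k: "\<kappa> \<in> A" "x \<in> cdom \<kappa>" using chart_exists by blast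
  have "g' \<kappa> (coord \<kappa> x) = (\<Omega> x)\<^sup>2 *\<^sub>R g \<kappa> (coord \<kappa> x)" "g' \<kappa> (coord \<kappa> x) = (\<Omega>' x)\<^sup>2 *\<^sub>R g \<kappa> (coord \<kappa> x)"
    using assms(2,3) k unfolding rescaling_def by blast+
  then have "(\<Omega> x)\<^sup>2 *\<^sub>R g \<kappa> (coord \<kappa> x) = (\<Omega>' x)\<^sup>2 *\<^sub>R g \<kappa> (coord \<kappa> x)" by (rule trans[OF sym])
  moreover have "g \<kappa> (coord \<kappa> x) \<noteq> 0"
    using metric_pos[OF k(1) assms(1) imageI[OF k(2)], of "axis undefined 1"] by (auto simp: axis_eq_0_iff)
  ultimately have "(\<Omega> x)\<^sup>2 = (\<Omega>' x)\<^sup>2" by simp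
  moreover have "\<Omega> x > 0" "\<Omega>' x > 0" using assms unfolding rescaling_def by auto
  ultimately show "\<Omega> x = \<Omega>' x" by (simp add: power2_eq_iff)
qed

text \<open>A logarithmic derivative turns products into sums.\<close>

lemma Upsilon_mult:
  assumes "\<kappa> \<in> A" "x \<in> cdom \<kappa>" "msmooth A UNIV \<Omega>" "msmooth A UNIV \<Omega>'" "\<Omega> x \<noteq> 0" "\<Omega>' x \<noteq> 0"
  shows "Upsilon (\<lambda>x. \<Omega> x * \<Omega>' x) \<kappa> x = Upsilon \<Omega> \<kappa> x + Upsilon \<Omega>' \<kappa> x"
proof -
  let ?y = "coord \<kappa> x"
  have sm: "smooth_on (coord \<kappa> ` cdom \<kappa>) (\<Omega> \<circ> cinv \<kappa>)" "smooth_on (coord \<kappa> ` cdom \<kappa>) (\<Omega>' \<circ> cinv \<kappa>)"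
    using assms unfolding msmooth_def by force+
  have y: "?y \<in> coord \<kappa> ` cdom \<kappa>" using assms by auto
  note d = smooth_on_has_derivative[OF sm(1) y] smooth_on_has_derivative[OF sm(2) y]
  have m: "((\<lambda>x. \<Omega> x * \<Omega>' x) \<circ> cinv \<kappa>) = (\<lambda>z. (\<Omega> \<circ> cinv \<kappa>) z * (\<Omega>' \<circ> cinv \<kappa>) z)" by (simp add: fun_eq_iff)
  have "pd a ((\<lambda>x. \<Omega> x * \<Omega>' x) \<circ> cinv \<kappa>) ?y = \<Omega> x * pd a (\<Omega>' \<circ> cinv \<kappa>) ?y + pd a (\<Omega> \<circ> cinv \<kappa>) ?y * \<Omega>' x" for a
    unfolding m using pd_eq(2)[OF has_derivative_mult[OF d], of a] pd_eq(2)[OF d(1), of a] pd_eq(2)[OF d(2), of a]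
      cinv_coord[OF assms(1,2)] by simp
  then show ?thesis using assms(5,6) by (simp add: Upsilon_def vec_eq_iff field_simps)
qed

section \<open>Changes of gauge\<close>

lemma change_gauge_linear: "linear (change_gauge \<Omega> \<kappa> g \<kappa>' x)"
  unfolding change_gauge_def Let_def
  by (rule linearI; rule tvec_eqI)
    (auto simp: algebra_simps inner_add_right add_divide_distrib diff_divide_distrib matrix_vector_right_distrib matrix_vector_mult_scaleR)

lemma change_gauge_parts:
  "change_gauge \<Omega> \<kappa> g \<kappa>' x v $ Top = \<Omega> x * v $ Top"
  "mid (change_gauge \<Omega> \<kappa> g \<kappa>' x v) = \<Omega> x *\<^sub>R (transpose (jac \<kappa>' \<kappa> x) *v (mid v + v $ Top *\<^sub>R Upsilon \<Omega> \<kappa> x))"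
  "change_gauge \<Omega> \<kappa> g \<kappa>' x v $ Bot = (v $ Bot - Upsilon \<Omega> \<kappa> x \<bullet> (ginv (\<kappa>, g) x *v mid v)
     - (1/2) * (Upsilon \<Omega> \<kappa> x \<bullet> (ginv (\<kappa>, g) x *v Upsilon \<Omega> \<kappa> x)) * v $ Top) / \<Omega> x"
  by (simp_all add: change_gauge_def Let_def ginv_def)

text \<open>The transposed Jacobian pulls covectors back, so the inverse metrics agree up to the
  conformal factor to the power -2.\<close>

lemma ginv_change:
  assumes "\<kappa> \<in> A" "\<kappa>' \<in> A" "g \<in> c" "g' \<in> c" "x \<in> cdom \<kappa>" "x \<in> cdom \<kappa>'" "rescaling A \<Omega> g g'"
  shows "(transpose (jac \<kappa>' \<kappa> x) *v a) \<bullet> (ginv (\<kappa>', g') x *v (transpose (jac \<kappa>' \<kappa> x) *v b)) =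
    (a \<bullet> (ginv (\<kappa>, g) x *v b)) / (\<Omega> x)\<^sup>2"
proof -
  have \<Omega>: "\<Omega> x > 0" "g' \<kappa> (coord \<kappa> x) = (\<Omega> x)\<^sup>2 *\<^sub>R g \<kappa> (coord \<kappa> x)"
    using assms unfolding rescaling_def by auto
  define u where "u = ginv (\<kappa>, g) x *v b"
  \<comment> \<open>The vector that \<open>g'\<close> in the new chart lowers to the transported
    covector: \<open>u\<close> pushed forward and divided by the square of the factor.\<close>
  define w where "w = (1 / (\<Omega> x)\<^sup>2) *\<^sub>R (jac \<kappa> \<kappa>' x *v u)"
  have "g' \<kappa>' (coord \<kappa>' x) *v w = transpose (jac \<kappa>' \<kappa> x) *v (g' \<kappa> (coord \<kappa> x) *v (jac \<kappa>' \<kappa> x *v w))"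
    using metric_change[OF assms(2,4,1,6,5)] by (simp add: matrix_vector_mul_assoc matrix_mul_assoc)
  also have "jac \<kappa>' \<kappa> x *v w = (1 / (\<Omega> x)\<^sup>2) *\<^sub>R u"
    by (simp add: w_def matrix_vector_mult_scaleR jac_inverse[OF assms(1,2,5,6)])
  also have "g' \<kappa> (coord \<kappa> x) *v ((1 / (\<Omega> x)\<^sup>2) *\<^sub>R u) = b"
    using \<Omega> by (simp add: matrix_vector_mult_scaleR u_def ginv_right[OF assms(1,3,5)] flip: scaleR_matrix_vector_assoc)
  finally have "ginv (\<kappa>', g') x *v (transpose (jac \<kappa>' \<kappa> x) *v b) = w"
    using ginv_left[OF assms(2,4,6), of w] by simp
  then show ?thesis
    by (simp add: w_def inner_matrix_adjoint jac_inverse[OF assms(1,2,5,6)] u_def del: transpose_matrix_vector)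
qed

text \<open>The cocycle condition that makes tractors at a point consistent. The covectors add up;
  in the last slot the pairing of the second covector with the first supplies the mixed term in the
  square of their sum.\<close>

lemma change_gauge_comp:
  assumes "\<kappa> \<in> A" "\<kappa>' \<in> A" "\<kappa>'' \<in> A" "g \<in> c" "g' \<in> c" "x \<in> cdom \<kappa>" "x \<in> cdom \<kappa>'" "x \<in> cdom \<kappa>''"
    and r: "rescaling A \<Omega> g g'" "rescaling A \<Omega>' g' g''"
  shows "change_gauge \<Omega>' \<kappa>' g' \<kappa>'' x (change_gauge \<Omega> \<kappa> g \<kappa>' x v) = change_gauge (\<lambda>x. \<Omega> x * \<Omega>' x) \<kappa> g \<kappa>'' x v"
proof -
  define Y where "Y = Upsilon \<Omega> \<kappa> x"
  define Y' where "Y' = Upsilon \<Omega>' \<kappa> x"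
  define J where "J = transpose (jac \<kappa>' \<kappa> x)"
  have sm: "msmooth A UNIV \<Omega>" "msmooth A UNIV \<Omega>'" and p: "\<Omega> x > 0" "\<Omega>' x > 0"
    using r by (auto simp: rescaling_def)
  have U: "Upsilon (\<lambda>x. \<Omega> x * \<Omega>' x) \<kappa> x = Y + Y'"
    unfolding Y_def Y'_def using p by (intro Upsilon_mult assms sm) auto
  have U': "Upsilon \<Omega>' \<kappa>' x = J *v Y'"
    unfolding J_def Y'_def by (rule Upsilon_change[OF assms(1,2,6,7) sm(2)])
  have J: "transpose (jac \<kappa>'' \<kappa> x) = transpose (jac \<kappa>'' \<kappa>' x) ** J"
    unfolding J_def using jac_comp[of \<kappa>'' \<kappa>' \<kappa> x] assms by (simp add: matrix_transpose_mul)
  note gc = ginv_change[OF assms(1,2,4,5,6,7) r(1), folded J_def]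
  have sy: "Y' \<bullet> (ginv (\<kappa>, g) x *v Y) = Y \<bullet> (ginv (\<kappa>, g) x *v Y')" by (rule ginv_inner[OF assms(1,4,6)])
  show ?thesis
  proof (rule tvec_eqI)
    show "mid (change_gauge \<Omega>' \<kappa>' g' \<kappa>'' x (change_gauge \<Omega> \<kappa> g \<kappa>' x v)) =
        mid (change_gauge (\<lambda>x. \<Omega> x * \<Omega>' x) \<kappa> g \<kappa>'' x v)"
      unfolding change_gauge_parts U U' Y_def[symmetric] J_def[symmetric] J
      by (simp add: algebra_simps matrix_vector_right_distrib matrix_vector_mult_scaleR flip: matrix_vector_mul_assoc)
    show "change_gauge \<Omega>' \<kappa>' g' \<kappa>'' x (change_gauge \<Omega> \<kappa> g \<kappa>' x v) $ Bot =
        change_gauge (\<lambda>x. \<Omega> x * \<Omega>' x) \<kappa> g \<kappa>'' x v $ Bot"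
      unfolding change_gauge_parts U U' Y_def[symmetric] J_def[symmetric]
      using p by (simp add: matrix_vector_mult_scaleR gc matrix_vector_right_distrib inner_add_left inner_add_right sy field_simps power2_eq_square)
  qed (simp add: change_gauge_parts)
qed

lemma change_gauge_id:
  assumes "\<kappa> \<in> A" "x \<in> cdom \<kappa>"
  shows "change_gauge (\<lambda>x. 1) \<kappa> g \<kappa> x v = v"
proof -
  have "pd a (\<lambda>z. 1 :: real) y = 0" for a and y :: "real^'n"
    using pd_eq(2)[OF has_derivative_const[of "1::real" "at y"], of a] by simp
  then have "Upsilon (\<lambda>x. 1) \<kappa> x = 0" by (simp add: Upsilon_def vec_eq_iff o_def)
  then show ?thesis by (intro tvec_eqI) (simp_all add: change_gauge_parts jac_self[OF assms] transpose_mat)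
qed

lemma tmetric_eq: "tmetric \<gamma> x v w = v $ Top * w $ Bot + v $ Bot * w $ Top + mid v \<bullet> (ginv \<gamma> x *v mid w)"
  by (cases \<gamma>) (simp add: tmetric_def ginv_def)

lemma tmetric_change_gauge:
  assumes "\<kappa> \<in> A" "\<kappa>' \<in> A" "g \<in> c" "g' \<in> c" "x \<in> cdom \<kappa>" "x \<in> cdom \<kappa>'" "rescaling A \<Omega> g g'"
  shows "tmetric (\<kappa>', g') x (change_gauge \<Omega> \<kappa> g \<kappa>' x v) (change_gauge \<Omega> \<kappa> g \<kappa>' x w) = tmetric (\<kappa>, g) x v w"
proof -
  define Y where "Y = Upsilon \<Omega> \<kappa> x"
  have p: "\<Omega> x > 0" using assms by (auto simp: rescaling_def)
  define J where "J = transpose (jac \<kappa>' \<kappa> x)"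
  note gc = ginv_change[OF assms, folded J_def]
  have sy: "mid v \<bullet> (ginv (\<kappa>, g) x *v Y) = Y \<bullet> (ginv (\<kappa>, g) x *v mid v)" by (rule ginv_inner[OF assms(1,3,5)])
  show ?thesis
    unfolding tmetric_eq change_gauge_parts Y_def[symmetric] J_def[symmetric]
    using p by (simp add: matrix_vector_mult_scaleR gc power2_eq_square)
      (simp add: matrix_vector_mult_scaleR matrix_vector_right_distrib inner_add_left inner_add_right sy field_simps)
qed

text \<open>The translation by Y is the square of the translation by half of Y, so its determinant
  is positive. The other factors are a dilation of determinant 1 and the middle block, a positive
  multiple of a transposed Jacobian with positive determinant.\<close>

lemma det_change_gauge:
  assumes "\<kappa> \<in> A" "\<kappa>' \<in> A" "g \<in> c" "x \<in> cdom \<kappa>" "x \<in> cdom \<kappa>'" "\<Omega> x > 0"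
  shows "det (matrix (change_gauge \<Omega> \<kappa> g \<kappa>' x)) > 0"
proof -
  define Gi where "Gi = ginv (\<kappa>, g) x"
  define f where "f Y v = tvec (v $ Top) (mid v + v $ Top *\<^sub>R Y) (v $ Bot - Y \<bullet> (Gi *v mid v) - (1/2) * (Y \<bullet> (Gi *v Y)) * v $ Top)" for Y v
  have lin: "linear (f Y)" for Y unfolding f_def
    by (rule linearI; rule tvec_eqI) (auto simp: algebra_simps inner_add_right matrix_vector_right_distrib matrix_vector_mult_scaleR)
  define U where "U Y = matrix (f Y)" for Y
  have U: "U Y *v v = f Y v" for Y v unfolding U_def by (rule matrix_linear_works[OF lin])
  have sy: "Y \<bullet> (Gi *v Z) = Z \<bullet> (Gi *v Y)" for Y Z unfolding Gi_def by (rule ginv_inner[OF assms(1,3,4)])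
  have add: "U Y ** U Z = U (Y + Z)" for Y Z
  proof (rule matrix_eq[THEN iffD2], rule allI)
    fix v
    show "(U Y ** U Z) *v v = U (Y + Z) *v v"
      unfolding matrix_vector_mul_assoc[symmetric] U f_def
      by (rule tvec_eqI) (auto simp: algebra_simps inner_add_right inner_add_left matrix_vector_right_distrib matrix_vector_mult_scaleR sy[of Z Y])
  qed
  have U0: "U 0 = mat 1" by (rule matrix_eq[THEN iffD2]) (auto simp: U f_def)
  define Y where "Y = Upsilon \<Omega> \<kappa> x"
  have "U Y = U ((1/2) *\<^sub>R Y) ** U ((1/2) *\<^sub>R Y)" unfolding add by (simp flip: scaleR_left.add)
  then have "det (U Y) = (det (U ((1/2) *\<^sub>R Y)))\<^sup>2" by (simp add: det_mul power2_eq_square)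
  moreover have "det (U Y) * det (U (- Y)) = 1" unfolding det_mul[symmetric] add by (simp add: U0)
  then have "det (U Y) \<noteq> 0" by auto
  ultimately have "det (U Y) > 0" by simp
  have "matrix (change_gauge \<Omega> \<kappa> g \<kappa>' x) = scale_mat (\<Omega> x) ** blk (\<Omega> x *\<^sub>R transpose (jac \<kappa>' \<kappa> x)) ** U Y"
  proof (rule matrix_eq[THEN iffD2], rule allI)
    fix v
    show "matrix (change_gauge \<Omega> \<kappa> g \<kappa>' x) *v v = (scale_mat (\<Omega> x) ** blk (\<Omega> x *\<^sub>R transpose (jac \<kappa>' \<kappa> x)) ** U Y) *v v"
      unfolding matrix_vector_mul_assoc[symmetric] U f_def matrix_linear_works[OF change_gauge_linear]
      by (rule tvec_eqI) (simp_all add: change_gauge_parts scale_mat_works blk_works Y_def Gi_def flip: scaleR_matrix_vector_assoc)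
  qed
  moreover have "det (\<Omega> x *\<^sub>R transpose (jac \<kappa>' \<kappa> x)) > 0"
  proof -
    have "\<Omega> x *\<^sub>R transpose (jac \<kappa>' \<kappa> x) = (\<chi> i. \<Omega> x *s (transpose (jac \<kappa>' \<kappa> x) $ i))"
      by (simp add: vec_eq_iff)
    then have "det (\<Omega> x *\<^sub>R transpose (jac \<kappa>' \<kappa> x)) = (\<Prod>i\<in>(UNIV :: 'n set). \<Omega> x) * det (transpose (jac \<kappa>' \<kappa> x))"
      by (simp only: det_rows_mul vec_lambda_eta)
    then show ?thesis using jac_det[of \<kappa>' \<kappa> x] assms by (simp add: det_transpose)
  qed
  ultimately show ?thesis using \<open>det (U Y) > 0\<close> assms(6) by (simp add: det_mul det_blk Ggrp_det scale_mat_Ggrp)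
qed

text \<open>The tractor at \<open>x\<close> with the value \<open>v\<close> in the gauge \<gamma>,
  when this is a gauge at \<open>x\<close>. The factor between two metrics of the class is unique,
  so the choice operator has a single candidate.\<close>

definition extend :: "('m, 'n) gauge \<Rightarrow> 'm \<Rightarrow> real^'n tidx \<Rightarrow> ('m, 'n) tractor" where
  "extend \<gamma> x v = (\<lambda>\<gamma>'. if \<gamma>' \<in> gauges A c x
     then change_gauge (SOME \<Omega>. rescaling A \<Omega> (snd \<gamma>) (snd \<gamma>')) (fst \<gamma>) (snd \<gamma>) (fst \<gamma>') x v else 0)"

lemma extend_eq:
  assumes "(\<kappa>, g) \<in> gauges A c x" "(\<kappa>', g') \<in> gauges A c x" "rescaling A \<Omega> g g'"
  shows "extend (\<kappa>, g) x v (\<kappa>', g') = change_gauge \<Omega> \<kappa> g \<kappa>' x v"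
proof -
  have "(SOME \<Omega>. rescaling A \<Omega> g g') = \<Omega>"
    using assms by (intro some_equality) (auto simp: gauges_def intro: rescaling_unique)
  then show ?thesis using assms(2) by (simp add: extend_def)
qed

lemma extend_self: "(\<kappa>, g) \<in> gauges A c x \<Longrightarrow> extend (\<kappa>, g) x v (\<kappa>, g) = v"
  using extend_eq[OF _ _ rescaling_refl, of \<kappa> g x \<kappa> v] change_gauge_id[of \<kappa> x] by (auto simp: gauges_def)

lemma extend_tractors:
  assumes "(\<kappa>, g) \<in> gauges A c x"
  shows "extend (\<kappa>, g) x v \<in> tractors A c x"
  unfolding tractors_def
proof (intro CollectI conjI allI impI)
  fix \<kappa>1 g1 \<kappa>2 g2 \<Omega>
  assume *: "(\<kappa>1, g1) \<in> gauges A c x \<and> (\<kappa>2, g2) \<in> gauges A c x \<and> rescaling A \<Omega> g1 g2"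
  obtain \<Omega>1 where 1: "rescaling A \<Omega>1 g g1" using rescaling_exists * assms by (auto simp: gauges_def)
  show "extend (\<kappa>, g) x v (\<kappa>2, g2) = change_gauge \<Omega> \<kappa>1 g1 \<kappa>2 x (extend (\<kappa>, g) x v (\<kappa>1, g1))"
    using extend_eq[OF assms _ 1, of \<kappa>1 v] extend_eq[OF assms _ rescaling_trans[OF 1], of \<kappa>2 g2 \<Omega> v] *
      change_gauge_comp[OF _ _ _ _ _ _ _ _ 1, of \<kappa> \<kappa>1 \<kappa>2 x \<Omega> g2 v] assms by (auto simp: gauges_def)
qed (auto simp: extend_def)

lemma tractors_change:
  "T \<in> tractors A c x \<Longrightarrow> (\<kappa>, g) \<in> gauges A c x \<Longrightarrow> (\<kappa>', g') \<in> gauges A c x \<Longrightarrow> rescaling A \<Omega> g g' \<Longrightarrow>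
    T (\<kappa>', g') = change_gauge \<Omega> \<kappa> g \<kappa>' x (T (\<kappa>, g))"
  unfolding tractors_def by blast

lemma tractors_off: "T \<in> tractors A c x \<Longrightarrow> \<gamma> \<notin> gauges A c x \<Longrightarrow> T \<gamma> = 0"
  unfolding tractors_def by blast

lemma tractors_eqI:
  assumes "T \<in> tractors A c x" "T' \<in> tractors A c x" "\<gamma> \<in> gauges A c x" "T \<gamma> = T' \<gamma>"
  shows "T = T'"
proof
  fix \<gamma>' :: "('m, 'n) gauge"
  obtain \<kappa> g where g1: "\<gamma> = (\<kappa>, g)" by (cases \<gamma>)
  obtain \<kappa>' g' where g2: "\<gamma>' = (\<kappa>', g')" by (cases \<gamma>')
  note g = g1 g2
  show "T \<gamma>' = T' \<gamma>'"
  proof (cases "\<gamma>' \<in> gauges A c x")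
    case True
    then obtain \<Omega> where "rescaling A \<Omega> g g'" using rescaling_exists assms(3) g by (auto simp: gauges_def)
    then show ?thesis
      using tractors_change[OF assms(1)] tractors_change[OF assms(2)] assms(3,4) True unfolding g by simp
  next
    case False
    then show ?thesis using tractors_off[OF assms(1)] tractors_off[OF assms(2)] by simp
  qed
qed

text \<open>Smoothness in the other gauges is the point. There the values are
  \<open>change_gauge\<close> applied to \<open>v\<close> after the coordinate change, and the
  factor, its logarithmic derivative, the Jacobian and the inverse metric are all smooth in the new
  coordinates.\<close>

lemma extend_field:
  assumes k: "\<kappa> \<in> A" and g: "g \<in> c" and v: "smooth_on (coord \<kappa> ` cdom \<kappa>) v"
  shows "tractor_field A c (cdom \<kappa>) (\<lambda>x. extend (\<kappa>, g) x (v (coord \<kappa> x)))"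
  unfolding tractor_field_def
proof (intro conjI ballI)
  show "extend (\<kappa>, g) x (v (coord \<kappa> x)) \<in> tractors A c x" if "x \<in> cdom \<kappa>" for x
    using assms that by (intro extend_tractors) (auto simp: gauges_def)
  fix \<kappa>' g' assume k': "\<kappa>' \<in> A" and g': "g' \<in> c"
  obtain \<Omega> where r: "rescaling A \<Omega> g g'" using rescaling_exists[OF g g'] by blast
  define U where "U = coord \<kappa>' ` (cdom \<kappa> \<inter> cdom \<kappa>')"
  define T where "T y = coord \<kappa> (cinv \<kappa>' y)" for y
  define \<omega> where "\<omega> y = \<Omega> (cinv \<kappa>' y)" for y
  define Y where "Y y = Upsilon \<Omega> \<kappa> (cinv \<kappa>' y)" for y
  have U: "open U" unfolding U_def by (intro coord_image_open k' chart_open k)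
  have Uc: "cinv \<kappa>' y \<in> cdom \<kappa>" "cinv \<kappa>' y \<in> cdom \<kappa>'" "coord \<kappa>' (cinv \<kappa>' y) = y" if "y \<in> U" for y
    using that k' by (auto simp: U_def cinv_coord)
  have T: "smooth_on U T" unfolding U_def T_def by (rule transition_smooth[OF k' k])
  have TU: "T ` U \<subseteq> coord \<kappa> ` cdom \<kappa>" using Uc by (auto simp: T_def)
  note comp = smooth_on_compose[OF U chart_open(2)[OF k] _ T TU]
  have sm: "msmooth A UNIV \<Omega>" and pos: "\<Omega> x > 0" for x using r by (auto simp: rescaling_def)
  have \<omega>: "smooth_on U \<omega>"
  proof -
    have "smooth_on (coord \<kappa>' ` (UNIV \<inter> cdom \<kappa>')) (\<Omega> \<circ> cinv \<kappa>')"
      by (rule bspec[OF sm[unfolded msmooth_def] k'])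
    then have "smooth_on U (\<Omega> \<circ> cinv \<kappa>')" by (rule smooth_on_subset) (auto simp: U_def)
    then show ?thesis unfolding \<omega>_def o_def .
  qed
  have \<omega>0: "\<omega> y \<noteq> 0" for y using pos[of "cinv \<kappa>' y"] by (simp add: \<omega>_def)
  have Y: "smooth_on U Y"
  proof -
    have "smooth_on (coord \<kappa> ` cdom \<kappa>) (\<Omega> \<circ> cinv \<kappa>)" using sm k unfolding msmooth_def by force
    then have "smooth_on U (\<lambda>y. pd a (\<Omega> \<circ> cinv \<kappa>) (T y))" for a
      by (intro comp smooth_on_pd chart_open k)
    then have "smooth_on U (\<lambda>y. \<chi> a. pd a (\<Omega> \<circ> cinv \<kappa>) (T y) / \<omega> y)"
      by (intro smooth_on_vec_lambda smooth_on_divide U \<omega> \<omega>0)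
    then show ?thesis unfolding Y_def Upsilon_def T_def \<omega>_def .
  qed
  have J: "smooth_on U (\<lambda>y. jac \<kappa>' \<kappa> (cinv \<kappa>' y))"
  proof -
    have "smooth_on U (\<lambda>y. \<chi> i j. frechet_derivative T (at y) (axis j 1) $ i)"
      by (intro smooth_on_vec_lambda smooth_on_nth smooth_on_frechet[OF T] U) (simp add: axis_in_Basis_iff)
    then show ?thesis
      by (rule smooth_on_eqI[OF U]) (simp add: jac_def Uc matrix_def o_def T_def[abs_def])
  qed
  have Gi: "smooth_on U (\<lambda>y. matrix_inv (g \<kappa> (T y)))"
    by (rule comp[OF metric_inv_smooth[OF k g]])
  have vT: "smooth_on U (\<lambda>y. v (T y))" by (rule comp[OF v])
  have "smooth_on U (\<lambda>y. tvec (\<omega> y * v (T y) $ Top)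
      (\<omega> y *\<^sub>R (transpose (jac \<kappa>' \<kappa> (cinv \<kappa>' y)) *v (mid (v (T y)) + v (T y) $ Top *\<^sub>R Y y)))
      ((v (T y) $ Bot - Y y \<bullet> (matrix_inv (g \<kappa> (T y)) *v mid (v (T y))) -
        (1/2) * (Y y \<bullet> (matrix_inv (g \<kappa> (T y)) *v Y y)) * v (T y) $ Top) / \<omega> y))"
    by (intro smooth_on_tvec smooth_on_divide smooth_intros smooth_on_mid U \<omega> \<omega>0 Y J Gi vT)
  then have "smooth_on U (\<lambda>y. change_gauge \<Omega> \<kappa> g \<kappa>' (cinv \<kappa>' y) (v (T y)))"
    unfolding change_gauge_def Let_def \<omega>_def Y_def T_def .
  then show "smooth_on (coord \<kappa>' ` (cdom \<kappa> \<inter> cdom \<kappa>')) (\<lambda>y. extend (\<kappa>, g) (cinv \<kappa>' y) (v (coord \<kappa> (cinv \<kappa>' y))) (\<kappa>', g'))"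
    unfolding U_def[symmetric] T_def[symmetric]
    by (rule smooth_on_eqI[OF U]) (use k k' g g' Uc in \<open>auto intro!: extend_eq r simp: gauges_def\<close>)
qed

end


section \<open>Moving frames\<close>

lemma smooth_on_blk: "open U \<Longrightarrow> smooth_on U E \<Longrightarrow> smooth_on U (\<lambda>y. blk (E y))"
proof (intro smooth_on_vec)
  assume U: "open U" "smooth_on U E"
  show "smooth_on U (\<lambda>y. blk (E y) $ i $ j)" for i j
    unfolding blk_def
    by (cases i; cases j) (auto intro: smooth_on_const U smooth_on_nth[OF U(1) smooth_on_nth[OF U]])
qed

lemma transpose_sandwich: "(transpose S ** M ** S) $ i $ l = (\<Sum>r\<in>UNIV. \<Sum>s\<in>UNIV. S $ r $ i * M $ r $ s * S $ s $ l)"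
  for S M :: "real^'n^'n"
proof -
  have "(transpose S ** M ** S) $ i $ l = (\<Sum>s\<in>UNIV. \<Sum>r\<in>UNIV. S $ r $ i * M $ r $ s * S $ s $ l)"
    by (simp add: matrix_matrix_mult_def transpose_def sum_distrib_right)
  then show ?thesis by (subst sum.swap)
qed

text \<open>One Gram-Schmidt step: the matrix below differs from the identity only in row \<open>j\<close>. It normalises the
  \<open>j\<close>-th basis vector and subtracts from the others their components along it.\<close>

definition gs_row :: "real^'n^'n \<Rightarrow> 'n \<Rightarrow> real^('n::finite)" where
  "gs_row M j = (\<chi> i. if i = j then 1 / sqrt (M $ j $ j) else - M $ j $ i / M $ j $ j)"

definition gs_step :: "real^'n^'n \<Rightarrow> 'n \<Rightarrow> real^'n^('n::finite)" where
  "gs_step M j = (\<chi> r i. if r = j then gs_row M j $ i else if r = i then 1 else 0)"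

lemma det_gs_step: "det (gs_step M j) = 1 / sqrt (M $ j $ j)" for M :: "real^'n^('n::finite)"
proof -
  \<comment> \<open>Transposed, the step is the identity with one column replaced, the shape that
    Cramer's lemma evaluates.\<close>
  have "transpose (gs_step M j) = (\<chi> i r. if r = j then (mat 1 *v gs_row M j) $ i else mat 1 $ i $ r)"
    by (simp add: vec_eq_iff transpose_def gs_step_def) (auto simp: mat_def)
  then have "det (transpose (gs_step M j)) = gs_row M j $ j * det (mat 1 :: real^'n^'n)"
    by (simp only: cramer_lemma)
  then show ?thesis by (simp add: gs_row_def)
qed

text \<open>Off row and column \<open>j\<close> the new Gram matrix is the Schur complement of the
  pivot, as every other vector has lost its component along vector \<open>j\<close>.\<close>

lemma gs_step_sandwich:
  fixes M :: "real^'n^'n"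
  assumes sym: "\<And>i l. M $ i $ l = M $ l $ i" and pos: "M $ j $ j > 0"
  shows "(transpose (gs_step M j) ** M ** gs_step M j) $ i $ l =
    (if i = j \<or> l = j then if i = l then 1 else 0 else M $ i $ l - M $ j $ i * M $ j $ l / M $ j $ j)"
proof -
  define b where "b = gs_row M j"
  define e where "e i r = (if r = j then 0 else if r = i then 1 else 0 :: real)" for i r :: 'n
  have S: "gs_step M j $ r $ i = e i r + (if r = j then b $ i else 0)" for r i
    by (simp add: gs_step_def b_def e_def)
  have es: "(\<Sum>r\<in>UNIV. e i r * f r) = (if i = j then 0 else f i)" for i and f :: "'n \<Rightarrow> real"
  proof -
    have "(\<Sum>r\<in>UNIV. e i r * f r) = (\<Sum>r\<in>UNIV. if r = i then (if i = j then 0 else f i) else 0)"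
      by (intro sum.cong) (auto simp: e_def)
    then show ?thesis by simp
  qed
  have "(\<Sum>s\<in>UNIV. M $ r $ s * gs_step M j $ s $ l) = (if l = j then 0 else M $ r $ l) + M $ r $ j * b $ l" for r
  proof -
    have "(\<Sum>s\<in>UNIV. M $ r $ s * gs_step M j $ s $ l) = (\<Sum>s\<in>UNIV. e l s * M $ r $ s) + (\<Sum>s\<in>UNIV. if s = j then M $ r $ j * b $ l else 0)"
      unfolding S sum.distrib[symmetric] by (intro sum.cong) (auto simp: algebra_simps)
    then show ?thesis by (simp add: es)
  qed
  then have "(transpose (gs_step M j) ** M ** gs_step M j) $ i $ l =
      (\<Sum>r\<in>UNIV. gs_step M j $ r $ i * ((if l = j then 0 else M $ r $ l) + M $ r $ j * b $ l))"
    unfolding transpose_sandwich mult.assoc by (simp flip: sum_distrib_left)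
  also have "\<dots> = (\<Sum>r\<in>UNIV. e i r * ((if l = j then 0 else M $ r $ l) + M $ r $ j * b $ l))
      + (\<Sum>r\<in>UNIV. if r = j then b $ i * ((if l = j then 0 else M $ j $ l) + M $ j $ j * b $ l) else 0)"
    unfolding S sum.distrib[symmetric] by (intro sum.cong) (auto simp: algebra_simps)
  also have "\<dots> = (if i = j then 0 else ((if l = j then 0 else M $ i $ l) + M $ i $ j * b $ l))
      + b $ i * ((if l = j then 0 else M $ j $ l) + M $ j $ j * b $ l)"
    by (simp add: es)
  also have "\<dots> = (if i = j \<or> l = j then if i = l then 1 else 0 else M $ i $ l - M $ j $ i * M $ j $ l / M $ j $ j)"
    using pos sym[of i j] by (auto simp: b_def gs_row_def field_simps)
  finally show ?thesis .
qed

text \<open>Gram-Schmidt with the point as a parameter: each step uses only square roots of and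
  divisions by positive smooth functions. The induction runs over the set \<open>J\<close> of
  indices already treated, as the index type carries no order.\<close>

lemma smooth_orthonormalisation:
  fixes M :: "'a::euclidean_space \<Rightarrow> real^'n^('n::finite)"
  assumes D: "open D" "smooth_on D M" and sym: "\<And>y. y \<in> D \<Longrightarrow> transpose (M y) = M y"
    and pos: "\<And>y v. y \<in> D \<Longrightarrow> v \<noteq> 0 \<Longrightarrow> v \<bullet> (M y *v v) > 0"
  obtains E where "smooth_on D E" "\<And>y. y \<in> D \<Longrightarrow> det (E y) > 0"
    "\<And>y. y \<in> D \<Longrightarrow> transpose (E y) ** M y ** E y = mat 1"
proof -
  have "\<exists>E. smooth_on D E \<and> (\<forall>y\<in>D. det (E y) > 0 \<and>
      (\<forall>i\<in>J. \<forall>l. (transpose (E y) ** M y ** E y) $ i $ l = (if i = l then 1 else 0)))" for J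
    using finite[of J]
  proof (induction J rule: finite_induct)
    case empty
    show ?case by (rule exI[of _ "\<lambda>y. mat 1"]) (auto intro: smooth_on_const D)
  next
    case (insert j J)
    then obtain E where E: "smooth_on D E" "\<And>y. y \<in> D \<Longrightarrow> det (E y) > 0"
      "\<And>y i l. y \<in> D \<Longrightarrow> i \<in> J \<Longrightarrow> (transpose (E y) ** M y ** E y) $ i $ l = (if i = l then 1 else 0)" by blast
    define K where "K y = transpose (E y) ** M y ** E y" for y
    have Ksym: "K y $ i $ l = K y $ l $ i" if "y \<in> D" for y i l
    proof -
      have "transpose (K y) = K y" unfolding K_def by (simp add: matrix_transpose_mul sym[OF that] matrix_mul_assoc)
      then show ?thesis by (metis transpose_def vec_lambda_beta)
    qed
    have Kpos: "K y $ j $ j > 0" if "y \<in> D" for y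
    proof -
      have ne: "E y *v axis j 1 \<noteq> 0"
      proof
        assume "E y *v axis j 1 = 0"
        then have "matrix_inv (E y) *v (E y *v axis j 1) = 0" by simp
        then show False using matrix_inv_inverts(2)[of "E y"] E(2)[OF that]
          by (simp add: matrix_vector_mul_assoc axis_eq_0_iff)
      qed
      have "K y $ j $ j = axis j 1 \<bullet> (K y *v axis j 1)"
        by (simp add: inner_axis' matrix_vector_mult_basis column_def)
      also have "\<dots> = (E y *v axis j 1) \<bullet> (M y *v (E y *v axis j 1))"
        by (simp add: K_def inner_matrix_adjoint matrix_vector_mul_assoc matrix_mul_assoc del: transpose_matrix_vector)
      finally show ?thesis using pos[OF that ne] by simp
    qed
    have Ksm: "smooth_on D K" unfolding K_def by (intro smooth_intros D E)
    define E' where "E' y = E y ** gs_step (K y) j" for y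
    have "smooth_on D (\<lambda>y. gs_row (K y) j $ i)" for i
      by (cases "i = j") (auto simp: gs_row_def less_imp_neq[OF Kpos, symmetric] intro!: smooth_on_divide smooth_on_sqrt smooth_on_minus smooth_on_const smooth_on_nth D Ksm Kpos)
    then have "smooth_on D (\<lambda>y. gs_step (K y) j $ r $ i)" for r i
      by (cases "r = j"; cases "r = i") (simp_all add: gs_step_def smooth_on_const D)
    then have "smooth_on D (\<lambda>y. gs_step (K y) j)" by (intro smooth_on_vec D)
    then have "smooth_on D E'" unfolding E'_def by (intro smooth_intros D E)
    moreover have "det (E' y) > 0" if "y \<in> D" for y
      using E(2)[OF that] Kpos[OF that] by (simp add: E'_def det_mul det_gs_step)
    moreover have "(transpose (E' y) ** M y ** E' y) $ i $ l = (if i = l then 1 else 0)"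
      if y: "y \<in> D" and i: "i \<in> insert j J" for y i l
    proof -
      have "transpose (E' y) ** M y ** E' y = transpose (gs_step (K y) j) ** K y ** gs_step (K y) j"
        by (simp add: E'_def K_def matrix_transpose_mul matrix_mul_assoc)
      \<comment> \<open>For \<open>i\<close> already treated the entry of \<open>K y\<close> at
        \<open>(j, i)\<close> is 0, so the correction made by the step vanishes and row
        \<open>i\<close> is preserved.\<close>
      then show ?thesis
        using gs_step_sandwich[OF Ksym[OF y] Kpos[OF y], of i l] i E(3)[OF y] Ksym[OF y, of j i]
        by (auto simp flip: K_def)
    qed
    ultimately show ?case by blast
  qed
  from this[of UNIV] obtain E where E: "smooth_on D E" "\<And>y. y \<in> D \<Longrightarrow> det (E y) > 0"
    "\<And>y i l. y \<in> D \<Longrightarrow> (transpose (E y) ** M y ** E y) $ i $ l = (if i = l then 1 else 0)" by blast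
  show ?thesis
    by (rule that[OF E(1,2)]) (simp_all add: vec_eq_iff mat_def E(3))
qed

lemma matrix_inv_unique: "q ** p = mat 1 \<Longrightarrow> matrix_inv q = p" for q p :: "real^'n^'n"
proof -
  assume qp: "q ** p = mat 1"
  have "det q * det p = 1" using qp by (metis det_mul det_I)
  then have "det q \<noteq> 0" by auto
  have "matrix_inv q = matrix_inv q ** (q ** p)" by (simp add: qp)
  also have "\<dots> = p" by (simp add: matrix_mul_assoc matrix_inv_inverts[OF \<open>det q \<noteq> 0\<close>])
  finally show ?thesis .
qed

context conformal_manifold begin

text \<open>\<open>frames\<close> imposes its conditions in every gauge, but changes of gauge
  preserve the tractor metric, the sign of the determinant and the positive ray, so checking one
  gauge is enough.\<close>

lemma extend_frame:
  assumes g: "(\<kappa>, g) \<in> gauges A c x" and F: "\<And>v w. tmetric (\<kappa>, g) x (F *v v) (F *v w) = hform v w"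
    "det F > 0" "F *v axis Bot 1 = tvec 0 0 r" "r > 0"
  shows "(\<lambda>v. extend (\<kappa>, g) x (F *v v)) \<in> frames A c x"
  unfolding frames_def
proof (intro CollectI conjI allI ballI)
  show "extend (\<kappa>, g) x (F *v v) \<in> tractors A c x" for v by (rule extend_tractors[OF g])
  fix \<gamma> assume \<gamma>: "\<gamma> \<in> gauges A c x"
  obtain \<kappa>' g' where gg: "\<gamma> = (\<kappa>', g')" by (cases \<gamma>)
  have k: "\<kappa> \<in> A" "\<kappa>' \<in> A" "g \<in> c" "g' \<in> c" "x \<in> cdom \<kappa>" "x \<in> cdom \<kappa>'"
    using g \<gamma> by (auto simp: gauges_def gg)
  obtain \<Omega> where r: "rescaling A \<Omega> g g'" using rescaling_exists k by blast
  have e: "extend (\<kappa>, g) x v \<gamma> = change_gauge \<Omega> \<kappa> g \<kappa>' x v" for v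
    unfolding gg by (rule extend_eq[OF g \<gamma>[unfolded gg] r])
  have \<Omega>: "\<Omega> x > 0" using r by (auto simp: rescaling_def)
  show lin: "linear (\<lambda>v. extend (\<kappa>, g) x (F *v v) \<gamma>)"
    unfolding e using linear_compose[OF matrix_vector_mul_linear[of F] change_gauge_linear] by (simp add: o_def)
  show "tmetric \<gamma> x (extend (\<kappa>, g) x (F *v v) \<gamma>) (extend (\<kappa>, g) x (F *v w) \<gamma>) = hform v w" for v w
    unfolding e unfolding gg by (simp add: tmetric_change_gauge[OF k r] F)
  have "frame_mat \<gamma> (\<lambda>v. extend (\<kappa>, g) x (F *v v)) = matrix (change_gauge \<Omega> \<kappa> g \<kappa>' x) ** F"
    unfolding frame_mat_def by (rule matrix_eq[THEN iffD2])
      (auto simp: matrix_linear_works[OF lin[unfolded e]] matrix_linear_works[OF change_gauge_linear] e simp flip: matrix_vector_mul_assoc)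
  then show "det (frame_mat \<gamma> (\<lambda>v. extend (\<kappa>, g) x (F *v v))) > 0"
    using det_change_gauge[where \<Omega> = \<Omega> and x = x, OF k(1,2,3,5,6) \<Omega>] F(2) by (simp add: det_mul)
  have "change_gauge \<Omega> \<kappa> g \<kappa>' x (tvec 0 0 r) = tvec 0 0 (r / \<Omega> x)"
    by (rule tvec_eqI) (simp_all add: change_gauge_parts)
  then show "\<exists>r>0. extend (\<kappa>, g) x (F *v axis Bot 1) \<gamma> = tvec 0 0 r"
    unfolding e F(3) using F(4) \<Omega> by (intro exI[of _ "r / \<Omega> x"]) simp
qed

text \<open>The middle slot holds covectors, so it is the inverse metric that is orthonormalised;
  the outer slots already pair as in \<open>hform\<close> and stay as they are.\<close>

lemma moving_frame:
  assumes k: "\<kappa> \<in> A" and g: "g \<in> c"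
  obtains F u where "smooth_on (coord \<kappa> ` cdom \<kappa>) F" "frame_field A c (cdom \<kappa>) u"
    "\<And>x v. x \<in> cdom \<kappa> \<Longrightarrow> u x v (\<kappa>, g) = F (coord \<kappa> x) *v v"
proof -
  let ?D = "coord \<kappa> ` cdom \<kappa>"
  have "\<exists>E. smooth_on ?D E \<and> (\<forall>y\<in>?D. det (E y) > 0 \<and> transpose (E y) ** matrix_inv (g \<kappa> y) ** E y = mat 1)"
  proof -
    have Gi: "matrix_inv (g \<kappa> y) = ginv (\<kappa>, g) (cinv \<kappa> y)" "cinv \<kappa> y \<in> cdom \<kappa>" if "y \<in> ?D" for y
      using that coord_cinv[OF k] cinv_cdom[OF k] by (auto simp: ginv_def)
    have sym: "transpose (matrix_inv (g \<kappa> y)) = matrix_inv (g \<kappa> y)" if y: "y \<in> ?D" for y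
    proof (rule matrix_eq[THEN iffD2], rule allI, rule vector_eq_ldot[THEN iffD1], rule allI)
      fix v z :: "real^'n"
      have "z \<bullet> (transpose (matrix_inv (g \<kappa> y)) *v v) = (matrix_inv (g \<kappa> y) *v z) \<bullet> v"
        by (rule inner_matrix_adjoint[symmetric])
      also have "\<dots> = z \<bullet> (matrix_inv (g \<kappa> y) *v v)"
        unfolding Gi(1)[OF y] by (metis ginv_inner[OF k g Gi(2)[OF y]] inner_commute)
      finally show "z \<bullet> (transpose (matrix_inv (g \<kappa> y)) *v v) = z \<bullet> (matrix_inv (g \<kappa> y) *v v)" .
    qed
    obtain E where "smooth_on ?D E" "\<And>y. y \<in> ?D \<Longrightarrow> det (E y) > 0"
      "\<And>y. y \<in> ?D \<Longrightarrow> transpose (E y) ** matrix_inv (g \<kappa> y) ** E y = mat 1"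
      by (rule smooth_orthonormalisation[OF chart_open(2)[OF k] metric_inv_smooth[OF k g] sym])
        (auto simp: Gi(1) intro: ginv_pos[OF k g Gi(2)])
    then show ?thesis by blast
  qed
  then obtain E where E: "smooth_on ?D E" "\<And>y. y \<in> ?D \<Longrightarrow> det (E y) > 0"
    "\<And>y. y \<in> ?D \<Longrightarrow> transpose (E y) ** matrix_inv (g \<kappa> y) ** E y = mat 1" by blast
  define F where "F y = blk (E y)" for y
  define u where "u x = (\<lambda>v. extend (\<kappa>, g) x (F (coord \<kappa> x) *v v))" for x
  have Fsm: "smooth_on ?D F" unfolding F_def by (intro smooth_on_blk chart_open k E)
  have gau: "(\<kappa>, g) \<in> gauges A c x" if "x \<in> cdom \<kappa>" for x using k g that by (simp add: gauges_def)
  have "u x \<in> frames A c x" if x: "x \<in> cdom \<kappa>" for x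
    unfolding u_def
  proof (rule extend_frame[OF gau[OF x]])
    have y: "coord \<kappa> x \<in> ?D" using x by simp
    have "(E (coord \<kappa> x) *v a) \<bullet> (ginv (\<kappa>, g) x *v (E (coord \<kappa> x) *v b)) = a \<bullet> b" for a b
    proof -
      have "(E (coord \<kappa> x) *v a) \<bullet> (ginv (\<kappa>, g) x *v (E (coord \<kappa> x) *v b)) =
          a \<bullet> ((transpose (E (coord \<kappa> x)) ** matrix_inv (g \<kappa> (coord \<kappa> x)) ** E (coord \<kappa> x)) *v b)"
        by (simp only: inner_matrix_adjoint ginv_def fst_conv snd_conv matrix_vector_mul_assoc matrix_mul_assoc)
      then show ?thesis by (simp add: E(3)[OF y])
    qed
    then show "tmetric (\<kappa>, g) x (F (coord \<kappa> x) *v v) (F (coord \<kappa> x) *v w) = hform v w" for v w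
      by (simp add: tmetric_eq F_def blk_works hform_def)
    show "det (F (coord \<kappa> x)) > 0" using E(2)[OF y] by (simp add: F_def det_blk)
    show "F (coord \<kappa> x) *v axis Bot 1 = tvec 0 0 1" by (simp add: F_def blk_works axis_tidx)
  qed simp
  moreover have "tractor_field A c (cdom \<kappa>) (\<lambda>x. u x v)" for v
    unfolding u_def by (rule extend_field[OF k g]) (intro smooth_on_matrix_vector_mult chart_open k Fsm smooth_on_const)
  ultimately have "frame_field A c (cdom \<kappa>) u"
    using chart_open(1)[OF k] by (simp add: frame_field_def)
  moreover have "u x v (\<kappa>, g) = F (coord \<kappa> x) *v v" if "x \<in> cdom \<kappa>" for x v
    unfolding u_def by (rule extend_self[OF gau[OF that]])
  ultimately show ?thesis using that Fsm by blast
qed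

section \<open>Frames at a point and their transitions\<close>

lemma frames_nonempty: "\<exists>u. u \<in> frames A c x"
proof -
  obtain \<kappa> where k: "\<kappa> \<in> A" "x \<in> cdom \<kappa>" using chart_exists by blast
  obtain g where g: "g \<in> c" using conf unfolding conformal_class_def by blast
  show ?thesis using k by (rule_tac moving_frame[OF k(1) g]) (auto simp: frame_field_def)
qed

lemma
  assumes "u \<in> frames A c x" "\<gamma> \<in> gauges A c x"
  shows frame_mat_works: "frame_mat \<gamma> u *v v = u v \<gamma>"
    and frame_mat_hform: "tmetric \<gamma> x (frame_mat \<gamma> u *v v) (frame_mat \<gamma> u *v w) = hform v w"
    and frame_mat_det: "det (frame_mat \<gamma> u) > 0"
    and frame_mat_Bot: "\<exists>r>0. frame_mat \<gamma> u *v axis Bot 1 = tvec 0 0 r"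
    and frame_tractors: "u v \<in> tractors A c x"
proof -
  have f: "(\<forall>v. u v \<in> tractors A c x)" "linear (\<lambda>v. u v \<gamma>)" "\<forall>v w. tmetric \<gamma> x (u v \<gamma>) (u w \<gamma>) = hform v w"
    "det (frame_mat \<gamma> u) > 0" "\<exists>r>0. u (axis Bot 1) \<gamma> = tvec 0 0 r"
    using assms unfolding frames_def by blast+
  show 1: "frame_mat \<gamma> u *v v = u v \<gamma>" for v unfolding frame_mat_def by (rule matrix_linear_works[OF f(2)])
  show "tmetric \<gamma> x (frame_mat \<gamma> u *v v) (frame_mat \<gamma> u *v w) = hform v w"
    "det (frame_mat \<gamma> u) > 0" "\<exists>r>0. frame_mat \<gamma> u *v axis Bot 1 = tvec 0 0 r" "u v \<in> tractors A c x"
    using f by (simp_all add: 1)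
qed

text \<open>The transition matrix is an isometry of positive determinant that preserves the ray;
  \<open>ray_stabiliser_Ggrp\<close> places it in the identity component.\<close>

lemma frame_transition_Ggrp:
  assumes u: "u \<in> frames A c x" "u' \<in> frames A c x" and \<gamma>: "\<gamma> \<in> gauges A c x"
  defines "p \<equiv> matrix_inv (frame_mat \<gamma> u) ** frame_mat \<gamma> u'"
  shows "p \<in> Pgrp"
proof -
  let ?F = "frame_mat \<gamma> u" and ?F' = "frame_mat \<gamma> u'"
  have d: "det ?F > 0" "det ?F' > 0" using frame_mat_det assms by auto
  note inv = matrix_inv_inverts[OF less_imp_neq[OF d(1), symmetric]]
  have Fp: "?F *v (p *v v) = ?F' *v v" for v
    by (simp add: p_def matrix_vector_mul_assoc matrix_mul_assoc inv)
  have O: "p \<in> O_h"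
  proof (rule O_hI)
    fix v w
    have "hform (p *v v) (p *v w) = tmetric \<gamma> x (?F *v (p *v v)) (?F *v (p *v w))"
      by (rule frame_mat_hform[OF u(1) \<gamma>, symmetric])
    also have "\<dots> = hform v w" unfolding Fp by (rule frame_mat_hform[OF u(2) \<gamma>])
    finally show "hform (p *v v) (p *v w) = hform v w" .
  qed
  have "det ?F * det p = det ?F'"
    unfolding p_def det_mul[symmetric] by (simp add: matrix_mul_assoc inv)
  then have dp: "det p > 0" using d by (metis zero_less_mult_pos)
  obtain r r' where r: "r > 0" "?F *v axis Bot 1 = tvec 0 0 r" "r' > 0" "?F' *v axis Bot 1 = tvec 0 0 r'"
    using frame_mat_Bot u \<gamma> by metis
  have "p *v axis Bot 1 = (r' / r) *\<^sub>R axis Bot 1"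
  proof -
    have "?F *v ((r' / r) *\<^sub>R axis Bot 1) = ?F' *v axis Bot 1"
      using r by (simp add: matrix_vector_mult_scaleR) (rule tvec_eqI; simp)
    then have "p *v axis Bot 1 = matrix_inv ?F *v (?F *v ((r' / r) *\<^sub>R axis Bot 1))"
      by (simp add: p_def matrix_vector_mul_assoc)
    then show ?thesis unfolding matrix_vector_mul_assoc inv by simp
  qed
  with r have e: "\<exists>r>0. p *v axis Bot 1 = r *\<^sub>R axis Bot 1" by (intro exI[of _ "r' / r"]) simp
  then have "p \<in> Ggrp" using ray_stabiliser_Ggrp[OF O dp] by blast
  then show ?thesis using e by (simp add: Pgrp_def)
qed

text \<open>Both directions are provided: \<open>q\<close> acts on frames, as in the equivariance of
  sections, and its inverse \<open>p\<close> acts on components, as for arrays. One pair serves all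
  gauges.\<close>

lemma frame_transition:
  assumes u: "u \<in> frames A c x" "u' \<in> frames A c x"
  obtains p q where "p \<in> Ggrp" "q \<in> Pgrp" "u = frame_act u' q" "matrix_inv q = p"
    "\<And>\<gamma>. \<gamma> \<in> gauges A c x \<Longrightarrow> frame_mat \<gamma> u' = frame_mat \<gamma> u ** p"
proof -
  obtain \<kappa> where k: "\<kappa> \<in> A" "x \<in> cdom \<kappa>" using chart_exists by blast
  obtain g where g: "g \<in> c" using conf unfolding conformal_class_def by blast
  define \<gamma> where "\<gamma> = (\<kappa>, g)"
  have \<gamma>: "\<gamma> \<in> gauges A c x" using k g by (simp add: gauges_def \<gamma>_def)
  let ?F = "frame_mat \<gamma> u" and ?F' = "frame_mat \<gamma> u'"
  have d: "det ?F \<noteq> 0" "det ?F' \<noteq> 0" using frame_mat_det[OF u(1) \<gamma>] frame_mat_det[OF u(2) \<gamma>] by auto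
  define p where "p = matrix_inv ?F ** ?F'"
  define q where "q = matrix_inv ?F' ** ?F"
  have "q ** p = matrix_inv ?F' ** (?F ** matrix_inv ?F) ** ?F'" by (simp add: p_def q_def matrix_mul_assoc)
  then have "q ** p = mat 1" by (simp add: matrix_inv_inverts[OF d(1)] matrix_inv_inverts[OF d(2)])
  have ueq: "w v = w' (s *v v)" if w: "w \<in> frames A c x" "w' \<in> frames A c x"
    and s: "s = matrix_inv (frame_mat \<gamma> w') ** frame_mat \<gamma> w" for w w' s v
  proof (rule tractors_eqI[OF frame_tractors[OF w(1) \<gamma>] frame_tractors[OF w(2) \<gamma>] \<gamma>])
    have "det (frame_mat \<gamma> w') \<noteq> 0" using frame_mat_det[OF w(2) \<gamma>] by simp
    then have "frame_mat \<gamma> w *v v = frame_mat \<gamma> w' *v (s *v v)"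
      unfolding s by (simp add: matrix_vector_mul_assoc matrix_mul_assoc matrix_inv_inverts)
    then show "w v \<gamma> = w' (s *v v) \<gamma>" by (simp add: frame_mat_works[OF w(1) \<gamma>] frame_mat_works[OF w(2) \<gamma>])
  qed
  show ?thesis
  proof (rule that[of p q])
    show "p \<in> Ggrp" using frame_transition_Ggrp[OF u \<gamma>] by (simp add: p_def Pgrp_def)
    show "q \<in> Pgrp" using frame_transition_Ggrp[OF u(2,1) \<gamma>] by (simp add: q_def)
    show "u = frame_act u' q" unfolding frame_act_def by (rule ext) (rule ueq[OF u q_def])
    show "matrix_inv q = p" by (rule matrix_inv_unique) fact
    show "frame_mat \<gamma>' u' = frame_mat \<gamma>' u ** p" if "\<gamma>' \<in> gauges A c x" for \<gamma>'
      by (rule matrix_eq[THEN iffD2])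
        (simp add: frame_mat_works[OF u(1) that] frame_mat_works[OF u(2) that] ueq[OF u(2,1) p_def] flip: matrix_vector_mul_assoc)
  qed
qed

end


section \<open>The tractor connection\<close>

lemma bounded_bilinear_matrix_vector_mult: "bounded_bilinear ((*v) :: real^'n^'m \<Rightarrow> real^'n \<Rightarrow> real^'m)"
proof -
  have "bilinear ((*v) :: real^'n^'m \<Rightarrow> real^'n \<Rightarrow> real^'m)"
    unfolding bilinear_def
    by (auto intro!: linearI simp: matrix_vector_mult_add_rdistrib matrix_vector_right_distrib
        matrix_vector_mult_scaleR scaleR_matrix_vector_assoc)
  then show ?thesis by (simp add: bilinear_conv_bounded_bilinear)
qed

lemmas has_vector_derivative_matrix_vector_mult =
  bounded_bilinear.has_vector_derivative[OF bounded_bilinear_matrix_vector_mult]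

lemma has_vector_derivative_nth:
  "(f has_vector_derivative f') F \<Longrightarrow> ((\<lambda>t. f t $ i) has_vector_derivative f' $ i) F"
  by (rule bounded_linear.has_vector_derivative[OF bounded_linear_vec_nth])

lemma bounded_linear_mid: "bounded_linear mid"
  by (simp add: linear_conv_bounded_linear[symmetric] linearI)

lemma has_vector_derivative_mid:
  "(f has_vector_derivative f') F \<Longrightarrow> ((\<lambda>t. mid (f t)) has_vector_derivative mid f') F"
  by (rule bounded_linear.has_vector_derivative[OF bounded_linear_mid])

lemma pd_cong:
  assumes "open U" "y \<in> U" "smooth_on U f" "\<And>z. z \<in> U \<Longrightarrow> f z = h z"
  shows "pd a f y = pd a h y"
proof -
  have "(h has_derivative frechet_derivative f (at y)) (at y)"
    by (rule has_derivative_transform_within_open[OF smooth_on_has_derivative[OF assms(3,2)] assms(1,2,4)])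
  from pd_eq(2)[OF this] pd_eq(2)[OF smooth_on_has_derivative[OF assms(3,2)]] show ?thesis by simp
qed

lemma pd_nth: "smooth_on U f \<Longrightarrow> y \<in> U \<Longrightarrow> pd a (\<lambda>z. f z $ i) y = pd a f y $ i"
  using pd_eq(2)[OF bounded_linear.has_derivative[OF bounded_linear_vec_nth smooth_on_has_derivative], of U f y a i]
    pd_eq(2)[OF smooth_on_has_derivative, of U f y a] by simp

lemma symmetric_matrix_nth: "transpose M = M \<Longrightarrow> M $ i $ j = M $ j $ i"
  by (simp add: transpose_def vec_eq_iff)

text \<open>The part of the connection without derivatives, split off so that covariant derivatives
  make sense for a curve of component vectors and not only for a tractor field.\<close>

definition conn_matrix :: "(real^'n \<Rightarrow> real^'n^'n) \<Rightarrow> real^'n \<Rightarrow> 'n \<Rightarrow> real^('n::finite) tidx \<Rightarrow> real^'n tidx" where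
  "conn_matrix G y a v = tvec (- v $ Mid a)
     (\<chi> b. - (\<Sum>e\<in>UNIV. christoffel G y e a b * v $ Mid e) + schouten G y a b * v $ Top + G y $ a $ b * v $ Bot)
     (- (\<Sum>b\<in>UNIV. schouten G y a b * (matrix_inv (G y) *v mid v) $ b))"

lemma tnabla_eq:
  "tnabla (\<kappa>, g) T a x = pd a (\<lambda>z. T (cinv \<kappa> z) (\<kappa>, g)) (coord \<kappa> x) + conn_matrix (g \<kappa>) (coord \<kappa> x) a (T x (\<kappa>, g))"
  unfolding tnabla_def conn_matrix_def Let_def
  by (rule tvec_eqI) (simp_all add: vec_eq_iff mid_nth)

lemma linear_conn_matrix: "linear (conn_matrix G y a)"
  unfolding conn_matrix_def
  by (rule linearI; rule tvec_eqI)
    (simp_all add: vec_eq_iff algebra_simps sum.distrib sum_distrib_left sum_negf matrix_vector_right_distrib matrix_vector_mult_scaleR)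

context conformal_manifold begin

text \<open>Lowering the index cancels the inverse metric and leaves the Christoffel symbols of the
  first kind.\<close>

lemma christoffel_lowered:
  assumes "\<kappa> \<in> A" "g \<in> c" "y \<in> coord \<kappa> ` cdom \<kappa>"
  shows "(\<Sum>e\<in>UNIV. g \<kappa> y $ f $ e * christoffel (g \<kappa>) y e a b) =
    (1/2) * (pd a (g \<kappa>) y $ b $ f + pd b (g \<kappa>) y $ a $ f - pd f (g \<kappa>) y $ a $ b)"
proof -
  let ?D = "coord \<kappa> ` cdom \<kappa>"
  note D = chart_open(2)[OF assms(1)]
  note sm = metric_smooth[OF assms(1,2)]
  define X where "X = (\<chi> e. pd a (g \<kappa>) y $ b $ e + pd b (g \<kappa>) y $ a $ e - pd e (g \<kappa>) y $ a $ b)"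
  have ch: "christoffel (g \<kappa>) y e a b = (1/2) * (matrix_inv (g \<kappa> y) *v X) $ e" for e
    unfolding christoffel_def X_def matrix_vector_mult_def
    by (simp add: pd_nth[OF smooth_on_nth[OF D sm] assms(3)] pd_nth[OF sm assms(3)])
  have "(\<Sum>e\<in>UNIV. g \<kappa> y $ f $ e * christoffel (g \<kappa>) y e a b) = (\<Sum>e\<in>UNIV. (1/2) * (g \<kappa> y $ f $ e * (matrix_inv (g \<kappa> y) *v X) $ e))"
    unfolding ch by (intro sum.cong) auto
  also have "\<dots> = (1/2) * (g \<kappa> y *v (matrix_inv (g \<kappa> y) *v X)) $ f"
    by (simp only: matrix_vector_mult_def[of "g \<kappa> y"] sum_distrib_left[symmetric] vec_lambda_beta)
  also have "g \<kappa> y *v (matrix_inv (g \<kappa> y) *v X) = X"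
    by (simp add: matrix_vector_mul_assoc matrix_inv_inverts[OF metric_det[OF assms]])
  finally show ?thesis by (simp add: X_def)
qed

lemma pd_metric_sym:
  assumes "\<kappa> \<in> A" "g \<in> c" "y \<in> coord \<kappa> ` cdom \<kappa>"
  shows "pd a (g \<kappa>) y $ b $ e = pd a (g \<kappa>) y $ e $ b"
proof -
  let ?D = "coord \<kappa> ` cdom \<kappa>"
  note D = chart_open(2)[OF assms(1)]
  note sm = metric_smooth[OF assms(1,2)]
  have "g \<kappa> z $ b $ e = g \<kappa> z $ e $ b" if "z \<in> ?D" for z
    by (rule symmetric_matrix_nth[OF metric_sym[OF assms(1,2) that]])
  then have "pd a (\<lambda>z. g \<kappa> z $ b $ e) y = pd a (\<lambda>z. g \<kappa> z $ e $ b) y"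
    by (intro pd_cong[OF D assms(3)] smooth_on_nth D sm)
  then show ?thesis by (simp add: pd_nth[OF smooth_on_nth[OF D sm] assms(3)] pd_nth[OF sm assms(3)])
qed

text \<open>The metric is parallel for the Levi-Civita connection, here in terms of the covectors
  dual to \<open>p\<close> and \<open>q\<close>: the lowered symbols \<open>L\<close>, symmetrised,
  give the derivative of the metric.\<close>

lemma christoffel_compatible:
  fixes p q :: "real^'n" and a :: 'n
  assumes "\<kappa> \<in> A" "g \<in> c" "y \<in> coord \<kappa> ` cdom \<kappa>"
  defines "\<Gamma> \<equiv> \<lambda>m. \<chi> b. \<Sum>e\<in>UNIV. christoffel (g \<kappa>) y e a b * m $ e"
  shows "\<Gamma> (g \<kappa> y *v p) \<bullet> q + p \<bullet> \<Gamma> (g \<kappa> y *v q) = p \<bullet> (pd a (g \<kappa>) y *v q)"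
proof -
  define L where "L f b = (\<Sum>e\<in>UNIV. g \<kappa> y $ f $ e * christoffel (g \<kappa>) y e a b)" for f b
  have gs: "g \<kappa> y $ e $ f = g \<kappa> y $ f $ e" for e f
    by (rule symmetric_matrix_nth[OF metric_sym[OF assms(1-3)]])
  have \<Gamma>: "\<Gamma> (g \<kappa> y *v r) $ b = (\<Sum>f\<in>UNIV. L f b * r $ f)" for r b
  proof -
    have "\<Gamma> (g \<kappa> y *v r) $ b = (\<Sum>e\<in>UNIV. \<Sum>f\<in>UNIV. g \<kappa> y $ f $ e * christoffel (g \<kappa>) y e a b * r $ f)"
      by (simp add: \<Gamma>_def matrix_vector_mult_def sum_distrib_left gs[of _ f for f] mult_ac)
    then show ?thesis unfolding L_def sum_distrib_right by (subst sum.swap)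
  qed
  have LL: "L f b + L b f = pd a (g \<kappa>) y $ f $ b" for f b
    unfolding L_def christoffel_lowered[OF assms(1-3)]
    using pd_metric_sym[OF assms(1-3), of a b f] pd_metric_sym[OF assms(1-3), of b a f] pd_metric_sym[OF assms(1-3), of f a b]
    by (simp add: field_simps)
  have "\<Gamma> (g \<kappa> y *v p) \<bullet> q + p \<bullet> \<Gamma> (g \<kappa> y *v q) =
      (\<Sum>b\<in>UNIV. \<Sum>f\<in>UNIV. L f b * p $ f * q $ b) + (\<Sum>f\<in>UNIV. \<Sum>b\<in>UNIV. L b f * p $ f * q $ b)"
    by (simp add: inner_vec_def \<Gamma> sum_distrib_left sum_distrib_right mult_ac)
  also have "(\<Sum>b\<in>UNIV. \<Sum>f\<in>UNIV. L f b * p $ f * q $ b) = (\<Sum>f\<in>UNIV. \<Sum>b\<in>UNIV. L f b * p $ f * q $ b)"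
    by (rule sum.swap)
  also have "\<dots> + (\<Sum>f\<in>UNIV. \<Sum>b\<in>UNIV. L b f * p $ f * q $ b) = (\<Sum>f\<in>UNIV. \<Sum>b\<in>UNIV. (L f b + L b f) * p $ f * q $ b)"
    by (simp add: sum.distrib algebra_simps)
  also have "\<dots> = p \<bullet> (pd a (g \<kappa>) y *v q)"
    unfolding LL by (simp add: inner_vec_def matrix_vector_mult_def sum_distrib_left mult_ac)
  finally show ?thesis .
qed

text \<open>The tractor connection is metric: the terms with the Schouten tensor and those with the
  undifferentiated metric cancel between the slots, and compatibility of the Levi-Civita connection
  accounts for the rest. It is stated for curves of components in a fixed gauge, the form in which
  frames and normal vectors are differentiated later.\<close>

lemma tnabla_metric:
  assumes k: "\<kappa> \<in> A" and g: "g \<in> c" and x: "x \<in> cdom \<kappa>"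
    and v: "(v has_vector_derivative v') (at 0)" and w: "(w has_vector_derivative w') (at 0)"
  defines "y \<equiv> coord \<kappa> x"
  shows "((\<lambda>t. tmetric (\<kappa>, g) (cinv \<kappa> (y + t *\<^sub>R axis a 1)) (v t) (w t)) has_real_derivative
     tmetric (\<kappa>, g) x (v' + conn_matrix (g \<kappa>) y a (v 0)) (w 0) +
     tmetric (\<kappa>, g) x (v 0) (w' + conn_matrix (g \<kappa>) y a (w 0))) (at 0)"
proof -
  let ?D = "coord \<kappa> ` cdom \<kappa>"
  have y: "y \<in> ?D" using x by (simp add: y_def)
  note D = chart_open(2)[OF k]
  define G where "G t = g \<kappa> (y + t *\<^sub>R axis a 1)" for t
  define Gi where "Gi t = matrix_inv (g \<kappa> (y + t *\<^sub>R axis a 1))" for t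
  define p where "p t = Gi t *v mid (v t)" for t
  define q where "q t = Gi t *v mid (w t)" for t
  have G': "(G has_vector_derivative pd a (g \<kappa>) y) (at 0)"
    unfolding G_def by (rule smooth_on_pd_derivative[OF metric_smooth[OF k g] y])
  have Gi': "(Gi has_vector_derivative pd a (\<lambda>y. matrix_inv (g \<kappa> y)) y) (at 0)"
    unfolding Gi_def by (rule smooth_on_pd_derivative[OF metric_inv_smooth[OF k g] y])
  have near: "\<forall>\<^sub>F t in nhds 0. y + t *\<^sub>R axis a 1 \<in> ?D"
  proof -
    have "((\<lambda>t. y + t *\<^sub>R axis a 1) \<longlongrightarrow> y + 0 *\<^sub>R axis a 1) (nhds 0)" by (intro tendsto_intros filterlim_ident)
    then show ?thesis using topological_tendstoD[OF _ D] y by simp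
  qed
  have inv: "G t *v (Gi t *v r) = r" if "y + t *\<^sub>R axis a 1 \<in> ?D" for t r
    using matrix_inv_inverts(1)[OF metric_det[OF k g that]] by (simp add: G_def Gi_def matrix_vector_mul_assoc)
  obtain p' where p': "(p has_vector_derivative p') (at 0)"
    unfolding p_def using has_vector_derivative_matrix_vector_mult[OF Gi' has_vector_derivative_mid[OF v]] by blast
  obtain q' where q': "(q has_vector_derivative q') (at 0)"
    unfolding q_def using has_vector_derivative_matrix_vector_mult[OF Gi' has_vector_derivative_mid[OF w]] by blast
  \<comment> \<open>Differentiating a covector as the metric applied to its raised vector keeps the
    derivative of the inverse metric out of the computation.\<close>
  have Gp: "mid u' = G 0 *v r' + pd a (g \<kappa>) y *v r 0"
    if "(r has_vector_derivative r') (at 0)" "(u has_vector_derivative u') (at 0)" "r = (\<lambda>t. Gi t *v mid (u t))" for r r' u u'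
  proof (rule vector_derivative_unique_at)
    show "((\<lambda>t. mid (u t)) has_vector_derivative mid u') (at 0)" by (rule has_vector_derivative_mid[OF that(2)])
    have "((\<lambda>t. G t *v r t) has_vector_derivative G 0 *v r' + pd a (g \<kappa>) y *v r 0) (at 0)"
      by (rule has_vector_derivative_matrix_vector_mult[OF G' that(1)])
    moreover have "\<forall>\<^sub>F t in nhds 0. G t *v r t = mid (u t)"
      using near by eventually_elim (simp add: that(3) inv)
    ultimately show "((\<lambda>t. mid (u t)) has_vector_derivative G 0 *v r' + pd a (g \<kappa>) y *v r 0) (at 0)"
      by (subst (asm) has_vector_derivative_cong_ev) (auto dest: eventually_nhds_x_imp_x)
  qed
  have mv: "mid v' = G 0 *v p' + pd a (g \<kappa>) y *v p 0" by (rule Gp[OF p' v]) (simp add: p_def fun_eq_iff)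
  have mw: "mid w' = G 0 *v q' + pd a (g \<kappa>) y *v q 0" by (rule Gp[OF q' w]) (simp add: q_def fun_eq_iff)
  have G0: "G 0 = g \<kappa> y" by (simp add: G_def)
  have y0: "y + 0 *\<^sub>R axis a 1 \<in> ?D" using y by simp
  have m0: "mid (v 0) = g \<kappa> y *v p 0" "mid (w 0) = g \<kappa> y *v q 0"
    using inv[OF y0] by (simp_all add: p_def q_def G0)
  have gy: "r \<bullet> (g \<kappa> y *v s) = s \<bullet> (g \<kappa> y *v r)" for r s unfolding y_def by (rule metric_inner[OF k g x])
  have dsym: "r \<bullet> (pd a (g \<kappa>) y *v s) = s \<bullet> (pd a (g \<kappa>) y *v r)" for r s
  proof -
    have "transpose (pd a (g \<kappa>) y) = pd a (g \<kappa>) y"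
      by (simp add: transpose_def vec_eq_iff pd_metric_sym[OF k g y, of a])
    then show ?thesis using inner_matrix_adjoint[of "pd a (g \<kappa>) y" r s] by (simp add: inner_commute del: transpose_matrix_vector)
  qed
  have gi: "ginv (\<kappa>, g) x *v mid (v 0) = p 0" "ginv (\<kappa>, g) x *v mid (w 0) = q 0"
    by (simp_all add: ginv_def p_def q_def Gi_def y_def)
  have gil: "r \<bullet> (ginv (\<kappa>, g) x *v mid (w 0)) = r \<bullet> q 0" "mid (v 0) \<bullet> (ginv (\<kappa>, g) x *v r) = p 0 \<bullet> r" for r
    using gi ginv_inner[OF k g x, of "mid (v 0)" r] by (simp_all add: inner_commute)
  define \<Gamma> where "\<Gamma> m = (\<chi> b. \<Sum>e\<in>UNIV. christoffel (g \<kappa>) y e a b * m $ e)" for m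
  have compat: "\<Gamma> (mid (v 0)) \<bullet> q 0 + p 0 \<bullet> \<Gamma> (mid (w 0)) = p 0 \<bullet> (pd a (g \<kappa>) y *v q 0)"
    unfolding m0 \<Gamma>_def by (rule christoffel_compatible[OF k g y])
  define P where "P = (\<chi> b. schouten (g \<kappa>) y a b)"
  have cm: "conn_matrix (g \<kappa>) y a u = tvec (- mid u $ a) (u $ Top *\<^sub>R P + u $ Bot *\<^sub>R (g \<kappa> y $ a) - \<Gamma> (mid u))
      (- (P \<bullet> (ginv (\<kappa>, g) x *v mid u)))" for u
    unfolding conn_matrix_def
    by (rule tvec_eqI) (simp_all add: vec_eq_iff mid_nth \<Gamma>_def P_def inner_vec_def ginv_def y_def mult.commute)
  have row: "(g \<kappa> y $ a) \<bullet> r = (g \<kappa> y *v r) $ a" for r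
    by (simp add: matrix_vector_mult_def inner_vec_def)
  have "((\<lambda>t. v t $ Top * w t $ Bot + v t $ Bot * w t $ Top + mid (v t) \<bullet> q t) has_real_derivative
      (v 0 $ Top * w' $ Bot + v' $ Top * w 0 $ Bot) + (v 0 $ Bot * w' $ Top + v' $ Bot * w 0 $ Top)
      + (mid (v 0) \<bullet> q' + mid v' \<bullet> q 0)) (at 0)"
    unfolding has_real_derivative_iff_has_vector_derivative
    by (intro has_vector_derivative_add bounded_bilinear.has_vector_derivative[OF bounded_bilinear_mult]
        bounded_bilinear.has_vector_derivative[OF bounded_bilinear_inner] has_vector_derivative_nth has_vector_derivative_mid v w q')
  moreover have "\<forall>\<^sub>F t in nhds 0. v t $ Top * w t $ Bot + v t $ Bot * w t $ Top + mid (v t) \<bullet> q t =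
      tmetric (\<kappa>, g) (cinv \<kappa> (y + t *\<^sub>R axis a 1)) (v t) (w t)"
    using near by eventually_elim (simp add: tmetric_eq q_def Gi_def ginv_def coord_cinv[OF k])
  ultimately have "((\<lambda>t. tmetric (\<kappa>, g) (cinv \<kappa> (y + t *\<^sub>R axis a 1)) (v t) (w t)) has_real_derivative
      (v 0 $ Top * w' $ Bot + v' $ Top * w 0 $ Bot) + (v 0 $ Bot * w' $ Top + v' $ Bot * w 0 $ Top)
      + (mid (v 0) \<bullet> q' + mid v' \<bullet> q 0)) (at 0)"
    by (subst (asm) DERIV_cong_ev) auto
  moreover have "(v 0 $ Top * w' $ Bot + v' $ Top * w 0 $ Bot) + (v 0 $ Bot * w' $ Top + v' $ Bot * w 0 $ Top)
      + (mid (v 0) \<bullet> q' + mid v' \<bullet> q 0) =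
     tmetric (\<kappa>, g) x (v' + conn_matrix (g \<kappa>) y a (v 0)) (w 0) +
     tmetric (\<kappa>, g) x (v 0) (w' + conn_matrix (g \<kappa>) y a (w 0))"
  proof -
    have e1: "mid (v 0) \<bullet> q' = p 0 \<bullet> (g \<kappa> y *v q')" unfolding m0 using gy[of q' "p 0"] by (simp add: inner_commute)
    have e2: "p 0 \<bullet> mid w' = p 0 \<bullet> (g \<kappa> y *v q') + p 0 \<bullet> (pd a (g \<kappa>) y *v q 0)"
      unfolding mw G0 by (simp add: inner_add_right)
    have r1: "(g \<kappa> y $ a) \<bullet> q 0 = mid (w 0) $ a" "p 0 \<bullet> (g \<kappa> y $ a) = mid (v 0) $ a"
      using row[of "q 0"] row[of "p 0"] by (simp_all add: m0 inner_commute)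
    show ?thesis
      unfolding tmetric_eq cm tvec_nth vector_add_component mid_simps gil
      using compat e1 e2 r1 by (simp add: inner_add_left inner_add_right inner_diff_left inner_diff_right algebra_simps gi inner_commute)
  qed
  ultimately show ?thesis by (simp only:)
qed

end


section \<open>Normal bundles\<close>

lemma matrix_vector_nth: "(B *v v) $ i = B $ i \<bullet> v"
  by (simp add: matrix_vector_mult_def inner_vec_def)

text \<open>The block matrix is the direct sum of the identity on the indices in \<open>ks\<close>
  and the restriction of \<open>B\<close> to the others, so definiteness is inherited. This is what
  makes \<open>tan_inv\<close> an actual inverse.\<close>

lemma tan_block_pos:
  fixes B :: "real^'n^('n::finite)"
  assumes pos: "\<And>v. v \<noteq> 0 \<Longrightarrow> v \<bullet> (B *v v) > 0" and v: "v \<noteq> 0"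
  shows "v \<bullet> (tan_block ks B *v v) > 0"
proof -
  define vT where "vT = (\<chi> i. if i \<in> set ks then 0 else v $ i)"
  define vN where "vN = (\<chi> i. if i \<in> set ks then v $ i else 0)"
  have "(tan_block ks B *v v) $ i = (if i \<in> set ks then v $ i else (B *v vT) $ i)" for i
    unfolding tan_block_def matrix_vector_mult_def vT_def
    by (auto simp: if_distrib[of "\<lambda>x. x * _"] cong: if_cong intro!: sum.cong)
  then have "v \<bullet> (tan_block ks B *v v) = (\<Sum>i\<in>UNIV. vN $ i * vN $ i + vT $ i * (B *v vT) $ i)"
    unfolding inner_vec_def by (intro sum.cong) (auto simp: vN_def vT_def)
  then have eq: "v \<bullet> (tan_block ks B *v v) = vN \<bullet> vN + vT \<bullet> (B *v vT)"
    by (simp add: inner_vec_def sum.distrib)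
  show ?thesis
  proof (cases "vT = 0")
    case True
    have "v = vN + vT" by (simp add: vec_eq_iff vN_def vT_def)
    then have "vN \<noteq> 0" using True v by auto
    then show ?thesis unfolding eq True by simp
  next
    case False
    then show ?thesis unfolding eq using pos[OF False] inner_ge_zero[of vN] by linarith
  qed
qed

context conformal_manifold begin

lemma christoffel_smooth:
  assumes "\<kappa> \<in> A" "g \<in> c"
  shows "smooth_on (coord \<kappa> ` cdom \<kappa>) (\<lambda>y. christoffel (g \<kappa>) y e a b)"
proof -
  note D = chart_open(2)[OF assms(1)]
  show ?thesis unfolding christoffel_def
    by (intro smooth_on_mult smooth_on_sum smooth_on_diff smooth_on_add smooth_on_const smooth_on_pd smooth_on_nth D
        metric_inv_smooth[OF assms] metric_smooth[OF assms])
qed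

lemma tan_inv_smooth:
  assumes "\<kappa> \<in> A" "g \<in> c"
  shows "smooth_on (coord \<kappa> ` cdom \<kappa>) (\<lambda>y. tan_inv ks (g \<kappa> y))"
  unfolding tan_inv_def
proof (rule smooth_on_matrix_inv[OF chart_open(2)[OF assms(1)]])
  note D = chart_open(2)[OF assms(1)]
  have "smooth_on (coord \<kappa> ` cdom \<kappa>) (\<lambda>y. tan_block ks (g \<kappa> y) $ i $ j)" for i j
    by (cases "i \<in> set ks \<or> j \<in> set ks")
      (auto simp: tan_block_def intro: smooth_on_const smooth_on_nth[OF D smooth_on_nth[OF D metric_smooth[OF assms]]] D)
  then show "smooth_on (coord \<kappa> ` cdom \<kappa>) (\<lambda>y. tan_block ks (g \<kappa> y))" by (intro smooth_on_vec D)
  show "det (tan_block ks (g \<kappa> y)) \<noteq> 0" if "y \<in> coord \<kappa> ` cdom \<kappa>" for y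
    by (rule posdef_det, rule tan_block_pos) (use metric_pos[OF assms that] in auto)
qed

lemma mean_curv_smooth:
  assumes "\<kappa> \<in> A" "g \<in> c"
  shows "smooth_on (coord \<kappa> ` cdom \<kappa>) (\<lambda>y. mean_curv ks (\<kappa>, g) (cinv \<kappa> y))"
proof -
  let ?D = "coord \<kappa> ` cdom \<kappa>"
  note D = chart_open(2)[OF assms(1)]
  have np: "smooth_on ?D (\<lambda>y. normal_part ks (g \<kappa> y) (\<chi> e. christoffel (g \<kappa>) y e i j))" for i j
    unfolding normal_part_def
    by (intro smooth_on_diff smooth_on_sum smooth_on_scaleR smooth_on_mult smooth_on_const smooth_on_nth
        smooth_on_vec_lambda smooth_on_matrix_vector_mult D tan_inv_smooth[OF assms] metric_smooth[OF assms] christoffel_smooth[OF assms])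
  have "smooth_on ?D (\<lambda>y. (1 / real (CARD('n) - length ks)) *\<^sub>R
      (\<Sum>i\<in>- set ks. \<Sum>j\<in>- set ks. tan_inv ks (g \<kappa> y) $ i $ j *\<^sub>R normal_part ks (g \<kappa> y) (\<chi> e. christoffel (g \<kappa>) y e i j)))"
    by (intro smooth_on_scaleR smooth_on_sum smooth_on_const smooth_on_nth D tan_inv_smooth[OF assms] np)
  then show ?thesis
    by (rule smooth_on_eqI[OF D]) (simp add: mean_curv_def second_ff_def coord_cinv[OF assms(1)])
qed

lemma normal_tractor_dual:
  assumes "\<kappa> \<in> A" "g \<in> c" "x \<in> cdom \<kappa>"
  shows "normal_tractor ks (\<kappa>, g) x (matrix_inv (g \<kappa> (coord \<kappa> x)) *v axis k 1) = tvec 0 (axis k 1) (mean_curv ks (\<kappa>, g) x $ k)"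
  using ginv_right[OF assms, of "axis k 1"]
  by (simp add: normal_tractor_def Let_def ginv_def inner_axis')

text \<open>Invertibility of the metric lets covectors that vanish on tangential directions replace
  normal vectors as parameters.\<close>

lemma normal_bundle_iff:
  assumes "\<kappa> \<in> A" "g \<in> c" "x \<in> cdom \<kappa>"
  shows "v \<in> normal_bundle ks (\<kappa>, g) x \<longleftrightarrow>
    v $ Top = 0 \<and> (\<forall>j. j \<notin> set ks \<longrightarrow> v $ Mid j = 0) \<and> v $ Bot = mid v \<bullet> mean_curv ks (\<kappa>, g) x"
proof
  assume "v \<in> normal_bundle ks (\<kappa>, g) x"
  then show "v $ Top = 0 \<and> (\<forall>j. j \<notin> set ks \<longrightarrow> v $ Mid j = 0) \<and> v $ Bot = mid v \<bullet> mean_curv ks (\<kappa>, g) x"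
    by (auto simp: normal_bundle_def normal_tractor_def Let_def)
next
  assume v: "v $ Top = 0 \<and> (\<forall>j. j \<notin> set ks \<longrightarrow> v $ Mid j = 0) \<and> v $ Bot = mid v \<bullet> mean_curv ks (\<kappa>, g) x"
  define n where "n = ginv (\<kappa>, g) x *v mid v"
  have n: "g \<kappa> (coord \<kappa> x) *v n = mid v" unfolding n_def by (rule ginv_right[OF assms])
  have "v = normal_tractor ks (\<kappa>, g) x n"
    using v by (intro tvec_eqI) (simp_all add: normal_tractor_def Let_def n)
  moreover have "\<forall>j. j \<notin> set ks \<longrightarrow> (g \<kappa> (coord \<kappa> x) *v n) $ j = 0" using v by (simp add: n mid_nth)
  ultimately show "v \<in> normal_bundle ks (\<kappa>, g) x" by (auto simp: normal_bundle_def)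
qed

lemma normal_bundle_expand:
  assumes "\<kappa> \<in> A" "g \<in> c" "x \<in> cdom \<kappa>" and v: "v \<in> normal_bundle ks (\<kappa>, g) x" and ks: "distinct ks"
  shows "v = (\<Sum>l<length ks. v $ Mid (ks ! l) *\<^sub>R tvec 0 (axis (ks ! l) 1) (mean_curv ks (\<kappa>, g) x $ (ks ! l)))"
proof -
  note v' = v[unfolded normal_bundle_iff[OF assms(1-3)]]
  have bij: "bij_betw (\<lambda>l. ks ! l) {..<length ks} (set ks)" using ks by (intro bij_betw_nth) auto
  have "(\<Sum>l<length ks. v $ Mid (ks ! l) *\<^sub>R tvec 0 (axis (ks ! l) 1) (mean_curv ks (\<kappa>, g) x $ (ks ! l))) =
      (\<Sum>k\<in>set ks. v $ Mid k *\<^sub>R tvec 0 (axis k 1) (mean_curv ks (\<kappa>, g) x $ k))" (is "_ = ?s")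
    by (rule sum.reindex_bij_betw[OF bij])
  also have "?s = v"
  proof (rule tvec_eqI)
    show "?s $ Top = v $ Top" using v' by (simp add: sum_component)
    show "mid ?s = mid v"
      using v' by (simp add: mid_sum vec_eq_iff sum_component axis_def mid_nth if_distrib sum.delta cong: if_cong)
    have "(\<Sum>k\<in>set ks. v $ Mid k * mean_curv ks (\<kappa>, g) x $ k) = mid v \<bullet> mean_curv ks (\<kappa>, g) x"
      unfolding inner_vec_def using v' by (intro sum.mono_neutral_cong_left) (auto simp: mid_nth)
    then show "?s $ Bot = v $ Bot" using v' by (simp add: sum_component)
  qed
  finally show ?thesis by simp
qed

lemma tmetric_normal:
  assumes "\<kappa> \<in> A" "g \<in> c" "x \<in> cdom \<kappa>" and n: "n \<in> normal_bundle ks (\<kappa>, g) x"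
  shows "tmetric (\<kappa>, g) x v n = mid n \<bullet> (v $ Top *\<^sub>R mean_curv ks (\<kappa>, g) x + ginv (\<kappa>, g) x *v mid v)"
  using n[unfolded normal_bundle_iff[OF assms(1-3)]] ginv_inner[OF assms(1-3), of "mid v" "mid n"]
  by (simp add: tmetric_eq inner_add_right)

text \<open>\<open>ortho_proj\<close> is a definite description, so existence and uniqueness have to
  be established before its vanishing says anything. Normal tractors have first slot 0, so on them
  the tractor metric reduces to the inverse metric, which is positive definite.\<close>

lemma ortho_proj_zero:
  assumes kg: "\<kappa> \<in> A" "g \<in> c" "x \<in> cdom \<kappa>"
    and z: "ortho_proj (tmetric (\<kappa>, g) x) (normal_bundle ks (\<kappa>, g) x) v = 0" and n: "n \<in> normal_bundle ks (\<kappa>, g) x"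
  shows "tmetric (\<kappa>, g) x v n = 0"
proof -
  let ?K = "normal_bundle ks (\<kappa>, g) x" and ?b = "tmetric (\<kappa>, g) x"
  define H where "H = mean_curv ks (\<kappa>, g) x"
  define b where "b = v $ Top *\<^sub>R H + ginv (\<kappa>, g) x *v mid v"
  \<comment> \<open>\<open>tan_block\<close> puts the identity on the listed indices, so listing the
    complement of \<open>ks\<close> retains the normal block of the inverse metric.\<close>
  obtain ls where ls: "set ls = - set ks" using finite_list[of "- set ks"] by auto
  define M where "M = tan_block ls (ginv (\<kappa>, g) x)"
  have M: "det M \<noteq> 0" unfolding M_def by (rule posdef_det, rule tan_block_pos) (use ginv_pos[OF kg] in auto)
  define m where "m = matrix_inv M *v (\<chi> k. if k \<in> set ks then b $ k else 0)"
  have Mm: "(M *v m) $ k = (if k \<in> set ks then b $ k else 0)" for k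
    by (simp add: m_def matrix_vector_mul_assoc matrix_inv_inverts[OF M])
  have m0: "m $ j = 0" if "j \<notin> set ks" for j
    using Mm[of j] that ls by (simp add: M_def tan_block_def matrix_vector_mult_def if_distrib[of "\<lambda>x. x * _"] cong: if_cong)
  have Gm: "(ginv (\<kappa>, g) x *v m) $ k = b $ k" if "k \<in> set ks" for k
  proof -
    have "(ginv (\<kappa>, g) x *v m) $ k = (M *v m) $ k"
      unfolding M_def matrix_vector_mult_def using that ls m0
      by (auto simp: tan_block_def intro!: sum.cong)
    then show ?thesis using Mm[of k] that by simp
  qed
  define p where "p = tvec 0 m (m \<bullet> H)"
  have pK: "p \<in> ?K" using m0 by (simp add: normal_bundle_iff[OF kg] p_def H_def)
  have lin: "?b (w - w') n = ?b w n - ?b w' n" for w w' n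
    by (simp add: tmetric_eq algebra_simps inner_diff_left)
  have pv: "?b (v - p) n = 0" if n: "n \<in> ?K" for n
  proof -
    have "?b (v - p) n = mid n \<bullet> (b - ginv (\<kappa>, g) x *v m)"
      unfolding lin tmetric_normal[OF kg n] by (simp add: p_def b_def H_def inner_diff_right inner_add_right matrix_vector_mult_diff_distrib)
    also have "\<dots> = 0"
      unfolding inner_vec_def
    proof (intro sum.neutral ballI)
      fix k
      show "mid n $ k \<bullet> (b - ginv (\<kappa>, g) x *v m) $ k = 0"
        using n[unfolded normal_bundle_iff[OF kg]] Gm[of k] by (cases "k \<in> set ks") (auto simp: mid_nth)
    qed
    finally show ?thesis .
  qed
  have uniq: "q = p" if q: "q \<in> ?K" "\<forall>n\<in>?K. ?b (v - q) n = 0" for q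
  proof -
    have dK: "q - p \<in> ?K"
      using q(1) pK unfolding normal_bundle_iff[OF kg] by (simp add: inner_diff_left)
    have "?b (q - p) (q - p) = ?b (v - p) (q - p) - ?b (v - q) (q - p)" by (simp add: lin)
    also have "\<dots> = 0" using pv[OF dK] q(2) dK by simp
    finally have "mid (q - p) \<bullet> (ginv (\<kappa>, g) x *v mid (q - p)) = 0"
      using dK[unfolded normal_bundle_iff[OF kg]] by (simp add: tmetric_eq)
    then have "mid (q - p) = 0" using ginv_pos[OF kg, of "mid (q - p)"] by fastforce
    then have "q - p = 0" using dK[unfolded normal_bundle_iff[OF kg]] by (intro tvec_eqI) auto
    then show ?thesis by simp
  qed
  have "ortho_proj ?b ?K v = p"
    unfolding ortho_proj_def
  proof (rule the_equality)
    show "p \<in> ?K \<and> (\<forall>n\<in>?K. ?b (v - p) n = 0)" by (intro conjI pK ballI pv)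
    show "q = p" if "q \<in> ?K \<and> (\<forall>n\<in>?K. ?b (v - q) n = 0)" for q
      by (rule uniq[OF conjunct1[OF that] conjunct2[OF that]])
  qed
  then have "p = 0" using z by simp
  then show ?thesis using pv[OF n] by simp
qed

end


section \<open>Distinguished submanifolds\<close>

locale distinguished_submanifold = conformal_manifold A c
  for A :: "('m::topological_space, 'n::finite) chart set" and c :: "('m, 'n) metric set" +
  fixes ks :: "'n list" and \<Sigma> :: "'m set" and Q :: "('m, 'n) chart set" and N :: "('m, 'n, 'n tidx list \<Rightarrow> real) assoc"
  assumes submf: "oriented_submanifold A ks \<Sigma> Q"
    and dist: "distinguished A c ks \<Sigma> Q"
    and form: "tractor_normal_form A c ks \<Sigma> Q N"
begin

section \<open>Slice charts and the normal form in a gauge\<close>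

lemma ks_distinct: "distinct ks"
  using submf by (simp add: oriented_submanifold_def)

lemma slice_chart: "\<kappa> \<in> Q \<Longrightarrow> \<kappa> \<in> A"
  using submf by (auto simp: oriented_submanifold_def)

lemma slice_chart_exists: "x \<in> \<Sigma> \<Longrightarrow> \<exists>\<kappa>\<in>Q. x \<in> cdom \<kappa>"
  using submf by (auto simp: oriented_submanifold_def)

lemma slice_iff: "\<kappa> \<in> Q \<Longrightarrow> x \<in> cdom \<kappa> \<Longrightarrow> x \<in> \<Sigma> \<longleftrightarrow> (\<forall>k\<in>set ks. coord \<kappa> x $ k = 0)"
  using submf unfolding oriented_submanifold_def by blast

text \<open>The normal tractor of the vector dual to the coordinate covector number
  \<open>k\<close>, simplified as in \<open>normal_tractor_dual\<close>. Only the mean curvature in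
  it varies with the point.\<close>

definition normal_vec :: "('m, 'n) gauge \<Rightarrow> 'm \<Rightarrow> 'n \<Rightarrow> real^'n tidx" where
  "normal_vec \<gamma> x k = tvec 0 (axis k 1) (mean_curv ks \<gamma> x $ k)"

lemma
  assumes "x \<in> \<Sigma>" "u \<in> frames A c x"
  shows form_ext_power: "N x u \<in> ext_power (length ks)"
    and form_norm: "full_contraction (length ks) (N x u) (N x u) = fact (length ks)"
  using form assms unfolding tractor_normal_form_def by blast+

lemma form_wedge:
  assumes x: "x \<in> \<Sigma>" "u \<in> frames A c x" and k: "\<kappa> \<in> Q" "g \<in> c" "x \<in> cdom \<kappa>"
  obtains r where "r > 0"
    "ext_act (frame_mat (\<kappa>, g) u) (N x u) = (\<lambda>I. r * wedge (map (normal_vec (\<kappa>, g) x) ks) I)"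
    "N x u = (\<lambda>I. r * wedge (map (\<lambda>k. matrix_inv (frame_mat (\<kappa>, g) u) *v normal_vec (\<kappa>, g) x k) ks) I)"
proof -
  let ?F = "frame_mat (\<kappa>, g) u"
  obtain r where r: "r > 0" "ext_act ?F (N x u) =
      (\<lambda>I. r * wedge (map (\<lambda>k. normal_tractor ks (\<kappa>, g) x (matrix_inv (g \<kappa> (coord \<kappa> x)) *v axis k 1)) ks) I)"
    using form x k unfolding tractor_normal_form_def by blast
  have 1: "ext_act ?F (N x u) = (\<lambda>I. r * wedge (map (normal_vec (\<kappa>, g) x) ks) I)"
    using r(2) by (simp add: normal_tractor_dual[OF slice_chart[OF k(1)] k(2,3)] normal_vec_def[abs_def])
  have "det ?F \<noteq> 0" using frame_mat_det[OF x(2), of "(\<kappa>, g)"] slice_chart k by (auto simp: gauges_def)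
  then have "N x u = ext_act (matrix_inv ?F) (ext_act ?F (N x u))"
    by (simp add: ext_act_mult matrix_inv_inverts ext_act_one)
  also have "\<dots> = (\<lambda>I. r * wedge (map (\<lambda>k. matrix_inv ?F *v normal_vec (\<kappa>, g) x k) ks) I)"
    unfolding 1 ext_act_scale ext_act_wedge by (simp add: o_def)
  finally show ?thesis using that r(1) 1 by blast
qed

lemma normal_vec_in_bundle:
  assumes "\<kappa> \<in> A" "g \<in> c" "x \<in> cdom \<kappa>" "k \<in> set ks"
  shows "normal_vec (\<kappa>, g) x k \<in> normal_bundle ks (\<kappa>, g) x"
  unfolding normal_bundle_iff[OF assms(1-3)] normal_vec_def using assms(4) by (simp add: inner_axis') (auto simp: axis_def)

text \<open>The rows of \<open>F\<close> with index in \<open>ks\<close> provide the dual family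
  that \<open>wedge_annihilator\<close> requires.\<close>

lemma normal_vec_frame_dual:
  assumes "det F \<noteq> 0" "i < length ks" "j < length ks"
  shows "(F $ Mid (ks ! i)) \<bullet> (matrix_inv F *v normal_vec \<gamma> x (ks ! j)) = (if i = j then 1 else 0)"
proof -
  have "(F $ Mid (ks ! i)) \<bullet> (matrix_inv F *v normal_vec \<gamma> x (ks ! j)) = (F *v (matrix_inv F *v normal_vec \<gamma> x (ks ! j))) $ Mid (ks ! i)"
    by (simp add: matrix_vector_nth)
  also have "\<dots> = normal_vec \<gamma> x (ks ! j) $ Mid (ks ! i)"
    by (simp add: matrix_vector_mul_assoc matrix_inv_inverts[OF assms(1)])
  also have "\<dots> = (if i = j then 1 else 0)"
    using ks_distinct assms by (auto simp: normal_vec_def axis_def nth_eq_iff_index_eq)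
  finally show ?thesis .
qed

text \<open>The normal bundle in one slice gauge determines the one in any other, as both are given by the tractor
  normal form.\<close>

lemma normal_orthogonal_change:
  assumes x: "x \<in> \<Sigma>" and k: "\<kappa> \<in> Q" "\<kappa>' \<in> Q" "g \<in> c" "g' \<in> c" "x \<in> cdom \<kappa>" "x \<in> cdom \<kappa>'"
    and T: "T \<in> tractors A c x"
    and orth: "\<And>k. k \<in> set ks \<Longrightarrow> tmetric (\<kappa>, g) x (T (\<kappa>, g)) (normal_vec (\<kappa>, g) x k) = 0"
    and n: "n \<in> normal_bundle ks (\<kappa>', g') x"
  shows "tmetric (\<kappa>', g') x (T (\<kappa>', g')) n = 0"
proof -
  obtain u where u: "u \<in> frames A c x" using frames_nonempty by blast
  have \<gamma>: "(\<kappa>, g) \<in> gauges A c x" "(\<kappa>', g') \<in> gauges A c x" using k slice_chart by (auto simp: gauges_def)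
  let ?F = "frame_mat (\<kappa>, g) u" and ?F' = "frame_mat (\<kappa>', g') u"
  have d: "det ?F \<noteq> 0" "det ?F' \<noteq> 0" using frame_mat_det[OF u \<gamma>(1)] frame_mat_det[OF u \<gamma>(2)] by simp_all
  \<comment> \<open>The components of \<open>T\<close> in the frame \<open>u\<close>, which are the
    same in both gauges.\<close>
  define v where "v = matrix_inv ?F *v T (\<kappa>, g)"
  have Fv: "?F *v v = T (\<kappa>, g)" by (simp add: v_def matrix_vector_mul_assoc matrix_inv_inverts[OF d(1)])
  have "u v = T"
    by (rule tractors_eqI[OF frame_tractors[OF u \<gamma>(1)] T \<gamma>(1)]) (simp add: Fv flip: frame_mat_works[OF u \<gamma>(1)])
  then have F'v: "?F' *v v = T (\<kappa>', g')" by (simp add: frame_mat_works[OF u \<gamma>(2)])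
  \<comment> \<open>Carries the orthogonality conditions to the model space, where the two wedge
    products can be compared.\<close>
  have pull: "tmetric \<delta> x (frame_mat \<delta> u *v v) w = (Hmat *v v) \<bullet> (matrix_inv (frame_mat \<delta> u) *v w)"
    if "\<delta> \<in> gauges A c x" "det (frame_mat \<delta> u) \<noteq> 0" for \<delta> w
  proof -
    have "tmetric \<delta> x (frame_mat \<delta> u *v v) (frame_mat \<delta> u *v (matrix_inv (frame_mat \<delta> u) *v w)) = hform v (matrix_inv (frame_mat \<delta> u) *v w)"
      by (rule frame_mat_hform[OF u that(1)])
    moreover have "hform v z = (Hmat *v v) \<bullet> z" for z
      unfolding hform_sym[of v z] hform_Hmat[of z v] by (rule inner_commute)
    moreover have "frame_mat \<delta> u *v (matrix_inv (frame_mat \<delta> u) *v w) = w"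
      by (simp add: matrix_vector_mul_assoc matrix_inv_inverts[OF that(2)])
    ultimately show ?thesis by (simp only:)
  qed
  obtain r where r: "r > 0" "N x u = (\<lambda>I. r * wedge (map (\<lambda>k. matrix_inv ?F *v normal_vec (\<kappa>, g) x k) ks) I)"
    using form_wedge[OF x u k(1,3,5)] by blast
  obtain r' where r': "r' > 0" "N x u = (\<lambda>I. r' * wedge (map (\<lambda>k. matrix_inv ?F' *v normal_vec (\<kappa>', g') x k) ks) I)"
    using form_wedge[OF x u k(2,4,6)] by blast
  have z: "tmetric (\<kappa>', g') x (T (\<kappa>', g')) (normal_vec (\<kappa>', g') x (ks ! j)) = 0" if j: "j < length ks" for j
  proof -
    have "(Hmat *v v) \<bullet> (map (\<lambda>k. matrix_inv ?F' *v normal_vec (\<kappa>', g') x k) ks ! j) = 0"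
    proof (rule wedge_annihilator)
      show "(\<lambda>I. r * wedge (map (\<lambda>k. matrix_inv ?F *v normal_vec (\<kappa>, g) x k) ks) I) =
          (\<lambda>I. r' * wedge (map (\<lambda>k. matrix_inv ?F' *v normal_vec (\<kappa>', g') x k) ks) I)"
        using r(2) r'(2) by simp
      show "?F' $ Mid (ks ! i) \<bullet> (map (\<lambda>k. matrix_inv ?F' *v normal_vec (\<kappa>', g') x k) ks ! j) = (if i = j then 1 else 0)"
        if "i < length ks" "j < length ks" for i j
        using normal_vec_frame_dual[OF d(2) that] that by simp
      show "(Hmat *v v) \<bullet> (map (\<lambda>k. matrix_inv ?F *v normal_vec (\<kappa>, g) x k) ks ! j) = 0" if "j < length ks" for j
        using pull[OF \<gamma>(1) d(1), of "normal_vec (\<kappa>, g) x (ks ! j)"] orth[of "ks ! j"] that by (simp add: Fv)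
    qed (use r'(1) j in auto)
    then show ?thesis using pull[OF \<gamma>(2) d(2), of "normal_vec (\<kappa>', g') x (ks ! j)"] j by (simp add: F'v)
  qed
  have lin: "linear (tmetric (\<kappa>', g') x (T (\<kappa>', g')))"
    unfolding tmetric_eq by (rule linearI) (auto simp: algebra_simps inner_add_right matrix_vector_right_distrib matrix_vector_mult_scaleR)
  have "n = (\<Sum>l<length ks. n $ Mid (ks ! l) *\<^sub>R normal_vec (\<kappa>', g') x (ks ! l))"
    unfolding normal_vec_def by (rule normal_bundle_expand[OF slice_chart[OF k(2)] k(4,6) n ks_distinct])
  then have "tmetric (\<kappa>', g') x (T (\<kappa>', g')) n =
      tmetric (\<kappa>', g') x (T (\<kappa>', g')) (\<Sum>l<length ks. n $ Mid (ks ! l) *\<^sub>R normal_vec (\<kappa>', g') x (ks ! l))"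
    by (rule arg_cong)
  also have "\<dots> = 0" by (simp add: linear_sum[OF lin] linear_scale[OF lin] z)
  finally show ?thesis .
qed

text \<open>Moving a tangential coordinate leaves the coordinates in \<open>ks\<close> at 0.\<close>

lemma slice_line:
  assumes "\<kappa> \<in> Q" "x \<in> \<Sigma>" "x \<in> cdom \<kappa>" "i \<notin> set ks"
  shows "\<forall>\<^sub>F t in nhds 0. coord \<kappa> x + t *\<^sub>R axis i 1 \<in> coord \<kappa> ` cdom \<kappa> \<and>
    cinv \<kappa> (coord \<kappa> x + t *\<^sub>R axis i 1) \<in> cdom \<kappa> \<and> cinv \<kappa> (coord \<kappa> x + t *\<^sub>R axis i 1) \<in> \<Sigma>"
proof -
  note k = slice_chart[OF assms(1)]
  have "((\<lambda>t. coord \<kappa> x + t *\<^sub>R axis i 1) \<longlongrightarrow> coord \<kappa> x + 0 *\<^sub>R axis i 1) (nhds 0)" by (intro tendsto_intros filterlim_ident)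
  then have lim: "((\<lambda>t. coord \<kappa> x + t *\<^sub>R axis i 1) \<longlongrightarrow> coord \<kappa> x) (nhds 0)" by simp
  have "\<forall>\<^sub>F t in nhds 0. coord \<kappa> x + t *\<^sub>R axis i 1 \<in> coord \<kappa> ` cdom \<kappa>"
    by (rule topological_tendstoD[OF lim chart_open(2)[OF k] imageI[OF assms(3)]])
  then show ?thesis
  proof eventually_elim
    case (elim t)
    have "(coord \<kappa> x + t *\<^sub>R axis i 1) $ k = 0" if "k \<in> set ks" for k
      using slice_iff[OF assms(1,3)] assms(2,4) that by (auto simp: axis_def)
    then show ?case
      using elim slice_iff[OF assms(1) cinv_cdom[OF k elim]] cinv_cdom[OF k elim] coord_cinv[OF k elim] by simp
  qed
qed

text \<open>The hypothesis on the submanifold concerns tractor fields, so \<open>v\<close> is first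
  extended to one over the chart domain. Its premise asks for orthogonality in every slice gauge,
  which \<open>normal_orthogonal_change\<close> derives from the gauge at hand.\<close>

lemma distinguished_normal_part:
  assumes k: "\<kappa> \<in> Q" and g: "g \<in> c" and v: "smooth_on (coord \<kappa> ` cdom \<kappa>) v"
    and orth: "\<And>x k. x \<in> \<Sigma> \<Longrightarrow> x \<in> cdom \<kappa> \<Longrightarrow> k \<in> set ks \<Longrightarrow>
      tmetric (\<kappa>, g) x (v (coord \<kappa> x)) (normal_vec (\<kappa>, g) x k) = 0"
    and x: "x \<in> \<Sigma>" "x \<in> cdom \<kappa>" and i: "i \<notin> set ks" and n: "n \<in> normal_bundle ks (\<kappa>, g) x"
  shows "tmetric (\<kappa>, g) x (pd i v (coord \<kappa> x) + conn_matrix (g \<kappa>) (coord \<kappa> x) i (v (coord \<kappa> x))) n = 0"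
proof -
  note kA = slice_chart[OF k]
  define V where "V x = extend (\<kappa>, g) x (v (coord \<kappa> x))" for x
  have gau: "(\<kappa>, g) \<in> gauges A c x" if "x \<in> cdom \<kappa>" for x using kA g that by (simp add: gauges_def)
  have Vself: "V x (\<kappa>, g) = v (coord \<kappa> x)" if "x \<in> cdom \<kappa>" for x
    unfolding V_def by (rule extend_self[OF gau[OF that]])
  have "tractor_field A c (cdom \<kappa>) V" unfolding V_def by (rule extend_field[OF kA g v])
  moreover have "tmetric (\<kappa>', g') x (V x (\<kappa>', g')) n = 0"
    if "\<kappa>' \<in> Q" "g' \<in> c" "x \<in> \<Sigma> \<inter> cdom \<kappa> \<inter> cdom \<kappa>'" "n \<in> normal_bundle ks (\<kappa>', g') x" for \<kappa>' g' x n
  proof (rule normal_orthogonal_change[OF _ k that(1) g that(2) _ _ _ _ that(4)])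
    show "V x \<in> tractors A c x" unfolding V_def using that by (intro extend_tractors gau) auto
    show "tmetric (\<kappa>, g) x (V x (\<kappa>, g)) (normal_vec (\<kappa>, g) x k) = 0" if "k \<in> set ks" for k
      using orth[of x k] that \<open>x \<in> \<Sigma> \<inter> cdom \<kappa> \<inter> cdom \<kappa>'\<close> by (simp add: Vself)
  qed (use that in auto)
  ultimately have "tractor_second_ff ks (\<kappa>, g) V i x = 0"
    using dist[unfolded distinguished_def, rule_format, of "cdom \<kappa>" V \<kappa> g x i] chart_open(1)[OF kA] k g x i by blast
  then have "tmetric (\<kappa>, g) x (tnabla (\<kappa>, g) V i x) n = 0"
    unfolding tractor_second_ff_def by (rule ortho_proj_zero[OF kA g x(2) _ n])
  moreover have "pd i (\<lambda>z. V (cinv \<kappa> z) (\<kappa>, g)) (coord \<kappa> x) = pd i v (coord \<kappa> x)"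
    by (rule pd_cong[OF chart_open(2)[OF kA] imageI[OF x(2)] v, symmetric])
      (use Vself cinv_cdom[OF kA] coord_cinv[OF kA] in simp)
  ultimately show ?thesis unfolding tnabla_eq by (simp add: Vself[OF x(2)])
qed

lemma normal_vec_smooth:
  assumes "\<kappa> \<in> A" "g \<in> c"
  shows "smooth_on (coord \<kappa> ` cdom \<kappa>) (\<lambda>y. normal_vec (\<kappa>, g) (cinv \<kappa> y) k)"
  unfolding normal_vec_def
  by (intro smooth_on_tvec smooth_on_const smooth_on_nth mean_curv_smooth[OF assms] chart_open[OF assms(1)])

text \<open>The tractor connection preserves the orthogonal complement of the normal bundle along a distinguished
  submanifold. It is metric, so that it preserves the normal bundle as well. The complement is spanned by the
  three families of fields used below.\<close>

lemma normal_vec_derivative: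
  assumes k: "\<kappa> \<in> Q" and g: "g \<in> c" and x: "x \<in> \<Sigma>" "x \<in> cdom \<kappa>" and i: "i \<notin> set ks" and kk: "kk \<in> set ks"
  shows "pd i (\<lambda>y. normal_vec (\<kappa>, g) (cinv \<kappa> y) kk) (coord \<kappa> x) +
    conn_matrix (g \<kappa>) (coord \<kappa> x) i (normal_vec (\<kappa>, g) x kk) \<in> normal_bundle ks (\<kappa>, g) x" (is "?z \<in> _")
proof -
  note kA = slice_chart[OF k]
  let ?D = "coord \<kappa> ` cdom \<kappa>" and ?y = "coord \<kappa> x"
  have y: "?y \<in> ?D" using x by simp
  note D = chart_open(2)[OF kA]
  \<comment> \<open>Differentiate the vanishing pairing of \<open>v\<close> with the normal vector:
    the derivative of \<open>v\<close> contributes nothing by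
    \<open>distinguished_normal_part\<close>, so the other term vanishes too.\<close>
  have perp: "tmetric (\<kappa>, g) x (v ?y) ?z = 0"
    if v: "smooth_on ?D v" and orth: "\<And>x k. x \<in> \<Sigma> \<Longrightarrow> x \<in> cdom \<kappa> \<Longrightarrow> k \<in> set ks \<Longrightarrow>
      tmetric (\<kappa>, g) x (v (coord \<kappa> x)) (normal_vec (\<kappa>, g) x k) = 0" for v
  proof -
    note d1 = smooth_on_pd_derivative[OF v y, of i]
    note d2 = smooth_on_pd_derivative[OF normal_vec_smooth[OF kA g, of kk] y, of i]
    have "\<forall>\<^sub>F t in nhds 0. tmetric (\<kappa>, g) (cinv \<kappa> (?y + t *\<^sub>R axis i 1)) (v (?y + t *\<^sub>R axis i 1))
        (normal_vec (\<kappa>, g) (cinv \<kappa> (?y + t *\<^sub>R axis i 1)) kk) = 0"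
      using slice_line[OF k x i]
    proof eventually_elim
      case (elim t)
      then show ?case using orth[of "cinv \<kappa> (?y + t *\<^sub>R axis i 1)" kk] kk coord_cinv[OF kA] by simp
    qed
    then have "((\<lambda>t. tmetric (\<kappa>, g) (cinv \<kappa> (?y + t *\<^sub>R axis i 1)) (v (?y + t *\<^sub>R axis i 1))
        (normal_vec (\<kappa>, g) (cinv \<kappa> (?y + t *\<^sub>R axis i 1)) kk)) has_real_derivative 0) (at 0)"
      by (subst DERIV_cong_ev[where g = "\<lambda>t. 0"]) auto
    from DERIV_unique[OF tnabla_metric[OF kA g x(2) d1 d2] this]
    have "tmetric (\<kappa>, g) x (pd i v ?y + conn_matrix (g \<kappa>) ?y i (v ?y)) (normal_vec (\<kappa>, g) x kk) +
        tmetric (\<kappa>, g) x (v ?y) ?z = 0"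
      by (simp add: cinv_coord[OF kA x(2)])
    moreover have "tmetric (\<kappa>, g) x (pd i v ?y + conn_matrix (g \<kappa>) ?y i (v ?y)) (normal_vec (\<kappa>, g) x kk) = 0"
      by (rule distinguished_normal_part[OF k g v orth x i normal_vec_in_bundle[OF kA g x(2) kk]])
    ultimately show ?thesis by simp
  qed
  have gl: "(g \<kappa> (coord \<kappa> x) *v a) \<bullet> (ginv (\<kappa>, g) x *v b) = a \<bullet> b" if "x \<in> cdom \<kappa>" for x a b
    using metric_inner[OF kA g that, of "ginv (\<kappa>, g) x *v b" a] ginv_right[OF kA g that, of b] by (simp add: inner_commute)
  \<comment> \<open>Pairing \<open>?z\<close> with \<open>v1\<close>, \<open>v2 j\<close> and
    \<open>v3\<close> gives its first slot, its component \<open>j\<close> and the defect in the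
    condition on its last slot. The mean curvature in \<open>v3\<close> makes it orthogonal to the
    normal vectors.\<close>
  define v1 where "v1 y = (tvec 0 0 1 :: real^'n tidx)" for y :: "real^'n"
  define v2 where "v2 j y = tvec 0 (g \<kappa> y *v axis j 1) 0" for j y
  define v3 where "v3 y = tvec 1 (- (g \<kappa> y *v mean_curv ks (\<kappa>, g) (cinv \<kappa> y))) 0" for y
  have "tmetric (\<kappa>, g) x (v1 ?y) ?z = 0"
    by (rule perp) (auto simp: v1_def tmetric_eq normal_vec_def intro: smooth_on_const D)
  then have "?z $ Top = 0" by (simp add: v1_def tmetric_eq)
  moreover have "?z $ Mid j = 0" if j: "j \<notin> set ks" for j
  proof -
    have "tmetric (\<kappa>, g) x (v2 j ?y) ?z = 0"
    proof (rule perp)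
      show "smooth_on ?D (v2 j)" unfolding v2_def
        by (intro smooth_on_tvec smooth_on_const smooth_on_matrix_vector_mult metric_smooth kA g D)
      show "tmetric (\<kappa>, g) x (v2 j (coord \<kappa> x)) (normal_vec (\<kappa>, g) x k) = 0" if "x \<in> cdom \<kappa>" "k \<in> set ks" for x k
        using j that by (auto simp: tmetric_eq v2_def normal_vec_def gl inner_axis_axis)
    qed
    then show ?thesis by (simp add: v2_def tmetric_eq gl[OF x(2)] inner_axis' mid_nth)
  qed
  moreover have "?z $ Bot = mid ?z \<bullet> mean_curv ks (\<kappa>, g) x"
  proof -
    have "tmetric (\<kappa>, g) x (v3 ?y) ?z = 0"
    proof (rule perp)
      show "smooth_on ?D v3" unfolding v3_def
        by (intro smooth_on_tvec smooth_on_const smooth_on_minus smooth_on_matrix_vector_mult metric_smooth mean_curv_smooth kA g D)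
      show "tmetric (\<kappa>, g) x (v3 (coord \<kappa> x)) (normal_vec (\<kappa>, g) x k) = 0" if "x \<in> cdom \<kappa>" "k \<in> set ks" for x k
        using that by (simp add: tmetric_eq v3_def normal_vec_def gl cinv_coord[OF kA] inner_axis)
    qed
    then show ?thesis by (simp add: v3_def tmetric_eq gl[OF x(2)] cinv_coord[OF kA x(2)] inner_commute)
  qed
  ultimately show ?thesis unfolding normal_bundle_iff[OF kA g x(2)] by blast
qed

text \<open>Constant vectors read in the frame have constant pairings, so the metric property of the
  connection makes \<omega> skew, hence the velocity of a curve in the group.\<close>

lemma conn_form_props:
  fixes i :: 'n
  assumes k: "\<kappa> \<in> A" and g: "g \<in> c" and x: "x \<in> cdom \<kappa>"
    and F: "smooth_on (coord \<kappa> ` cdom \<kappa>) F" "frame_field A c (cdom \<kappa>) u"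
      "\<And>x v. x \<in> cdom \<kappa> \<Longrightarrow> u x v (\<kappa>, g) = F (coord \<kappa> x) *v v"
  defines "y \<equiv> coord \<kappa> x" and "\<omega> \<equiv> conn_form (\<kappa>, g) u i x"
  shows "F y *v (\<omega> *v v) = pd i F y *v v + conn_matrix (g \<kappa>) y i (F y *v v)"
    and "hform (\<omega> *v v) w + hform v (\<omega> *v w) = 0"
proof -
  let ?D = "coord \<kappa> ` cdom \<kappa>"
  note D = chart_open(2)[OF k]
  have y: "y \<in> ?D" using x by (simp add: y_def)
  have fr: "u x \<in> frames A c x" if "x \<in> cdom \<kappa>" for x using F(2) that by (simp add: frame_field_def)
  have gau: "(\<kappa>, g) \<in> gauges A c x" if "x \<in> cdom \<kappa>" for x using k g that by (simp add: gauges_def)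
  have fm: "frame_mat (\<kappa>, g) (u x) = F (coord \<kappa> x)" if "x \<in> cdom \<kappa>" for x
    by (rule matrix_eq[THEN iffD2]) (simp add: frame_mat_works[OF fr[OF that] gau[OF that]] F(3)[OF that])
  have d: "det (F y) \<noteq> 0" using frame_mat_det[OF fr[OF x] gau[OF x]] fm[OF x] by (simp add: y_def)
  have F': "((\<lambda>t. F (y + t *\<^sub>R axis i 1)) has_vector_derivative pd i F y) (at 0)"
    by (rule smooth_on_pd_derivative[OF F(1) y])
  have dF: "((\<lambda>t. F (y + t *\<^sub>R axis i 1) *v v) has_vector_derivative pd i F y *v v) (at 0)" for v
    using has_vector_derivative_matrix_vector_mult[OF F' has_vector_derivative_const[of v]] by simp
  have pdF: "pd i (\<lambda>z. u (cinv \<kappa> z) v (\<kappa>, g)) y = pd i F y *v v" for v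
  proof -
    have "pd i (\<lambda>z. u (cinv \<kappa> z) v (\<kappa>, g)) y = pd i (\<lambda>z. F z *v v) y"
      by (rule pd_cong[OF D y, symmetric])
        (use F cinv_cdom[OF k] coord_cinv[OF k] in \<open>auto intro!: smooth_on_matrix_vector_mult smooth_on_const D\<close>)
    also have "\<dots> = pd i F y *v v"
      unfolding pd_def[of i "\<lambda>z. F z *v v"] by (rule vector_derivative_at[OF dF])
    finally show ?thesis .
  qed
  define Z where "Z v = pd i F y *v v + conn_matrix (g \<kappa>) y i (F y *v v)" for v
  have tn: "tnabla (\<kappa>, g) (\<lambda>z. u z v) i x = Z v" for v
    unfolding tnabla_eq Z_def using pdF by (simp add: F(3)[OF x] y_def)
  have "linear Z" unfolding Z_def
    by (intro linear_compose_add matrix_vector_mul_linear linear_compose[OF matrix_vector_mul_linear[of "F y"] linear_conn_matrix, unfolded o_def])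
  then have lin: "linear (\<lambda>v. matrix_inv (F y) *v Z v)"
    using linear_compose[OF _ matrix_vector_mul_linear[of "matrix_inv (F y)"], of Z] by (simp add: o_def)
  have "\<omega> *v v = matrix_inv (F y) *v Z v" for v
    unfolding \<omega>_def conn_form_def tn fm[OF x] y_def[symmetric] by (rule matrix_linear_works[OF lin])
  then have \<omega>: "F y *v (\<omega> *v v) = Z v" for v
    by (simp add: matrix_vector_mul_assoc matrix_inv_inverts[OF d])
  then show "F y *v (\<omega> *v v) = pd i F y *v v + conn_matrix (g \<kappa>) y i (F y *v v)" by (simp add: Z_def)
  have F_hform: "tmetric (\<kappa>, g) x (F (coord \<kappa> x) *v v) (F (coord \<kappa> x) *v w) = hform v w" if "x \<in> cdom \<kappa>" for x v w
    using frame_mat_hform[OF fr[OF that] gau[OF that]] by (simp add: fm[OF that])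
  have "((\<lambda>t. y + t *\<^sub>R axis i 1) \<longlongrightarrow> y + 0 *\<^sub>R axis i 1) (nhds 0)" by (intro tendsto_intros filterlim_ident)
  then have "\<forall>\<^sub>F t in nhds 0. y + t *\<^sub>R axis i 1 \<in> ?D"
    using topological_tendstoD[OF _ D] y by simp
  then have "\<forall>\<^sub>F t in nhds 0. tmetric (\<kappa>, g) (cinv \<kappa> (y + t *\<^sub>R axis i 1)) (F (y + t *\<^sub>R axis i 1) *v v) (F (y + t *\<^sub>R axis i 1) *v w) = hform v w"
  proof eventually_elim
    case (elim t)
    show ?case using F_hform[OF cinv_cdom[OF k elim]] by (simp add: coord_cinv[OF k elim])
  qed
  then have "((\<lambda>t. tmetric (\<kappa>, g) (cinv \<kappa> (y + t *\<^sub>R axis i 1)) (F (y + t *\<^sub>R axis i 1) *v v) (F (y + t *\<^sub>R axis i 1) *v w)) has_real_derivative 0) (at 0)"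
    by (subst DERIV_cong_ev[where g = "\<lambda>t. hform v w"]) auto
  from DERIV_unique[OF tnabla_metric[OF k g x dF[unfolded y_def] dF[unfolded y_def], folded y_def] this]
  have "tmetric (\<kappa>, g) x (Z v) (F y *v w) + tmetric (\<kappa>, g) x (F y *v v) (Z w) = 0" by (simp add: Z_def)
  then show "hform (\<omega> *v v) w + hform v (\<omega> *v w) = 0"
    unfolding \<omega>[symmetric] using F_hform[OF x] by (simp add: y_def)
qed

end


section \<open>First integrals\<close>

context distinguished_submanifold begin

text \<open>Equivariance is derived, not postulated: in a slice gauge both sides are positive
  multiples of the same wedge product, and they have equal norms because \<open>p\<close> preserves
  contractions.\<close>

lemma form_transition:
  assumes x: "x \<in> \<Sigma>" and u: "u \<in> frames A c x" "u' \<in> frames A c x" and p: "p \<in> Ggrp"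
    and mat: "\<And>\<gamma>. \<gamma> \<in> gauges A c x \<Longrightarrow> frame_mat \<gamma> u' = frame_mat \<gamma> u ** p"
  shows "N x u = ext_act p (N x u')"
proof -
  obtain \<kappa> where k: "\<kappa> \<in> Q" "x \<in> cdom \<kappa>" using slice_chart_exists[OF x] by blast
  obtain g where g: "g \<in> c" using conf unfolding conformal_class_def by blast
  have \<gamma>: "(\<kappa>, g) \<in> gauges A c x" using k g slice_chart by (simp add: gauges_def)
  let ?F = "frame_mat (\<kappa>, g) u" and ?w = "wedge (map (normal_vec (\<kappa>, g) x) ks)"
  let ?fc = "full_contraction (length ks)"
  obtain r where r: "r > 0" "ext_act ?F (N x u) = (\<lambda>I. r * ?w I)"
    using form_wedge[OF x u(1) k(1) g k(2)] by blast
  obtain r' where r': "r' > 0" "ext_act (frame_mat (\<kappa>, g) u') (N x u') = (\<lambda>I. r' * ?w I)"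
    using form_wedge[OF x u(2) k(1) g k(2)] by blast
  have d: "det ?F \<noteq> 0" using frame_mat_det[OF u(1) \<gamma>] by simp
  have "ext_act ?F (ext_act p (N x u')) = (\<lambda>I. (r' / r) * ext_act ?F (N x u) I)"
    using r' r(1) by (simp add: ext_act_mult mat[OF \<gamma>] r(2))
  also have "\<dots> = ext_act ?F (\<lambda>I. (r' / r) * N x u I)" by (rule ext_act_scale[symmetric])
  finally have "ext_act (matrix_inv ?F) (ext_act ?F (ext_act p (N x u'))) = ext_act (matrix_inv ?F) (ext_act ?F (\<lambda>I. (r' / r) * N x u I))"
    by (rule arg_cong)
  then have e: "ext_act p (N x u') = (\<lambda>I. (r' / r) * N x u I)"
    by (simp add: ext_act_mult[of "matrix_inv ?F"] matrix_inv_inverts[OF d] ext_act_one)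
  have "fact (length ks) = ?fc (ext_act p (N x u')) (ext_act p (N x u'))"
    by (simp add: full_contraction_invariant[OF Ggrp_O_h[OF p]] form_norm[OF x u(2)])
  also have "\<dots> = (r' / r)\<^sup>2 * fact (length ks)"
    unfolding e full_contraction_scale form_norm[OF x u(1)] by (simp add: power2_eq_square)
  finally have "(r' / r)\<^sup>2 = 1" by simp
  then have "r' / r = 1" using r(1) r'(1) by (simp add: power2_eq_1_iff) (smt (verit) divide_pos_pos)
  then show ?thesis using e by simp
qed

text \<open>The normal vectors read in the frame satisfy the hypothesis of
  \<open>normalised_wedge_derivative\<close>: their covariant derivatives are normal, which gives
  the combination with coefficients \<open>a\<close>, and the change of the frame gives the term
  with \<omega>.\<close>

lemma normal_form_frame_derivative:
  fixes i :: 'n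
  assumes k: "\<kappa> \<in> Q" and g: "g \<in> c"
    and F: "smooth_on (coord \<kappa> ` cdom \<kappa>) F" "frame_field A c (cdom \<kappa>) u"
      "\<And>x v. x \<in> cdom \<kappa> \<Longrightarrow> u x v (\<kappa>, g) = F (coord \<kappa> x) *v v"
    and x: "x \<in> \<Sigma>" "x \<in> cdom \<kappa>" and i: "i \<notin> set ks"
    and C: "\<And>t. C t \<in> O_h" "C 0 = mat 1" "(C has_vector_derivative - conn_form (\<kappa>, g) u i x) (at (0::real))"
  defines "X \<equiv> \<lambda>t. cinv \<kappa> (coord \<kappa> x + t *\<^sub>R axis i 1)"
  shows "same_jet (\<lambda>t. N (X t) (u (X t)) I) (\<lambda>t. ext_act (C t) (N x (u x)) I)"
proof -
  note kA = slice_chart[OF k]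
  let ?D = "coord \<kappa> ` cdom \<kappa>"
  note D = chart_open(2)[OF kA]
  define y where "y = coord \<kappa> x"
  define d where "d = length ks"
  define \<omega> where "\<omega> = conn_form (\<kappa>, g) u i x"
  have y: "y \<in> ?D" using x by (simp add: y_def)
  have X0: "X 0 = x" by (simp add: X_def cinv_coord[OF kA x(2)])
  have fr: "u x \<in> frames A c x" if "x \<in> cdom \<kappa>" for x using F(2) that by (simp add: frame_field_def)
  have gau: "(\<kappa>, g) \<in> gauges A c x" if "x \<in> cdom \<kappa>" for x using kA g that by (simp add: gauges_def)
  have fm: "frame_mat (\<kappa>, g) (u x) = F (coord \<kappa> x)" if "x \<in> cdom \<kappa>" for x
    by (rule matrix_eq[THEN iffD2]) (simp add: frame_mat_works[OF fr[OF that] gau[OF that]] F(3)[OF that])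
  have dF: "det (F y) \<noteq> 0" if "y \<in> ?D" for y
    using frame_mat_det[OF fr[OF cinv_cdom[OF kA that]] gau[OF cinv_cdom[OF kA that]]] fm[OF cinv_cdom[OF kA that]]
    by (simp add: coord_cinv[OF kA that])
  define n where "n t = map (\<lambda>k. matrix_inv (F (y + t *\<^sub>R axis i 1)) *v normal_vec (\<kappa>, g) (X t) k) ks" for t
  have near: "\<forall>\<^sub>F t in nhds 0. y + t *\<^sub>R axis i 1 \<in> ?D \<and> X t \<in> cdom \<kappa> \<and> X t \<in> \<Sigma>"
    using slice_line[OF k x i] by (simp add: y_def X_def)
  define z where "z k = pd i (\<lambda>y. normal_vec (\<kappa>, g) (cinv \<kappa> y) k) y + conn_matrix (g \<kappa>) y i (normal_vec (\<kappa>, g) x k)" for k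
  define a where "a k l = z (ks ! k) $ Mid (ks ! l)" for k l
  \<comment> \<open>Chosen separately for each parameter, with no regularity claimed.\<close>
  define r where "r t = (SOME r. r > 0 \<and> N (X t) (u (X t)) = (\<lambda>I. r * wedge (n t) I))" for t
  have der: "((\<lambda>t. n t ! j) has_vector_derivative (\<Sum>l<d. a j l *\<^sub>R (n 0 ! l)) - \<omega> *v (n 0 ! j)) (at 0)" if j: "j < d" for j
  proof -
    let ?k = "ks ! j"
    define w where "w t = normal_vec (\<kappa>, g) (X t) ?k" for t
    define Fi where "Fi t = matrix_inv (F (y + t *\<^sub>R axis i 1))" for t
    have nj: "n t ! j = Fi t *v w t" for t using j by (simp add: n_def d_def w_def Fi_def)
    have w': "(w has_vector_derivative pd i (\<lambda>y. normal_vec (\<kappa>, g) (cinv \<kappa> y) ?k) y) (at 0)"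
      unfolding w_def X_def y_def[symmetric] by (rule smooth_on_pd_derivative[OF normal_vec_smooth[OF kA g] y])
    have Fi': "(Fi has_vector_derivative pd i (\<lambda>y. matrix_inv (F y)) y) (at 0)"
      unfolding Fi_def by (rule smooth_on_pd_derivative[OF smooth_on_matrix_inv[OF D F(1) dF] y])
    \<comment> \<open>Differentiability comes from the inverse matrix, but the value is found by
      differentiating \<open>F\<close> times the vector, which is \<open>w\<close>; the derivative
      of the inverse does not enter it.\<close>
    obtain n' where n': "((\<lambda>t. n t ! j) has_vector_derivative n') (at 0)"
      unfolding nj using has_vector_derivative_matrix_vector_mult[OF Fi' w'] by blast
    have "((\<lambda>t. F (y + t *\<^sub>R axis i 1) *v (n t ! j)) has_vector_derivative
        F (y + 0 *\<^sub>R axis i 1) *v n' + pd i F y *v (n 0 ! j)) (at 0)"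
      by (rule has_vector_derivative_matrix_vector_mult[OF smooth_on_pd_derivative[OF F(1) y] n'])
    moreover have Fn: "F (y + t *\<^sub>R axis i 1) *v (n t ! j) = w t" if "y + t *\<^sub>R axis i 1 \<in> ?D" for t
      unfolding nj Fi_def by (simp add: matrix_vector_mul_assoc matrix_inv_inverts[OF dF[OF that]])
    have "\<forall>\<^sub>F t in nhds 0. F (y + t *\<^sub>R axis i 1) *v (n t ! j) = w t"
      using near by eventually_elim (simp add: Fn)
    ultimately have "(w has_vector_derivative F y *v n' + pd i F y *v (n 0 ! j)) (at 0)"
      by (subst (asm) has_vector_derivative_cong_ev) (auto dest: eventually_nhds_x_imp_x)
    from vector_derivative_unique_at[OF w' this]
    have e: "pd i (\<lambda>y. normal_vec (\<kappa>, g) (cinv \<kappa> y) ?k) y = F y *v n' + pd i F y *v (n 0 ! j)" .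
    have w0: "normal_vec (\<kappa>, g) x ?k = F y *v (n 0 ! j)" using Fn[of 0] y by (simp add: w_def X0)
    have "F y *v (\<omega> *v (n 0 ! j)) = pd i F y *v (n 0 ! j) + conn_matrix (g \<kappa>) y i (F y *v (n 0 ! j))"
      unfolding \<omega>_def y_def by (rule conn_form_props(1)[OF kA g x(2) F])
    then have zj: "z ?k = F y *v n' + F y *v (\<omega> *v (n 0 ! j))"
      unfolding z_def e w0 by simp
    have "z ?k \<in> normal_bundle ks (\<kappa>, g) x"
      unfolding z_def y_def using j by (intro normal_vec_derivative[OF k g x i]) (simp add: d_def)
    then have "z ?k = (\<Sum>l<d. a j l *\<^sub>R normal_vec (\<kappa>, g) x (ks ! l))"
      unfolding a_def d_def normal_vec_def by (rule normal_bundle_expand[OF kA g x(2) _ ks_distinct])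
    then have "matrix_inv (F y) *v (F y *v n' + F y *v (\<omega> *v (n 0 ! j))) =
        matrix_inv (F y) *v (\<Sum>l<d. a j l *\<^sub>R normal_vec (\<kappa>, g) x (ks ! l))" by (simp add: zj)
    moreover have "matrix_inv (F y) *v (F y *v q) = q" for q
      by (simp add: matrix_vector_mul_assoc matrix_inv_inverts[OF dF[OF y]])
    moreover have "matrix_inv (F y) *v (\<Sum>l<d. a j l *\<^sub>R normal_vec (\<kappa>, g) x (ks ! l)) = (\<Sum>l<d. a j l *\<^sub>R (n 0 ! l))"
      unfolding linear_sum[OF matrix_vector_mul_linear] linear_scale[OF matrix_vector_mul_linear]
      by (intro sum.cong) (auto simp: n_def X0 d_def)
    ultimately have "n' + \<omega> *v (n 0 ! j) = (\<Sum>l<d. a j l *\<^sub>R (n 0 ! l))"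
      by (simp add: matrix_vector_right_distrib)
    then have "n' = (\<Sum>l<d. a j l *\<^sub>R (n 0 ! l)) - \<omega> *v (n 0 ! j)" by (simp add: eq_diff_eq)
    then show ?thesis using n' by simp
  qed
  have ev: "\<forall>\<^sub>F t in nhds 0. N (X t) (u (X t)) = (\<lambda>I. r t * wedge (n t) I) \<and> r t > 0 \<and>
      full_contraction d (N (X t) (u (X t))) (N (X t) (u (X t))) = fact d"
    using near
  proof eventually_elim
    case (elim t)
    then have Xt: "X t \<in> cdom \<kappa>" "X t \<in> \<Sigma>" and cX: "coord \<kappa> (X t) = y + t *\<^sub>R axis i 1"
      using coord_cinv[OF kA] by (auto simp: X_def y_def)
    have "\<exists>r>0. N (X t) (u (X t)) = (\<lambda>I. r * wedge (n t) I)"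
      using form_wedge[OF Xt(2) fr[OF Xt(1)] k g Xt(1)] unfolding fm[OF Xt(1)] cX n_def by blast
    then have "r t > 0 \<and> N (X t) (u (X t)) = (\<lambda>I. r t * wedge (n t) I)"
      unfolding r_def by (rule someI_ex[of "\<lambda>r. r > 0 \<and> N (X t) (u (X t)) = (\<lambda>I. r * wedge (n t) I)"])
    then show ?case using form_norm[OF Xt(2) fr[OF Xt(1)]] unfolding d_def by blast
  qed
  have len: "length (n t) = d" for t by (simp add: n_def d_def)
  obtain E where "\<And>I. ((\<lambda>t. N (X t) (u (X t)) I) has_real_derivative E I) (at 0)"
    "\<And>I. ((\<lambda>t. ext_act (C t) (N (X 0) (u (X 0))) I) has_real_derivative E I) (at 0)"
    by (rule normalised_wedge_derivative[OF len der ev C(1,2) C(3)[folded \<omega>_def]]) blast+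
  then show ?thesis unfolding same_jet_def by (auto simp: X0 C(2) ext_act_one)
qed

end

text \<open>In a frame field, vanishing of \<open>nabla\<close> says that the partial derivative is
  minus the action of the connection matrix, which is the velocity of the orbit along
  \<open>C\<close>.\<close>

lemma parallel_frame_derivative:
  assumes "conformal_manifold A c" and rep: "representation \<rho> V" and par: "parallel A c \<rho> V S"
    and k: "\<kappa> \<in> A" "g \<in> c" and u: "frame_field A c (cdom \<kappa>) u" and x: "x \<in> cdom \<kappa>"
    and C: "\<And>t. C t \<in> Ggrp" "C 0 = mat 1" "(C has_vector_derivative - conn_form (\<kappa>, g) u i x) (at (0::real))"
  defines "X \<equiv> \<lambda>t. cinv \<kappa> (coord \<kappa> x + t *\<^sub>R axis i 1)"
  shows "same_jet (\<lambda>t. S (X t) (u (X t)) \<bullet> e) (\<lambda>t. \<rho> (C t) (S x (u x)) \<bullet> e)"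
proof -
  interpret conformal_manifold A c by fact
  let ?D = "coord \<kappa> ` cdom \<kappa>"
  define s where "s y = S (cinv \<kappa> y) (u (cinv \<kappa> y))" for y
  have sec: "tractor_section A c \<rho> V S" using par by (simp add: parallel_def)
  have X0: "X 0 = x" by (simp add: X_def cinv_coord[OF k(1) x])
  have "msmooth A (cdom \<kappa>) (\<lambda>x. S x (u x))" using sec u unfolding tractor_section_def by blast
  then have "smooth_on (coord \<kappa> ` (cdom \<kappa> \<inter> cdom \<kappa>)) ((\<lambda>x. S x (u x)) \<circ> cinv \<kappa>)"
    unfolding msmooth_def using k(1) by blast
  then have "smooth_on ?D s" by (simp add: s_def[abs_def] o_def)
  from smooth_on_pd_derivative[OF this imageI[OF x], of i]
  have 1: "((\<lambda>t. S (X t) (u (X t))) has_vector_derivative pd i s (coord \<kappa> x)) (at 0)" by (simp add: s_def X_def)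
  have "nabla \<rho> (\<kappa>, g) u S i x = 0"
  proof -
    have "(\<kappa>, g) \<in> gauges A c x" using k x by (simp add: gauges_def)
    then show ?thesis using par u x unfolding parallel_def by blast
  qed
  then have "pd i s (coord \<kappa> x) = - drep \<rho> (conn_form (\<kappa>, g) u i x) (S x (u x))"
    by (simp add: nabla_def s_def[abs_def] eq_neg_iff_add_eq_0)
  with 1 have d1: "((\<lambda>t. S (X t) (u (X t))) has_vector_derivative - drep \<rho> (conn_form (\<kappa>, g) u i x) (S x (u x))) (at 0)" by simp
  have "u x \<in> frames A c x" using u x by (simp add: frame_field_def)
  then have Sx: "S x (u x) \<in> V" using sec unfolding tractor_section_def by blast
  have d2: "((\<lambda>t. \<rho> (C t) (S x (u x))) has_vector_derivative - drep \<rho> (conn_form (\<kappa>, g) u i x) (S x (u x))) (at 0)"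
    by (rule drep_uminus_curve[OF rep Sx C])
  have "\<rho> (C 0) (S x (u x)) = S x (u x)" using rep Sx C(2) by (simp add: representation_def)
  then show ?thesis
    unfolding same_jet_def has_real_derivative_iff_has_vector_derivative
    using bounded_linear.has_vector_derivative[OF bounded_linear_inner_left d1, of e]
      bounded_linear.has_vector_derivative[OF bounded_linear_inner_left d2, of e] by (auto simp: X0)
qed

section \<open>Assembling the first integral\<close>

locale first_integral = distinguished_submanifold A c ks \<Sigma> Q N
  for A :: "('m::topological_space, 'n::finite) chart set" and c :: "('m, 'n) metric set"
    and ks \<Sigma> Q N +
  fixes k :: nat and m :: "nat \<Rightarrow> nat" and \<rho> :: "nat \<Rightarrow> ('n, 'v::euclidean_space) rep" and V :: "nat \<Rightarrow> 'v set"
    and S :: "nat \<Rightarrow> ('m, 'n, 'v) assoc" and \<phi> :: "('n, 'v) tensor \<Rightarrow> real"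
  assumes rep: "\<And>i. i \<in> {1..k} \<Longrightarrow> representation (\<rho> i) (V i)"
    and par: "\<And>i. i \<in> {1..k} \<Longrightarrow> parallel A c (\<rho> i) (V i) (S i)"
    and inv: "invariant_functional (length ks) k m \<rho> V \<phi>"
begin

definition integral_at :: "'m \<Rightarrow> ('m, 'n) frame \<Rightarrow> real" where
  "integral_at x u = \<phi> (sym_prod k m (\<lambda>j. N x u) (\<lambda>i j. S i x u))"

text \<open>The frame is an arbitrary choice; \<open>integral_at_frame\<close> shows that over the
  submanifold the value is independent of it.\<close>

definition first_int :: "'m \<Rightarrow> real" where
  "first_int x = integral_at x (SOME u. u \<in> frames A c x)"

lemma section_mem: "i \<in> {1..k} \<Longrightarrow> u \<in> frames A c x \<Longrightarrow> S i x u \<in> V i"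
  using par[of i] unfolding parallel_def tractor_section_def by blast

lemma section_equivariant:
  "i \<in> {1..k} \<Longrightarrow> u \<in> frames A c x \<Longrightarrow> p \<in> Pgrp \<Longrightarrow> S i x (frame_act u p) = \<rho> i (matrix_inv p) (S i x u)"
  using par[of i] unfolding parallel_def tractor_section_def by blast

text \<open>A change of frame acts by one and the same \<open>p\<close> on the normal form and on
  all sections, so invariance of \<phi> applies.\<close>

lemma integral_at_frame:
  assumes x: "x \<in> \<Sigma>" and u: "u \<in> frames A c x" "u' \<in> frames A c x"
  shows "integral_at x u = integral_at x u'"
proof -
  obtain p q where p: "p \<in> Ggrp" and q: "q \<in> Pgrp" "u = frame_act u' q" "matrix_inv q = p"
    and mat: "\<And>\<gamma>. \<gamma> \<in> gauges A c x \<Longrightarrow> frame_mat \<gamma> u' = frame_mat \<gamma> u ** p"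
    by (rule frame_transition[OF u]) blast
  have "N x u = ext_act p (N x u')" by (rule form_transition[OF x u p mat])
  moreover have "S i x u = \<rho> i p (S i x u')" if "i \<in> {1..k}" for i
    using section_equivariant[OF that u(2) q(1)] q(2,3) by simp
  ultimately have "sym_prod k m (\<lambda>j. N x u) (\<lambda>i j. S i x u) = sym_prod k m (\<lambda>j. ext_act p (N x u')) (\<lambda>i j. \<rho> i p (S i x u'))"
    by (simp add: sym_prod_def)
  then show ?thesis
    unfolding integral_at_def
    using invariant_functionalD(3)[OF inv p, of "\<lambda>j. N x u'" "\<lambda>i j. S i x u'"]
      form_ext_power[OF x u(2)] section_mem[OF _ u(2)] by simp
qed

lemma first_int_eq: "x \<in> \<Sigma> \<Longrightarrow> u \<in> frames A c x \<Longrightarrow> first_int x = integral_at x u"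
  unfolding first_int_def by (rule integral_at_frame[OF _ someI[of "\<lambda>u. u \<in> frames A c x"]])

lemma first_int_derivative:
  assumes k: "\<kappa> \<in> Q" and x: "x \<in> \<Sigma>" "x \<in> cdom \<kappa>" and i: "i \<notin> set ks"
  shows "((\<lambda>t. first_int (cinv \<kappa> (coord \<kappa> x + t *\<^sub>R axis i 1))) has_real_derivative 0) (at 0)"
proof -
  note kA = slice_chart[OF k]
  obtain g where g: "g \<in> c" using conf unfolding conformal_class_def by blast
  obtain F u where F: "smooth_on (coord \<kappa> ` cdom \<kappa>) F" "frame_field A c (cdom \<kappa>) u"
    "\<And>x v. x \<in> cdom \<kappa> \<Longrightarrow> u x v (\<kappa>, g) = F (coord \<kappa> x) *v v"
    by (rule moving_frame[OF kA g]) blast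
  have fr: "u x \<in> frames A c x" if "x \<in> cdom \<kappa>" for x using F(2) that by (simp add: frame_field_def)
  define \<omega> where "\<omega> = conn_form (\<kappa>, g) u i x"
  have "hform ((- \<omega>) *v v) w + hform v ((- \<omega>) *v w) = 0" for v w
  proof -
    have "(- \<omega>) *v z = - (\<omega> *v z)" for z by (simp add: matrix_vector_mult_def vec_eq_iff sum_negf)
    then show ?thesis using conn_form_props(2)[OF kA g x(2) F, of i v w] by (simp add: hform_simps \<omega>_def)
  qed
  \<comment> \<open>The curve belongs to the single point \<open>x\<close>, where only its velocity
    matters; no parallel transport along the coordinate line is constructed.\<close>
  then obtain C where C: "\<And>t. C t \<in> Ggrp" "C 0 = mat 1" "(C has_vector_derivative - \<omega>) (at (0::real))"
    by (rule skew_curve_Ggrp) blast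
  define X where "X t = cinv \<kappa> (coord \<kappa> x + t *\<^sub>R axis i 1)" for t
  have X0: "X 0 = x" by (simp add: X_def cinv_coord[OF kA x(2)])
  have near: "\<forall>\<^sub>F t in nhds 0. X t \<in> cdom \<kappa> \<and> X t \<in> \<Sigma>"
    using slice_line[OF k x i] by (auto simp: X_def elim: eventually_mono)
  have "((\<lambda>t. \<phi> (sym_prod k m (\<lambda>j. N (X t) (u (X t))) (\<lambda>i j. S i (X t) (u (X t))))) has_real_derivative 0) (at 0)"
  proof (rule invariant_functional_derivative_zero[OF inv _ _ C(1), where w = "\<lambda>t. N (X t) (u (X t))" and v = "\<lambda>i t. S i (X t) (u (X t))"])
    show "subspace (V i)" if "i \<in> {1..k}" for i using rep[OF that] by (simp add: representation_def)
    show "\<forall>\<^sub>F t in nhds 0. N (X t) (u (X t)) \<in> ext_power (length ks) \<and> (\<forall>i\<in>{1..k}. S i (X t) (u (X t)) \<in> V i)"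
      using near by eventually_elim (auto intro: form_ext_power section_mem fr)
    show "\<rho> i (C t) (S i (X 0) (u (X 0))) \<in> V i" if "i \<in> {1..k}" for i t
      using rep[OF that] C(1)[of t] section_mem[OF that fr[OF x(2)]] unfolding representation_def X0 by blast
    show "same_jet (\<lambda>t. N (X t) (u (X t)) I) (\<lambda>t. ext_act (C t) (N (X 0) (u (X 0))) I)" for I
      unfolding X0 unfolding X_def
      by (rule normal_form_frame_derivative[OF k g F x i Ggrp_O_h[OF C(1)] C(2) C(3)[unfolded \<omega>_def]])
    show "same_jet (\<lambda>t. S i' (X t) (u (X t)) \<bullet> e) (\<lambda>t. \<rho> i' (C t) (S i' (X 0) (u (X 0))) \<bullet> e)" if "i' \<in> {1..k}" for i' e
      unfolding X0 unfolding X_def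
      by (rule parallel_frame_derivative[OF conformal_manifold_axioms rep[OF that] par[OF that] kA g F(2) x(2) C(1,2) C(3)[unfolded \<omega>_def]])
  qed
  moreover have "\<forall>\<^sub>F t in nhds 0. first_int (X t) = \<phi> (sym_prod k m (\<lambda>j. N (X t) (u (X t))) (\<lambda>i j. S i (X t) (u (X t))))"
    using near
  proof eventually_elim
    case (elim t)
    show ?case using first_int_eq[OF conjunct2[OF elim] fr[OF conjunct1[OF elim]]] by (simp add: integral_at_def)
  qed
  ultimately show ?thesis unfolding X_def[symmetric] by (subst DERIV_cong_ev) auto
qed

text \<open>Moving one tangential coordinate at a time.\<close>

lemma first_int_locally_constant:
  assumes x0: "x0 \<in> \<Sigma>"
  obtains W where "open W" "x0 \<in> W" "\<And>x. x \<in> \<Sigma> \<inter> W \<Longrightarrow> first_int x = first_int x0"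
proof -
  obtain \<kappa> where k: "\<kappa> \<in> Q" and x0k: "x0 \<in> cdom \<kappa>" using slice_chart_exists[OF x0] by blast
  note kA = slice_chart[OF k]
  define y0 where "y0 = coord \<kappa> x0"
  obtain e where e: "e > 0" "ball y0 e \<subseteq> coord \<kappa> ` cdom \<kappa>"
    using openE[OF chart_open(2)[OF kA] imageI[OF x0k]] by (auto simp: y0_def)
  define h where "h y = first_int (cinv \<kappa> y)" for y
  \<comment> \<open>Induction on a set \<open>J\<close> containing the coordinates in which
    \<open>y\<close> differs from \<open>y0\<close>. The normal ones never differ, being 0 in
    both.\<close>
  have main: "h y = h y0" if "y \<in> ball y0 e" "\<And>k. k \<in> set ks \<Longrightarrow> y $ k = 0" "{j. y $ j \<noteq> y0 $ j} \<subseteq> J" for J y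
    using finite[of J] that
  proof (induction J arbitrary: y rule: finite_induct)
    case empty
    then have "y = y0" by (auto simp: vec_eq_iff)
    then show ?case by simp
  next
    case (insert j J)
    have y00: "y0 $ k = 0" if "k \<in> set ks" for k using slice_iff[OF k x0k] x0 that by (simp add: y0_def)
    show ?case
    proof (cases "y $ j = y0 $ j")
      case True
      then show ?thesis using insert.prems by (intro insert.IH) auto
    next
      case False
      then have j: "j \<notin> set ks" using insert.prems(2) y00 by metis
      define \<delta> where "\<delta> = y0 $ j - y $ j"
      define y' where "y' = y + \<delta> *\<^sub>R axis j 1"
      have y'n: "y' $ l = (if l = j then y0 $ j else y $ l)" for l by (simp add: y'_def \<delta>_def axis_def)
      \<comment> \<open>Making one more coordinate agree with \<open>y0\<close> cannot increase the
        distance, so \<open>y'\<close> lies in the ball, and so does the segment to it by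
        convexity.\<close>
      have "dist y0 y' \<le> dist y0 y"
        unfolding dist_norm norm_vec_def
        by (rule L2_set_mono) (auto simp: y'n)
      then have y'b: "y' \<in> ball y0 e" using insert.prems(1) by simp
      have seg: "y + s *\<^sub>R axis j 1 \<in> ball y0 e" if s: "s \<in> closed_segment 0 \<delta>" for s
      proof -
        obtain t where t: "0 \<le> t" "t \<le> 1" "s = t * \<delta>" using s by (auto simp: closed_segment_def)
        have "y + s *\<^sub>R axis j 1 = (1 - t) *\<^sub>R y + t *\<^sub>R y'" by (simp add: y'_def t algebra_simps)
        then have "y + s *\<^sub>R axis j 1 \<in> closed_segment y y'" using t by (auto simp: closed_segment_def)
        then show ?thesis using insert.prems(1) y'b convex_ball[of y0 e] closed_segment_subset by blast
      qed
      have "((\<lambda>s. h (y + s *\<^sub>R axis j 1)) has_field_derivative 0) (at s within closed_segment 0 \<delta>)"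
        if s: "s \<in> closed_segment 0 \<delta>" for s
      proof -
        define x where "x = cinv \<kappa> (y + s *\<^sub>R axis j 1)"
        have ys: "y + s *\<^sub>R axis j 1 \<in> coord \<kappa> ` cdom \<kappa>" using seg[OF s] e by blast
        have x: "x \<in> cdom \<kappa>" "coord \<kappa> x = y + s *\<^sub>R axis j 1"
          unfolding x_def by (rule cinv_cdom[OF kA ys], rule coord_cinv[OF kA ys])
        have "x \<in> \<Sigma>" unfolding slice_iff[OF k x(1)] x(2) using insert.prems(2) j by (auto simp: axis_def)
        from first_int_derivative[OF k this x(1) j]
        have "((\<lambda>t. h (y + (t + s) *\<^sub>R axis j 1)) has_real_derivative 0) (at 0)"
          by (simp add: x(2) h_def algebra_simps)
        then have "((\<lambda>t. h (y + t *\<^sub>R axis j 1)) has_real_derivative 0) (at (0 + s))"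
          by (subst DERIV_shift)
        then show ?thesis by (auto intro: has_field_derivative_at_within)
      qed
      then have "\<exists>q. \<forall>s\<in>closed_segment 0 \<delta>. h (y + s *\<^sub>R axis j 1) = q"
        by (rule has_field_derivative_zero_constant[OF convex_closed_segment])
      then obtain q where q: "\<forall>s\<in>closed_segment 0 \<delta>. h (y + s *\<^sub>R axis j 1) = q" by (elim exE)
      have "h y = h y'" using bspec[OF q, of 0] bspec[OF q, of \<delta>] by (simp add: y'_def)
      also have "h y' = h y0"
        by (rule insert.IH[OF y'b]) (use insert.prems(2,3) j in \<open>auto simp: y'n\<close>)
      finally show ?thesis .
    qed
  qed
  define W where "W = cdom \<kappa> \<inter> coord \<kappa> -` ball y0 e"
  have "continuous_on (cdom \<kappa>) (coord \<kappa>)" using chart_homeo[OF kA] by (simp add: homeomorphism_def)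
  then have "open W" unfolding W_def by (intro continuous_open_preimage chart_open(1)[OF kA]) auto
  moreover have "x0 \<in> W" using x0k e(1) by (simp add: W_def y0_def)
  moreover have "first_int x = first_int x0" if x: "x \<in> \<Sigma> \<inter> W" for x
  proof -
    have xk: "x \<in> cdom \<kappa>" using x by (simp add: W_def)
    have "h (coord \<kappa> x) = h y0"
      by (rule main[of _ UNIV]) (use x slice_iff[OF k xk] in \<open>auto simp: W_def\<close>)
    then show ?thesis by (simp add: h_def y0_def cinv_coord[OF kA xk] cinv_coord[OF kA x0k])
  qed
  ultimately show ?thesis using that by blast
qed

lemma first_int_constant_on:
  assumes "C \<in> components \<Sigma>"
  shows "first_int constant_on C"
proof (rule locally_constant_imp_constant)
  show "connected C" using assms by (rule in_components_connected)
  fix x0 assume x0: "x0 \<in> C"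
  have sub: "C \<subseteq> \<Sigma>" using assms by (rule in_components_subset)
  obtain W where W: "open W" "x0 \<in> W" "\<And>x. x \<in> \<Sigma> \<inter> W \<Longrightarrow> first_int x = first_int x0"
    using first_int_locally_constant x0 sub by blast
  show "\<exists>T. openin (top_of_set C) T \<and> x0 \<in> T \<and> (\<forall>x\<in>T. first_int x = first_int x0)"
    by (rule exI[of _ "C \<inter> W"]) (use W x0 sub in \<open>auto intro: openin_open_Int\<close>)
qed

end

theorem theorem6p3:
  fixes A :: "('m::{t2_space, second_countable_topology}, 'n::finite) chart set"
    and c :: "('m, 'n) metric set"
    and d k :: nat
    and m :: "nat \<Rightarrow> nat"
    and \<rho> :: "nat \<Rightarrow> ('n, 'v::euclidean_space) rep"
    and V :: "nat \<Rightarrow> 'v set"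
    and \<sigma> :: "nat \<Rightarrow> ('m, 'n, 'v set) assoc"
    and S :: "nat \<Rightarrow> ('m, 'n, 'v) assoc"
    and \<phi> :: "('n, 'v) tensor \<Rightarrow> real"
    and ks :: "'n list"
    and \<Sigma> :: "'m set"
    and Q :: "('m, 'n) chart set"
    and N :: "('m, 'n, 'n tidx list \<Rightarrow> real) assoc"
  assumes "CARD('n) \<ge> 3"
    and "connected (UNIV :: 'm set)"
    and "oriented_smooth_structure A"
    and "conformal_class A c"
    and "1 \<le> d" and "d \<le> CARD('n) - 1"
    and "\<And>i. i \<in> {1..k} \<Longrightarrow> irreducible_rep (\<rho> i) (V i)"
    and "\<And>i. i \<in> {1..k} \<Longrightarrow> normal_solution A c (\<rho> i) (V i) (\<sigma> i)"
    and "\<And>i. i \<in> {1..k} \<Longrightarrow> corresponding_tractor A c (\<rho> i) (V i) (\<sigma> i) (S i)"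
    and "invariant_functional d k m \<rho> V \<phi>"
    and "oriented_submanifold A ks \<Sigma> Q" and "length ks = d"
    and "distinguished A c ks \<Sigma> Q"
    and "tractor_normal_form A c ks \<Sigma> Q N"
  shows "\<exists>f :: 'm \<Rightarrow> real.
     (\<forall>x\<in>\<Sigma>. \<forall>u\<in>frames A c x. f x = \<phi> (sym_prod k m (\<lambda>j. N x u) (\<lambda>i j. S i x u))) \<and>
     (\<forall>C\<in>components \<Sigma>. f constant_on C)"
proof -
  interpret first_integral A c ks \<Sigma> Q N k m \<rho> V S \<phi>
  proof
    show "representation (\<rho> i) (V i)" if "i \<in> {1..k}" for i
      using assms(7)[OF that] by (simp add: irreducible_rep_def)
    show "parallel A c (\<rho> i) (V i) (S i)" if "i \<in> {1..k}" for i
      using assms(9)[OF that] by (simp add: corresponding_tractor_def)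
    show "invariant_functional (length ks) k m \<rho> V \<phi>" using assms(10,12) by simp
  qed (rule assms)+
  show ?thesis
    by (intro exI[of _ first_int] conjI ballI first_int_constant_on) (rule first_int_eq[unfolded integral_at_def])
qed

end
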